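(* Let $C=B_R(0)\subset\mathbb{R}^N$ and let $f,g$ be radial. Assume moreover that $g$ is strictly positive and that the function $\rho\mapsto\rho^{N-1}g(\rho)$ is strictly increasing on $[R,\infty)$. (1) If $\Omega$ solves $\mathcal{QS}(f,g)$, then $\Omega$ is a concentric ball $B_{R^*}(0)$ with $R^*>R$. (2) A radial solution of $\mathcal{QS}(f,g)$ (i.e. a solution which is a ball centred at the origin) exists if and only if $$\int_C f\,dx>\int_{\partial C}g\,d\sigma .$$
   Context: $D\subset\mathbb{R}^N$ is a fixed bounded domain containing all admissible domains (the paper takes $N=2,3$). $f$ and $g$ are positive functions in $L^2(\mathbb{R}^N)$, $f$ has compact support with nonempty interior, and $C$ is the convex hull of $\operatorname{supp} f$ (here assumed to be the ball $B_R(0)$). Radial means $f(x)=\tilde f(|x|)$, $g(x)=\tilde g(|x|)$; we write $g(\rho)$ for $\tilde g(\rho)$. Problem $\mathcal{QS}(f,g)$: find an open set $\Omega\subset D$ strictly containing $C$ such that the solution $u_\Omega$ of $-\Delta u_\Omega=f$ in $\Omega$, $u_\Omega=0$ on $\partial\Omega$, satisfies $|\nabla u_\Omega|=g$ on $\partial\Omega$. Such an $\Omega$ is said to solve $\mathcal{QS}(f,g)$.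
   Formalization: The "if" half of (2) is proved assuming also that g is continuous on [R,∞) and that some ball B_ρ(0) inside D, ρ>R, has ∫_C f ≤ ∫_{∂B_ρ} g (without these it fails); g is required to be in L² only on D. *)

theory Defs
  imports "HOL-Analysis.Analysis"
begin

definition L2_on :: "(real^'n) set \<Rightarrow> (real^'n \<Rightarrow> real) \<Rightarrow> bool" where
  "L2_on S h \<longleftrightarrow>
     set_borel_measurable lebesgue S h \<and> set_integrable lebesgue S (\<lambda>x. (h x)\<^sup>2)"

text \<open>The support of an \<open>L\<^sup>2\<close> function, i.e. the complement of the largest open set on which it
  vanishes almost everywhere.\<close>

definition ess_support :: "(real^'n \<Rightarrow> real) \<Rightarrow> (real^'n) set" where
  "ess_support h = - \<Union>{U. open U \<and> (AE x in lebesgue. x \<in> U \<longrightarrow> h x = 0)}"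

definition partial_deriv :: "'n \<Rightarrow> (real^'n \<Rightarrow> real) \<Rightarrow> real^'n \<Rightarrow> real" where
  "partial_deriv i \<phi> x = frechet_derivative \<phi> (at x) (axis i 1)"

definition laplacian :: "(real^'n \<Rightarrow> real) \<Rightarrow> real^'n \<Rightarrow> real" where
  "laplacian \<phi> x = (\<Sum>i\<in>UNIV. partial_deriv i (partial_deriv i \<phi>) x)"

primrec Ck :: "nat \<Rightarrow> (real^'n \<Rightarrow> real) \<Rightarrow> bool" where
  "Ck 0 \<phi> \<longleftrightarrow> continuous_on UNIV \<phi>"
| "Ck (Suc k) \<phi> \<longleftrightarrow> (\<forall>x. \<phi> differentiable at x) \<and> (\<forall>i. Ck k (partial_deriv i \<phi>))"

definition test_function :: "(real^'n) set \<Rightarrow> (real^'n \<Rightarrow> real) \<Rightarrow> bool" where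
  "test_function \<Omega> \<phi> \<longleftrightarrow>
     (\<forall>k. Ck k \<phi>) \<and> compact (closure {x. \<phi> x \<noteq> 0}) \<and> closure {x. \<phi> x \<noteq> 0} \<subseteq> \<Omega>"

text \<open>As \<open>f\<close> is only square integrable, the equation \<open>- \<Delta>u = f\<close> is meant in the sense of
  distributions.  In dimension at most 3 a distributional solution with right-hand side in
  \<open>L\<^sup>2\<close> has a continuous representative; this representative attains the boundary value 0
  continuously.  On a bounded open set there is at most one such \<open>u\<close> (up to its irrelevant
  values outside the closure).\<close>

definition dirichlet_solution ::
  "(real^'n) set \<Rightarrow> (real^'n \<Rightarrow> real) \<Rightarrow> (real^'n \<Rightarrow> real) \<Rightarrow> bool" where
  "dirichlet_solution \<Omega> f u \<longleftrightarrow>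
     continuous_on (closure \<Omega>) u \<and>
     (\<forall>x\<in>frontier \<Omega>. u x = 0) \<and>
     (\<forall>\<phi>. test_function \<Omega> \<phi> \<longrightarrow>
        - (LINT x:\<Omega>|lebesgue. u x * laplacian \<phi> x) = (LINT x:\<Omega>|lebesgue. f x * \<phi> x))"

text \<open>\<open>|\<nabla>u| = g\<close> on the boundary: \<open>u\<close> is differentiable in \<open>\<Omega>\<close> near every boundary point \<open>x\<close>,
  and \<open>|\<nabla>u|\<close> tends to \<open>g x\<close> there.\<close>

definition boundary_gradient_norm ::
  "(real^'n) set \<Rightarrow> (real^'n \<Rightarrow> real) \<Rightarrow> (real^'n \<Rightarrow> real) \<Rightarrow> bool" where
  "boundary_gradient_norm \<Omega> u g \<longleftrightarrow>
     (\<exists>G :: real^'n \<Rightarrow> real^'n. \<forall>x\<in>frontier \<Omega>.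
        (\<forall>\<^sub>F y in at x within \<Omega>. GDERIV u y :> G y) \<and>
        ((\<lambda>y. norm (G y)) \<longlongrightarrow> g x) (at x within \<Omega>))"

definition solves_QS ::
  "(real^'n) set \<Rightarrow> (real^'n \<Rightarrow> real) \<Rightarrow> (real^'n \<Rightarrow> real) \<Rightarrow> (real^'n) set \<Rightarrow> bool" where
  "solves_QS D f g \<Omega> \<longleftrightarrow>
     open \<Omega> \<and> \<Omega> \<subseteq> D \<and> convex hull (ess_support f) \<subset> \<Omega> \<and>
     (\<exists>u. dirichlet_solution \<Omega> f u \<and> boundary_gradient_norm \<Omega> u g)"

text \<open>Surface measure on the sphere of radius \<open>r > 0\<close> about the origin of \<open>\<real>\<^sup>N\<close>: the measure of
  \<open>A\<close> is \<open>N / r\<close> times the volume of the cone \<open>{t a | a \<in> A, 0 < t < 1}\<close>.\<close>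

definition sphere_measure :: "real \<Rightarrow> (real^'n) measure" where
  "sphere_measure r =
     distr (density lborel (\<lambda>x. ennreal (real CARD('n) / r) * indicator (ball 0 r) x))
       borel (\<lambda>x. (r / norm x) *\<^sub>R x)"

definition sphere_integral :: "real \<Rightarrow> (real^'n \<Rightarrow> real) \<Rightarrow> real" where
  "sphere_integral r h = (LINT x:sphere 0 r|sphere_measure r. h x)"

end

theory Submission
  imports Defs "HOL-Computational_Algebra.Polynomial"
begin

text \<open>For \<open>r > R\<close> the ball \<open>B\<^sub>r\<close> carries the explicit potential
  \<open>w\<^sub>r(x) = \<integral> f(y) k\<^sub>r(max |x| |y|) dy\<close>, where \<open>k\<^sub>r\<close> is the fundamental solution normalised to vanish
  at \<open>r\<close>; its boundary gradient is \<open>(\<integral>f) / (\<sigma> r\<^sup>N\<^sup>-\<^sup>1)\<close>. Given a solution \<open>\<Omega>\<close>, let \<open>B\<^bsub>r1\<^esub>\<close> be the largest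
  centred ball inside \<open>\<Omega>\<close> and \<open>B\<^bsub>r2\<^esub>\<close> the smallest one containing it. Comparing \<open>u\<close> with the two
  potentials and looking at the contact points yields
  \<open>\<sigma> r2\<^sup>N\<^sup>-\<^sup>1 g(r2) \<le> \<integral>f \<le> \<sigma> r1\<^sup>N\<^sup>-\<^sup>1 g(r1)\<close>, so monotonicity forces \<open>r1 = r2\<close>. Existence is then
  the intermediate value theorem for \<open>\<sigma> r\<^sup>N\<^sup>-\<^sup>1 g(r) = \<integral>f\<close>.\<close>


section \<open>Smooth bumps\<close>

text \<open>The solution \<open>u\<close> is merely continuous and \<open>f\<close> merely square
  integrable, so classical maximum principles and a Hopf lemma do not apply to \<open>u\<close>:
  each comparison has to be extracted from integrals against test functions, and explicit bumps
  supply these. Square integrability of \<open>f\<close> suffices for a continuous potential because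
  in dimensions 2 and 3 the kernel is locally square integrable. The delicate point is that the
  potential satisfies the weak equation. Fubini reduces this to replacing \<open>\<phi>\<close> by
  its spherical means under the weight \<open>f\<close>. The profile of \<open>f\<close> is only
  Lebesgue measurable, so instead of polar coordinates the means are tested on complements of balls,
  where they are computed by the divergence theorem in the form of integration by parts for
  Lipschitz functions. At an inner contact point the segment towards the origin stays in the domain,
  so the mean value theorem bounds \<open>u\<close> from above. At an outer contact point the domain
  need not contain any ball touching there, and a penalised maximum takes over.\<close>

definition flat :: "real poly \<Rightarrow> real \<Rightarrow> real" where
  "flat p t = (if 0 < t then poly p (1 / t) * exp (- (1 / t)) else 0)"

lemma poly_times_exp_neg_tendsto_0:
  fixes p :: "real poly"
  shows "((\<lambda>x. poly p x * exp (- x)) \<longlongrightarrow> 0) at_top"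
proof -
  have "((\<lambda>x. \<Sum>i\<le>degree p. coeff p i * (x ^ i / exp x)) \<longlongrightarrow> (\<Sum>i\<le>degree p. coeff p i * 0)) at_top"
    by (intro tendsto_sum tendsto_mult tendsto_const tendsto_power_div_exp_0)
  then show ?thesis
    by (simp add: poly_altdef sum_distrib_right exp_minus divide_inverse mult.assoc)
qed

lemma flat_tendsto_0: "((\<lambda>t. flat p t) \<longlongrightarrow> 0) (at_right 0)"
proof -
  have "((\<lambda>t. poly p (inverse t) * exp (- inverse t)) \<longlongrightarrow> 0) (at_right (0::real))"
    using filterlim_compose[OF poly_times_exp_neg_tendsto_0 filterlim_inverse_at_top_right] .
  then show ?thesis
    by (rule Lim_transform_eventually)
       (auto simp: flat_def inverse_eq_divide eventually_at_right_less intro: eventually_mono[OF eventually_at_right_less])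
qed

text \<open>The derivative of p(1/t) exp(-1/t) is t^(-2) (p - p')(1/t) exp(-1/t), and t^(-2) is the
  polynomial X^2 at 1/t: admitting arbitrary polynomial factors makes the family closed under
  differentiation. At 0, dividing by \<open>h\<close> multiplies the polynomial by X, so the
  right-hand limit is again \<open>flat_tendsto_0\<close>.\<close>

lemma flat_has_derivative:
  "(flat p has_real_derivative flat ([:0, 0, 1:] * (p - pderiv p)) t) (at t)"
proof -
  consider "t > 0" | "t < 0" | "t = 0" by linarith
  then show ?thesis
  proof cases
    case 1
    have "((\<lambda>t. poly p (1 / t) * exp (- (1 / t))) has_real_derivative
            flat ([:0, 0, 1:] * (p - pderiv p)) t) (at t)"
      using 1 by (auto intro!: derivative_eq_intros DERIV_chain2[OF poly_DERIV] simp: flat_def field_simps power2_eq_square)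
    moreover have "\<forall>\<^sub>F s in nhds t. poly p (1 / s) * exp (- (1 / s)) = flat p s"
      using eventually_nhds_in_open[of "{0<..}" t] 1 by (auto simp: flat_def elim: eventually_mono)
    ultimately show ?thesis by (rule DERIV_cong_ev[OF refl _ refl, THEN iffD1, rotated])
  next
    case 2
    have "\<forall>\<^sub>F s in nhds t. 0 = flat p s"
      using eventually_nhds_in_open[of "{..<0}" t] 2 by (auto simp: flat_def elim: eventually_mono)
    moreover have "((\<lambda>t. 0) has_real_derivative flat ([:0, 0, 1:] * (p - pderiv p)) t) (at t)"
      using 2 by (auto simp: flat_def)
    ultimately show ?thesis by (rule DERIV_cong_ev[OF refl _ refl, THEN iffD1])
  next
    case 3
    have "((\<lambda>h. flat p h / h) \<longlongrightarrow> 0) (at_right 0)"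
    proof (rule Lim_transform_eventually[OF flat_tendsto_0[of "[:0,1:] * p"]])
      show "\<forall>\<^sub>F x in at_right 0. flat ([:0, 1:] * p) x = flat p x / x"
        by (rule eventually_mono[OF eventually_at_right_less]) (auto simp: flat_def)
    qed
    moreover have "((\<lambda>h. flat p h / h) \<longlongrightarrow> 0) (at_left 0)"
      by (rule Lim_transform_eventually[OF tendsto_const])
         (auto simp: flat_def eventually_at_left_field intro!: exI[of _ "-1"])
    ultimately have "((\<lambda>h. flat p h / h) \<longlongrightarrow> 0) (at 0)"
      by (simp add: filterlim_at_split)
    then show ?thesis using 3 by (simp add: DERIV_def flat_def)
  qed
qed

text \<open>A class containing the bumps and closed under partial derivatives, so that all \<open>Ck k\<close> follow by
  induction on \<open>k\<close>.\<close>

inductive smooth_gen :: "(real^'n) \<Rightarrow> real \<Rightarrow> (real^'n \<Rightarrow> real) \<Rightarrow> bool" for a c where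
  flat: "smooth_gen a c (\<lambda>x. flat p (1 - c * (norm (x - a))\<^sup>2))"
| const: "smooth_gen a c (\<lambda>x. d)"
| coord: "smooth_gen a c (\<lambda>x. (x - a) $ i)"
| add: "smooth_gen a c \<phi> \<Longrightarrow> smooth_gen a c \<psi> \<Longrightarrow> smooth_gen a c (\<lambda>x. \<phi> x + \<psi> x)"
| mult: "smooth_gen a c \<phi> \<Longrightarrow> smooth_gen a c \<psi> \<Longrightarrow> smooth_gen a c (\<lambda>x. \<phi> x * \<psi> x)"

section \<open>Partial derivatives of bumps\<close>

lemma partial_deriv_eqI:
  assumes "(\<phi> has_derivative D) (at x)"
  shows "partial_deriv i \<phi> x = D (axis i 1)"
  using frechet_derivative_at[OF assms] by (simp add: partial_deriv_def)

lemma has_derivative_flat_ball: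
  fixes a x :: "real^'n"
  shows "((\<lambda>x. flat p (1 - c * (norm (x - a))\<^sup>2)) has_derivative
     (\<lambda>h. flat ([:0, 0, 1:] * (p - pderiv p)) (1 - c * (norm (x - a))\<^sup>2) * (- 2 * c * ((x - a) \<bullet> h)))) (at x)"
proof -
  have "((\<lambda>x. 1 - c * (norm (x - a))\<^sup>2) has_derivative (\<lambda>h. - 2 * c * ((x - a) \<bullet> h))) (at x)"
    unfolding power2_norm_eq_inner
    by (auto intro!: derivative_eq_intros simp: inner_commute field_simps)
  from has_derivative_compose[OF this flat_has_derivative[THEN has_field_derivative_imp_has_derivative]]
  show ?thesis by (simp add: mult.commute)
qed

lemma partial_deriv_flat_ball:
  fixes a x :: "real^'n"
  shows "partial_deriv i (\<lambda>x. flat p (1 - c * (norm (x - a))\<^sup>2)) x =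
    flat ([:0, 0, 1:] * (p - pderiv p)) (1 - c * (norm (x - a))\<^sup>2) * ((- 2 * c) * ((x - a) $ i))"
  by (subst partial_deriv_eqI[OF has_derivative_flat_ball]) (simp only: inner_axis, simp)

lemma has_derivative_coord:
  "((\<lambda>x. (x - a) $ i) has_derivative (\<lambda>h. h $ i)) (at (x :: real^'n))"
  by (auto intro!: derivative_eq_intros bounded_linear_vec_nth bounded_linear.has_derivative[OF bounded_linear_vec_nth])

lemma partial_deriv_add:
  assumes "\<phi> differentiable at x" "\<psi> differentiable at x"
  shows "partial_deriv i (\<lambda>x. \<phi> x + \<psi> x) x = partial_deriv i \<phi> x + partial_deriv i \<psi> x"
  using partial_deriv_eqI[OF has_derivative_add[OF assms[unfolded frechet_derivative_works]]]
  by (simp add: partial_deriv_def)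

lemma partial_deriv_mult:
  assumes "\<phi> differentiable at x" "\<psi> differentiable at x"
  shows "partial_deriv i (\<lambda>x. \<phi> x * \<psi> x) x = \<phi> x * partial_deriv i \<psi> x + partial_deriv i \<phi> x * \<psi> x"
  using partial_deriv_eqI[OF has_derivative_mult[OF assms[unfolded frechet_derivative_works]]]
  by (simp add: partial_deriv_def)

lemma smooth_gen_closed:
  fixes \<phi> :: "real^'n \<Rightarrow> real"
  assumes "smooth_gen a c \<phi>"
  shows "(\<forall>x. \<phi> differentiable at x) \<and> (\<forall>i. smooth_gen a c (partial_deriv i \<phi>))"
  using assms
proof induction
  case (flat p)
  show ?case
    unfolding partial_deriv_flat_ball[abs_def]
    by (intro conjI allI differentiableI[OF has_derivative_flat_ball] smooth_gen.intros)
next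
  case (const d)
  have "partial_deriv i (\<lambda>x :: real^'n. d) = (\<lambda>x. 0)" for i
    by (rule ext, subst partial_deriv_eqI[OF has_derivative_const]) simp
  then show ?case by (auto intro: smooth_gen.intros)
next
  case (coord j)
  have "partial_deriv i (\<lambda>x. (x - a) $ j) = (\<lambda>x. axis i 1 $ j)" for i
    by (rule ext, subst partial_deriv_eqI[OF has_derivative_coord]) simp
  then show ?case 
    by (metis smooth_gen.const differentiableI[OF has_derivative_coord])
next
  case (add \<phi> \<psi>)
  then have "partial_deriv i (\<lambda>x. \<phi> x + \<psi> x) = (\<lambda>x. partial_deriv i \<phi> x + partial_deriv i \<psi> x)" for i
    by (auto simp: partial_deriv_add)
  with add show ?case by (auto intro: smooth_gen.intros)
next
  case (mult \<phi> \<psi>)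
  then have "partial_deriv i (\<lambda>x. \<phi> x * \<psi> x) = (\<lambda>x. \<phi> x * partial_deriv i \<psi> x + partial_deriv i \<phi> x * \<psi> x)" for i
    by (auto simp: partial_deriv_mult)
  with mult show ?case by (auto intro!: smooth_gen.add smooth_gen.mult)
qed

lemma smooth_gen_Ck: "smooth_gen a c \<phi> \<Longrightarrow> Ck k \<phi>"
proof (induction k arbitrary: \<phi>)
  case 0
  then show ?case
    using smooth_gen_closed[OF 0] by (auto intro!: differentiable_imp_continuous_on simp: differentiable_on_def differentiable_at_withinI)
next
  case (Suc k)
  with smooth_gen_closed[OF Suc.prems] show ?case by auto
qed

text \<open>The first two derivatives of \<open>flat 1\<close>, from the rule X^2 (p - p') with p =
  1 and then p = X^2.\<close>

abbreviation "flat' \<equiv> flat [:0, 0, 1:]"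
abbreviation "flat'' \<equiv> flat ([:0, 0, 1:] * ([:0, 0, 1:] - [:0, 2:]))"

lemma flat'_pos: "0 < t \<Longrightarrow> 0 < flat' t" by (simp add: flat_def)

lemma flat'_nonneg: "0 \<le> flat' t" by (simp add: flat_def)

lemma flat_1_nonneg: "0 \<le> flat 1 t" by (simp add: flat_def)

lemma DERIV_flat': "(flat' has_real_derivative flat'' t) (at t)"
  using flat_has_derivative[of "[:0, 0, 1:]" t] by (simp add: pderiv_pCons)

lemma continuous_flat: "continuous_on A (flat p)"
  by (meson DERIV_continuous_on flat_has_derivative has_field_derivative_at_within)

text \<open>The gradient is -2c \<open>flat'\<close> (x - a). Differentiating \<open>flat'\<close>
  gives the first term; the divergence N of x - a gives the second.\<close>

lemma laplacian_flat_ball: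
  fixes a x :: "real^'n"
  shows "laplacian (\<lambda>x. flat 1 (1 - c * (norm (x - a))\<^sup>2)) x =
     4 * c\<^sup>2 * (norm (x - a))\<^sup>2 * flat'' (1 - c * (norm (x - a))\<^sup>2)
      - 2 * real CARD('n) * c * flat' (1 - c * (norm (x - a))\<^sup>2)"
proof -
  let ?\<tau> = "1 - c * (norm (x - a))\<^sup>2"
  have 1: "partial_deriv i (\<lambda>x. flat 1 (1 - c * (norm (x - a))\<^sup>2)) =
        (\<lambda>x. flat' (1 - c * (norm (x - a))\<^sup>2) * ((- 2 * c) * ((x - a) $ i)))" for i
    by (rule ext) (simp only: partial_deriv_flat_ball, simp)
  have 2: "partial_deriv i (\<lambda>x. flat' (1 - c * (norm (x - a))\<^sup>2) * ((- 2 * c) * ((x - a) $ i))) x =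
      flat' ?\<tau> * (- 2 * c) + (4 * c\<^sup>2 * ((x - a) $ i)\<^sup>2) * flat'' ?\<tau>" for i
  proof -
    note d = has_derivative_mult[OF has_derivative_flat_ball[of "[:0,0,1:]" c a x]
        has_derivative_mult_right[OF has_derivative_coord[of a i x], of "- 2 * c"]]
    show ?thesis
      by (subst partial_deriv_eqI[OF d]) (simp add: inner_axis pderiv_pCons power2_eq_square algebra_simps)
  qed
  have "laplacian (\<lambda>x. flat 1 (1 - c * (norm (x - a))\<^sup>2)) x =
     (\<Sum>i\<in>UNIV. flat' ?\<tau> * (- 2 * c) + (4 * c\<^sup>2 * ((x - a) $ i)\<^sup>2) * flat'' ?\<tau>)"
    unfolding laplacian_def 1 2 ..
  also have "\<dots> = real CARD('n) * (flat' ?\<tau> * (- 2 * c)) + (4 * c\<^sup>2 * (\<Sum>i\<in>UNIV. ((x - a) $ i)\<^sup>2)) * flat'' ?\<tau>"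
    by (simp only: sum.distrib sum_constant sum_distrib_left sum_distrib_right)
  also have "(\<Sum>i\<in>UNIV. ((x - a) $ i)\<^sup>2) = (norm (x - a))\<^sup>2"
    unfolding power2_norm_eq_inner by (simp add: inner_vec_def power2_eq_square)
  finally show ?thesis by (simp add: algebra_simps)
qed

lemma test_function_flat_ball:
  assumes "0 < s" "cball a s \<subseteq> \<Omega>"
  shows "test_function \<Omega> (\<lambda>x. flat 1 (1 - (1 / s\<^sup>2) * (norm (x - a))\<^sup>2))"
proof -
  have "{x. flat 1 (1 - (1 / s\<^sup>2) * (norm (x - a))\<^sup>2) \<noteq> 0} \<subseteq> cball a s"
  proof (clarsimp simp: dist_norm)
    fix x assume "flat 1 (1 - (norm (x - a))\<^sup>2 / s\<^sup>2) \<noteq> 0"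
    then have "(norm (x - a))\<^sup>2 / s\<^sup>2 < 1" by (auto simp: flat_def split: if_splits)
    then have "(norm (x - a))\<^sup>2 < s\<^sup>2" using assms by (simp add: divide_simps)
    then show "norm (a - x) \<le> s" using assms power2_less_imp_less[of "norm (x - a)" s]
      by (simp add: norm_minus_commute)
  qed
  then have "closure {x. flat 1 (1 - (1 / s\<^sup>2) * (norm (x - a))\<^sup>2) \<noteq> 0} \<subseteq> cball a s"
    by (rule closure_minimal) simp
  then show ?thesis
    using assms by (auto simp: test_function_def compact_eq_bounded_closed
      intro: smooth_gen_Ck[OF smooth_gen.flat[where c = "1 / s\<^sup>2"], simplified] bounded_subset[OF bounded_cball])
qed


section \<open>Test functions and integration by parts\<close>

lemma test_function_partial_deriv:
  assumes "test_function \<Omega> \<phi>"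
  shows "test_function \<Omega> (partial_deriv i \<phi>)"
proof -
  have Ck: "Ck k \<phi>" for k using assms by (auto simp: test_function_def)
  have C: "compact (closure {x. \<phi> x \<noteq> 0})" "closure {x. \<phi> x \<noteq> 0} \<subseteq> \<Omega>"
    using assms by (auto simp: test_function_def)
  have "{x. partial_deriv i \<phi> x \<noteq> 0} \<subseteq> closure {x. \<phi> x \<noteq> 0}"
  proof
    fix x assume "x \<in> {x. partial_deriv i \<phi> x \<noteq> 0}"
    then have nz: "partial_deriv i \<phi> x \<noteq> 0" by simp
    show "x \<in> closure {x. \<phi> x \<noteq> 0}"
    proof (rule ccontr)
      assume x: "x \<notin> closure {x. \<phi> x \<noteq> 0}"
      have "(\<phi> has_derivative (\<lambda>h. 0)) (at x)"
      proof (rule has_derivative_transform_within_open[OF has_derivative_const])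
        show "open (- closure {x. \<phi> x \<noteq> 0})" by (rule open_Compl) simp
        show "x \<in> - closure {x. \<phi> x \<noteq> 0}" using x by simp
        show "0 = \<phi> y" if "y \<in> - closure {x. \<phi> x \<noteq> 0}" for y
          using that closure_subset[of "{x. \<phi> x \<noteq> 0}"] by auto
      qed
      then show False using nz partial_deriv_eqI by metis
    qed
  qed
  then have sub: "closure {x. partial_deriv i \<phi> x \<noteq> 0} \<subseteq> closure {x. \<phi> x \<noteq> 0}"
    by (rule closure_minimal) simp
  have "Ck k (partial_deriv i \<phi>)" for k using Ck[of "Suc k"] by simp
  then show ?thesis
    using sub C by (auto simp: test_function_def compact_eq_bounded_closed intro: bounded_subset)
qed

lemma test_function_differentiable: "test_function \<Omega> \<phi> \<Longrightarrow> \<phi> differentiable at x"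
  by (auto simp: test_function_def dest!: conjunct1 spec[of _ "Suc 0"])

lemma test_function_continuous: "test_function \<Omega> \<phi> \<Longrightarrow> continuous_on A \<phi>"
  by (auto simp: test_function_def intro: continuous_on_subset dest!: conjunct1 spec[of _ 0])

lemma test_function_zero: "test_function \<Omega> \<phi> \<Longrightarrow> x \<notin> \<Omega> \<Longrightarrow> \<phi> x = 0"
  using closure_subset[of "{x. \<phi> x \<noteq> 0}"] by (auto simp: test_function_def)

lemma test_function_mono: "test_function S \<phi> \<Longrightarrow> S \<subseteq> T \<Longrightarrow> test_function T \<phi>"
  by (auto simp: test_function_def)

lemma test_function_support:
  assumes "test_function \<Omega> \<phi>"
  obtains K where "compact K" "K \<subseteq> \<Omega>" "\<And>x. x \<notin> K \<Longrightarrow> \<phi> x = 0"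
proof -
  let ?K = "closure {x. \<phi> x \<noteq> 0}"
  have K: "test_function ?K \<phi>" "compact ?K" "?K \<subseteq> \<Omega>" using assms by (simp_all add: test_function_def)
  show ?thesis using that[OF K(2,3) test_function_zero[OF K(1)]] .
qed

lemma test_function_bounded:
  assumes "test_function \<Omega> \<phi>"
  obtains M where "0 \<le> M" "\<And>x. \<bar>\<phi> x\<bar> \<le> M"
proof -
  obtain K where K: "compact K" "\<And>x. x \<notin> K \<Longrightarrow> \<phi> x = 0"
    using test_function_support[OF assms] by metis
  have "bounded (\<phi> ` K)"
    by (intro compact_imp_bounded compact_continuous_image test_function_continuous[OF assms] K)
  then obtain M where M: "\<And>x. x \<in> K \<Longrightarrow> \<bar>\<phi> x\<bar> \<le> M" by (auto simp: bounded_iff)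
  have "\<bar>\<phi> x\<bar> \<le> max 0 M" for x using M[of x] K(2)[of x] by (cases "x \<in> K") auto
  then show ?thesis using that[of "max 0 M"] by simp
qed

lemma laplacian_test_function:
  assumes "test_function \<Omega> \<phi>"
  shows "continuous_on A (laplacian \<phi>)" "x \<notin> \<Omega> \<Longrightarrow> laplacian \<phi> x = 0"
proof -
  have t: "test_function \<Omega> (partial_deriv i (partial_deriv i \<phi>))" for i
    by (intro test_function_partial_deriv assms)
  have "laplacian \<phi> = (\<lambda>x. \<Sum>i\<in>UNIV. partial_deriv i (partial_deriv i \<phi>) x)"
    by (simp add: laplacian_def fun_eq_iff)
  then show "continuous_on A (laplacian \<phi>)"
    by (auto intro!: continuous_on_sum test_function_continuous[OF t])
  show "x \<notin> \<Omega> \<Longrightarrow> laplacian \<phi> x = 0"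
    by (auto simp: laplacian_def test_function_zero[OF t])
qed

lemma laplacian_support:
  assumes "test_function \<Omega> \<phi>"
  obtains K where "compact K" "K \<subseteq> \<Omega>" "\<And>x. x \<notin> K \<Longrightarrow> \<phi> x = 0" "\<And>x. x \<notin> K \<Longrightarrow> laplacian \<phi> x = 0"
proof -
  let ?K = "closure {x. \<phi> x \<noteq> 0}"
  have K: "test_function ?K \<phi>" "compact ?K" "?K \<subseteq> \<Omega>" using assms by (simp_all add: test_function_def)
  show ?thesis using that[OF K(2,3) test_function_zero[OF K(1)] laplacian_test_function(2)[OF K(1)]] .
qed

lemma has_derivative_partial:
  fixes \<phi> :: "real^'n \<Rightarrow> real"
  assumes "\<phi> differentiable at x"
  shows "(\<phi> has_derivative (\<lambda>v. \<Sum>i\<in>UNIV. v $ i * partial_deriv i \<phi> x)) (at x)"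
proof -
  let ?D = "frechet_derivative \<phi> (at x)"
  have D: "(\<phi> has_derivative ?D) (at x)" using assms by (simp add: frechet_derivative_works)
  then have lin: "linear ?D" by (simp add: has_derivative_linear)
  have "?D v = (\<Sum>i\<in>UNIV. v $ i * partial_deriv i \<phi> x)" for v
  proof -
    have "?D v = ?D (\<Sum>i\<in>UNIV. v $ i *\<^sub>R axis i 1)"
      using basis_expansion[of v] by (simp add: scalar_mult_eq_scaleR)
    also have "\<dots> = (\<Sum>i\<in>UNIV. v $ i * partial_deriv i \<phi> x)"
      by (simp add: linear_sum[OF lin] linear_scale[OF lin] partial_deriv_def)
    finally show ?thesis .
  qed
  then have "?D = (\<lambda>v. \<Sum>i\<in>UNIV. v $ i * partial_deriv i \<phi> x)" by (rule ext)
  with D show ?thesis by simp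
qed

lemma test_function_lipschitz:
  fixes \<phi> :: "real^'n \<Rightarrow> real"
  assumes "test_function \<Omega> \<phi>"
  obtains L where "L-lipschitz_on UNIV \<phi>"
proof -
  have "\<exists>M. 0 \<le> M \<and> (\<forall>x. \<bar>partial_deriv i \<phi> x\<bar> \<le> M)" for i
    using test_function_bounded[OF test_function_partial_deriv[OF assms, of i]] by metis
  then obtain M where M: "\<And>i. 0 \<le> M i" "\<And>i x. \<bar>partial_deriv i \<phi> x\<bar> \<le> M i" by metis
  have "(\<Sum>i\<in>UNIV. M i)-lipschitz_on UNIV \<phi>"
  proof (rule bounded_derivative_imp_lipschitz)
    fix x
    show "(\<phi> has_derivative (\<lambda>v. \<Sum>i\<in>UNIV. v $ i * partial_deriv i \<phi> x)) (at x within UNIV)"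
      using has_derivative_partial[OF test_function_differentiable[OF assms]] by simp
    have "\<bar>\<Sum>i\<in>UNIV. v $ i * partial_deriv i \<phi> x\<bar> \<le> (\<Sum>i\<in>UNIV. M i) * norm v" for v
    proof -
      have "\<bar>\<Sum>i\<in>UNIV. v $ i * partial_deriv i \<phi> x\<bar> \<le> (\<Sum>i\<in>UNIV. norm v * M i)"
        by (rule order_trans[OF sum_abs sum_mono])
           (auto simp: abs_mult intro!: mult_mono M component_le_norm_cart)
      then show ?thesis by (simp add: sum_distrib_left mult.commute)
    qed
    then show "onorm (\<lambda>v. \<Sum>i\<in>UNIV. v $ i * partial_deriv i \<phi> x) \<le> (\<Sum>i\<in>UNIV. M i)"
      by (intro onorm_le) simp
  qed (auto intro: sum_nonneg M)
  then show ?thesis using that by blast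
qed

lemma test_function_directional:
  assumes "test_function \<Omega> \<phi>"
  shows "((\<lambda>t. \<phi> (x + t *\<^sub>R axis i 1)) has_real_derivative partial_deriv i \<phi> x) (at 0)"
proof -
  have 1: "((\<lambda>t. x + t *\<^sub>R axis i 1) has_derivative (\<lambda>t. t *\<^sub>R axis i 1)) (at (0::real))"
    by (auto intro!: derivative_eq_intros)
  have 2: "(\<phi> has_derivative frechet_derivative \<phi> (at x)) (at x)"
    using test_function_differentiable[OF assms] by (simp add: frechet_derivative_works)
  have lin: "linear (frechet_derivative \<phi> (at x))" using 2 by (simp add: has_derivative_linear)
  have "((\<lambda>t. \<phi> (x + t *\<^sub>R axis i 1)) has_derivative (\<lambda>t. frechet_derivative \<phi> (at x) (t *\<^sub>R axis i 1))) (at 0)"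
    using has_derivative_compose[OF 1, of \<phi>] 2 by simp
  then show ?thesis
    by (simp add: has_field_derivative_def partial_deriv_def linear_scale[OF lin] mult.commute[of _ "frechet_derivative \<phi> (at x) (axis i 1)"])
qed

section \<open>Integration by parts for Lipschitz functions\<close>

lemma lborel_integral_translate:
  fixes h :: "'a::euclidean_space \<Rightarrow> real"
  assumes [measurable]: "h \<in> borel_measurable borel"
  shows "(LINT x|lborel. h (x + c)) = (LINT x|lborel. h x)"
proof -
  have "(LINT x|lborel. h x) = (LINT x|distr lborel borel ((+) c). h x)" by (simp add: lborel_distr_plus)
  also have "\<dots> = (LINT x|lborel. h (c + x))" by (subst integral_distr) auto
  finally show ?thesis by (simp add: add.commute)
qed

lemma integrable_continuous_support:
  fixes h :: "'a::euclidean_space \<Rightarrow> real"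
  assumes "continuous_on UNIV h" "compact K" "\<And>x. x \<notin> K \<Longrightarrow> h x = 0"
  shows "integrable lborel h"
proof -
  have "integrable lborel (\<lambda>x. indicator K x *\<^sub>R h x)"
    using assms by (intro borel_integrable_compact) (auto intro: continuous_on_subset)
  also have "(\<lambda>x. indicator K x *\<^sub>R h x) = h" using assms(3) by (auto simp: indicator_def fun_eq_iff)
  finally show ?thesis .
qed

text \<open>Translation invariance makes every difference quotient of the product along
  \<open>e\<close> integrate to 0; the Lipschitz constants dominate the quotients, so the limit
  passes under the integral. Asking for derivatives only almost everywhere admits functions with a
  kink on a sphere.\<close>

lemma integral_by_parts_lipschitz:
  fixes a b a' b' :: "'a::euclidean_space \<Rightarrow> real" and e :: 'a
  assumes La: "La-lipschitz_on UNIV a" and Lb: "Lb-lipschitz_on UNIV b"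
    and supp: "\<And>x. \<rho> < norm x \<Longrightarrow> b x = 0"
    and da: "AE x in lborel. ((\<lambda>t. a (x + t *\<^sub>R e)) has_real_derivative a' x) (at 0)"
    and db: "AE x in lborel. ((\<lambda>t. b (x + t *\<^sub>R e)) has_real_derivative b' x) (at 0)"
    and [measurable]: "a' \<in> borel_measurable borel" "b' \<in> borel_measurable borel"
  shows "integrable lborel (\<lambda>x. a x * b' x + a' x * b x)"
    and "(LINT x|lborel. a x * b' x + a' x * b x) = 0"
proof -
  define \<tau> where "\<tau> n = inverse (real (Suc n))" for n
  have \<tau>: "0 < \<tau> n" "\<tau> n \<le> 1" for n by (auto simp: \<tau>_def field_simps)
  have \<tau>0: "filterlim \<tau> (at 0) sequentially"
    using LIMSEQ_inverse_real_of_nat \<tau>(1) unfolding \<tau>_def[abs_def]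
    by (intro filterlim_atI) (auto simp: less_imp_neq)
  define D where "D n x = (a (x + \<tau> n *\<^sub>R e) * b (x + \<tau> n *\<^sub>R e) - a x * b x) / \<tau> n" for n x
  \<comment> \<open>The shift by \<open>\<tau> n *\<^sub>R e\<close> has length at most
    \<open>norm e\<close>, so the quotients vanish beyond this enlarged radius.\<close>
  define \<rho>' where "\<rho>' = \<bar>\<rho>\<bar> + norm e"
  define A where "A = \<bar>a 0\<bar> + La * (\<rho>' + norm e)"
  define B where "B = \<bar>b 0\<bar> + Lb * (\<rho>' + norm e)"
  have L0: "0 \<le> La" "0 \<le> Lb" using La Lb by (auto simp: lipschitz_on_def)
  have La': "\<bar>a x - a y\<bar> \<le> La * norm (x - y)" for x y
    using La by (auto simp: lipschitz_on_def dist_norm)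
  have Lb': "\<bar>b x - b y\<bar> \<le> Lb * norm (x - y)" for x y
    using Lb by (auto simp: lipschitz_on_def dist_norm)
  have cont: "continuous_on UNIV a" "continuous_on UNIV b"
    using La Lb lipschitz_on_continuous_on by blast+
  then have [measurable]: "a \<in> borel_measurable borel" "b \<in> borel_measurable borel"
    by (auto intro: borel_measurable_continuous_onI)
  have int: "integrable lborel (\<lambda>x. a x * b x)"
    by (rule integrable_continuous_support[of _ "cball 0 \<rho>"]) (auto intro!: continuous_intros cont supp)
  then have int': "integrable lborel (\<lambda>x. a (x + c) * b (x + c))" for c
  proof -
    have "integrable (distr lborel borel ((+) c)) (\<lambda>x. a x * b x)" using int by (simp add: lborel_distr_plus)
    then have "integrable lborel (\<lambda>x. a (c + x) * b (c + x))" by (subst (asm) integrable_distr_eq) auto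
    then show ?thesis by (simp add: add.commute)
  qed
  have D0: "(LINT x|lborel. D n x) = 0" for n
    unfolding D_def using int int' lborel_integral_translate[of "\<lambda>x. a x * b x"] by simp
  have lim: "AE x in lborel. (\<lambda>n. D n x) \<longlonglongrightarrow> a x * b' x + a' x * b x"
    using da db
  proof eventually_elim
    case (elim x)
    from DERIV_mult[OF elim]
    have "((\<lambda>h. (a (x + h *\<^sub>R e) * b (x + h *\<^sub>R e) - a x * b x) / h) \<longlongrightarrow> a x * b' x + a' x * b x) (at 0)"
      by (simp add: DERIV_def algebra_simps)
    from filterlim_compose[OF this \<tau>0] show ?case by (simp add: D_def)
  qed
  have bd: "norm (D n x) \<le> indicator (cball 0 \<rho>') x *\<^sub>R (A * (Lb * norm e) + La * norm e * B)" for n x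
  proof (cases "norm x \<le> \<rho>'")
    case False
    have n: "norm (\<tau> n *\<^sub>R e) \<le> norm e" using \<tau>[of n] by (simp add: mult_left_le_one_le)
    have "norm x \<le> norm (x + \<tau> n *\<^sub>R e) + norm (\<tau> n *\<^sub>R e)" using norm_triangle_ineq4[of "x + \<tau> n *\<^sub>R e" "\<tau> n *\<^sub>R e"] by simp
    moreover have "\<rho>' < norm x" "\<rho> \<le> \<rho>' - norm e" "0 \<le> norm e" using False by (auto simp: \<rho>'_def)
    ultimately have "\<rho> < norm (x + \<tau> n *\<^sub>R e)" "\<rho> < norm x" using n by linarith+
    then show ?thesis using False by (simp add: D_def supp)
  next
    case True
    let ?y = "x + \<tau> n *\<^sub>R e"
    have n: "norm (\<tau> n *\<^sub>R e) \<le> norm e" using \<tau>[of n] by (simp add: mult_left_le_one_le)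
    then have ny: "norm ?y \<le> \<rho>' + norm e" using True norm_triangle_ineq[of x "\<tau> n *\<^sub>R e"] by linarith
    have "\<bar>a ?y\<bar> \<le> \<bar>a 0\<bar> + La * norm ?y" using La'[of ?y 0] by simp
    also have "\<dots> \<le> A" unfolding A_def using ny L0 by (intro add_left_mono mult_left_mono) auto
    finally have a: "\<bar>a ?y\<bar> \<le> A" .
    have "\<bar>b x\<bar> \<le> \<bar>b 0\<bar> + Lb * norm x" using Lb'[of x 0] by simp
    also have "\<dots> \<le> B" unfolding B_def using True L0 norm_ge_zero[of e] by (intro add_left_mono mult_left_mono) linarith+
    finally have b: "\<bar>b x\<bar> \<le> B" .
    have qa: "\<bar>(a ?y - a x) / \<tau> n\<bar> \<le> La * norm e" 
      using La'[of ?y x] \<tau>[of n] by (simp add: divide_simps mult_ac)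
    have qb: "\<bar>(b ?y - b x) / \<tau> n\<bar> \<le> Lb * norm e" 
      using Lb'[of ?y x] \<tau>[of n] by (simp add: divide_simps mult_ac)
    \<comment> \<open>Discrete product rule: it separates the quotients of \<open>a\<close> and
      \<open>b\<close>, each bounded by its Lipschitz constant times \<open>norm e\<close>.\<close>
    have "D n x = a ?y * ((b ?y - b x) / \<tau> n) + (a ?y - a x) / \<tau> n * b x"
      using \<tau>[of n] by (simp add: D_def divide_simps) (simp add: algebra_simps)
    then have "\<bar>D n x\<bar> \<le> \<bar>a ?y\<bar> * \<bar>(b ?y - b x) / \<tau> n\<bar> + \<bar>(a ?y - a x) / \<tau> n\<bar> * \<bar>b x\<bar>"
      by (metis abs_mult abs_triangle_ineq)
    also have "\<dots> \<le> A * (Lb * norm e) + La * norm e * B"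
      using a b L0 by (intro add_mono mult_mono qa qb) auto
    finally show ?thesis using True by simp
  qed
  have dom: "integrable lborel (\<lambda>x. indicator (cball 0 \<rho>') x *\<^sub>R (A * (Lb * norm e) + La * norm e * B) :: real)"
    by (rule borel_integrable_compact) auto
  have Dm: "D n \<in> borel_measurable lborel" for n unfolding D_def[abs_def] by measurable
  note dct = integrable_dominated_convergence[OF _ Dm dom lim] integral_dominated_convergence[OF _ Dm dom lim]
  show "integrable lborel (\<lambda>x. a x * b' x + a' x * b x)"
    by (rule dct(1)) (use bd in auto)
  have "(\<lambda>n. LINT x|lborel. D n x) \<longlonglongrightarrow> (LINT x|lborel. a x * b' x + a' x * b x)"
    by (rule dct(2)) (use bd in auto)
  then show "(LINT x|lborel. a x * b' x + a' x * b x) = 0" by (simp add: D0 LIMSEQ_const_iff)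
qed


section \<open>The minimum principle for distributional supersolutions\<close>

lemma set_integral_lebesgue_eq_lborel:
  fixes g h :: "'a::euclidean_space \<Rightarrow> real"
  assumes "h \<in> borel_measurable borel" "\<And>x. x \<in> S \<Longrightarrow> g x = h x" "\<And>x. x \<notin> S \<Longrightarrow> h x = 0"
  shows "(LINT x:S|lebesgue. g x) = (LINT x|lborel. h x)"
proof -
  have "(\<lambda>x. indicator S x *\<^sub>R g x) = h" using assms by (auto simp: indicator_def fun_eq_iff)
  then show ?thesis using assms(1) by (simp add: set_lebesgue_integral_def integral_completion)
qed

text \<open>Differentiation under the integral sign and the criterion for a vanishing integral are
  applied below to gauge integrals over boxes; this is the passage to them.\<close>

lemma integral_cbox_eq_lborel:
  fixes f :: "'a::euclidean_space \<Rightarrow> real"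
  assumes "continuous_on UNIV f" "\<And>x. x \<notin> cbox a b \<Longrightarrow> f x = 0"
  shows "integral (cbox a b) f = (LINT x|lborel. f x)"
proof -
  have "integrable lborel f"
    using assms by (intro integrable_continuous_support[of f "cbox a b"]) auto
  then have "(f has_integral (LINT x|lborel. f x)) UNIV" by (rule has_integral_integral_lborel)
  moreover have "(\<lambda>x. if x \<in> cbox a b then f x else 0) = f" using assms(2) by auto
  ultimately have "(f has_integral (LINT x|lborel. f x)) (cbox a b)"
    using has_integral_restrict_UNIV[of "cbox a b" f] by simp
  then show ?thesis by (rule integral_unique)
qed

lemma integral_laplacian_test_function:
  fixes \<phi> :: "real^'n \<Rightarrow> real"
  assumes "test_function \<Omega> \<phi>"
  shows "(LINT x|lborel. laplacian \<phi> x) = 0"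
proof -
  note t = test_function_partial_deriv[OF assms]
  have "(LINT x|lborel. partial_deriv i (partial_deriv i \<phi>) x) = 0 \<and>
     integrable lborel (partial_deriv i (partial_deriv i \<phi>))" for i
  proof -
    obtain K where K: "compact K" "\<And>x. x \<notin> K \<Longrightarrow> partial_deriv i \<phi> x = 0"
      using test_function_support[OF t[of i]] by metis
    obtain \<rho> where \<rho>: "\<And>x. x \<in> K \<Longrightarrow> norm x \<le> \<rho>"
      using compact_imp_bounded[OF K(1)] by (auto simp: bounded_iff)
    obtain L where L: "L-lipschitz_on UNIV (partial_deriv i \<phi>)" using test_function_lipschitz[OF t[of i]] .
    \<comment> \<open>The partner in the integration by parts is the constant 1, so only the second
      derivative survives.\<close>
    have 1: "0-lipschitz_on UNIV (\<lambda>x::real^'n. 1::real)" by (auto intro!: lipschitz_intros)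
    have m: "partial_deriv i (partial_deriv i \<phi>) \<in> borel_measurable borel"
      by (intro borel_measurable_continuous_onI test_function_continuous[OF test_function_partial_deriv[OF t]])
    have z: "partial_deriv i \<phi> x = 0" if "\<rho> < norm x" for x
      using K(2)[of x] \<rho>[of x] that by linarith
    show ?thesis
      using integral_by_parts_lipschitz[OF 1 L z, where e = "axis i 1" and a' = "\<lambda>x. 0" and
        b' = "partial_deriv i (partial_deriv i \<phi>)"] m test_function_directional[OF t] by simp
  qed
  then show ?thesis unfolding laplacian_def by (subst Bochner_Integration.integral_sum) auto
qed

text \<open>Mollification is avoided: if \<open>Q\<^sub>s\<close> is the bump \<open>b(1 - |x - x0|\<^sup>2 / s\<^sup>2)\<close> and
  \<open>K\<^sub>s = 2 s\<^sup>-\<^sup>N b'(1 - |x - x0|\<^sup>2 / s\<^sup>2)\<close>, then \<open>\<partial>K\<^sub>s / \<partial>s = s\<^sup>1\<^sup>-\<^sup>N \<Delta>Q\<^sub>s\<close>. Hence the average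
  \<open>E(s) = \<integral> (v - v(x0)) K\<^sub>s\<close> is nonincreasing; as \<open>E \<ge> 0\<close> and \<open>E(s) \<rightarrow> 0\<close> for \<open>s \<rightarrow> 0\<close>, it vanishes.\<close>

lemma superharmonic_local_min_constant:
  fixes v :: "real^'n \<Rightarrow> real"
  assumes s1: "0 < s1" "cball x0 s1 \<subseteq> \<Omega>"
    and cont: "continuous_on (cball x0 s1) v"
    and min: "\<And>x. x \<in> cball x0 s1 \<Longrightarrow> v x0 \<le> v x"
    and super: "\<And>\<phi>. test_function \<Omega> \<phi> \<Longrightarrow> (\<And>x. 0 \<le> \<phi> x) \<Longrightarrow> (LINT x:\<Omega>|lebesgue. v x * laplacian \<phi> x) \<le> 0"
    and x: "x \<in> ball x0 s1"
  shows "v x = v x0"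
proof -
  \<comment> \<open>\<open>v\<close> is controlled only on the closed ball; composing with the
    nearest-point projection extends v - v(x0) to a continuous nonnegative function on the whole
    space.\<close>
  define V where "V x = v (closest_point (cball x0 s1) x) - v x0" for x
  have cp: "closest_point (cball x0 s1) y \<in> cball x0 s1" for y
    using s1 by (intro closest_point_in_set) auto
  have V0: "0 \<le> V y" for y using min[OF cp] by (simp add: V_def)
  have Vv: "V y = v y - v x0" if "y \<in> cball x0 s1" for y
    using that by (simp add: V_def closest_point_self)
  have contV: "continuous_on A V" for A
    unfolding V_def using s1 cp
    by (intro continuous_intros continuous_on_compose2[OF cont] continuous_on_closest_point) auto
  define K where "K s y = 2 / s ^ CARD('n) * flat' (1 - 1 / s\<^sup>2 * (norm (y - x0))\<^sup>2)" for s y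
  define Q where "Q s y = flat 1 (1 - 1 / s\<^sup>2 * (norm (y - x0))\<^sup>2)" for s y
  \<comment> \<open>Written out as a formula rather than as a Laplacian, because the Leibniz rule
    needs joint continuity in \<open>s\<close> and \<open>y\<close>.\<close>
  define K' where "K' s y = 4 * (norm (y - x0))\<^sup>2 / s ^ (CARD('n) + 3) * flat'' (1 - 1 / s\<^sup>2 * (norm (y - x0))\<^sup>2)
     - 2 * real CARD('n) / s ^ (CARD('n) + 1) * flat' (1 - 1 / s\<^sup>2 * (norm (y - x0))\<^sup>2)" for s y
  have K': "K' s y = s / s ^ CARD('n) * laplacian (Q s) y" if "0 < s" for s y
    using that unfolding K'_def Q_def[abs_def] laplacian_flat_ball
    by (simp add: field_simps power_add power2_eq_square power3_eq_cube)
  have DK: "((\<lambda>s. K s y) has_real_derivative K' s y) (at s)" if "0 < s" for s y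
  proof -
    obtain n where n: "CARD('n) = Suc n" using zero_less_card_finite[where 'a='n] by (metis Suc_pred)
    let ?r = "(norm (y - x0))\<^sup>2"
    have 1: "((\<lambda>s. 2 / s ^ Suc n) has_real_derivative - (2 * real (Suc n) / s ^ (Suc n + 1))) (at s)"
    proof -
      have "((\<lambda>s. 2 / s ^ Suc n) has_real_derivative (0 * s ^ Suc n - 2 * (real (Suc n) * s ^ n)) / (s ^ Suc n * s ^ Suc n)) (at s)"
        using DERIV_pow[of "Suc n" s UNIV] that by (intro DERIV_divide DERIV_const) auto
      then show ?thesis by (rule DERIV_cong) (use that in \<open>simp add: field_simps\<close>)
    qed
    have 2: "((\<lambda>s. 1 - 1 / s\<^sup>2 * ?r) has_real_derivative 2 * ?r / s ^ 3) (at s)"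
      using that by (auto intro!: derivative_eq_intros simp: field_simps power2_eq_square power3_eq_cube)
    show ?thesis
      unfolding K_def[abs_def] K'_def n
      by (rule DERIV_cong[OF DERIV_mult[OF 1 DERIV_chain2[OF DERIV_flat' 2]]])
         (use that in \<open>simp add: divide_simps power_add\<close>, simp add: algebra_simps eval_nat_numeral)
  qed
  have flat0: "flat p (1 - 1 / s\<^sup>2 * (norm (y - x0))\<^sup>2) = 0" if "0 < s" "s \<le> dist x0 y" for s y p
  proof -
    have "s\<^sup>2 \<le> (norm (y - x0))\<^sup>2" using that by (intro power_mono) (auto simp: dist_norm norm_minus_commute)
    then have "1 - 1 / s\<^sup>2 * (norm (y - x0))\<^sup>2 \<le> 0" using that by (simp add: divide_simps)
    then show ?thesis by (simp add: flat_def)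
  qed
  have cK: "continuous_on A (K s)" for A s
    unfolding K_def by (intro continuous_intros continuous_on_compose2[OF continuous_flat]) auto
  obtain a where ab: "cball x0 s1 \<subseteq> cbox (- a) a"
    using bounded_subset_cbox_symmetric[OF bounded_cball] by metis
  \<comment> \<open>The box contains the support of \<open>K s\<close> for every s \<le> s1 and does
    not move with \<open>s\<close>, so only the integrand is differentiated.\<close>
  define E where "E s = integral (cbox (- a) a) (\<lambda>y. V y * K s y)" for s
  have E_eq: "E s = (LINT y|lborel. V y * K s y)" if "0 < s" "s \<le> s1" for s
    unfolding E_def
  proof (rule integral_cbox_eq_lborel)
    show "V y * K s y = 0" if "y \<notin> cbox (- a) a" for y
    proof -
      have "s1 < dist x0 y" using that ab by (meson mem_cball not_le subsetD)
      then show ?thesis using \<open>0 < s\<close> \<open>s \<le> s1\<close> flat0[of s y] by (simp add: K_def)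
    qed
  qed (intro continuous_intros contV cK)
  have DE: "(E has_real_derivative integral (cbox (- a) a) (\<lambda>y. V y * K' s y)) (at s)" if "0 < s" for s
  proof -
    have "(E has_real_derivative integral (cbox (- a) a) (\<lambda>y. V y * K' s y)) (at s within {0<..})"
      unfolding E_def[abs_def]
    proof (rule leibniz_rule_field_derivative)
      show "((\<lambda>s. V y * K s y) has_real_derivative V y * K' s y) (at s within {0<..})" if "s \<in> {0<..}" for s y
        by (rule has_field_derivative_at_within[OF DERIV_cmult[OF DK]]) (use that in simp)
      show "(\<lambda>y. V y * K s y) integrable_on cbox (- a) a" for s
        by (intro integrable_continuous continuous_intros contV cK)
      show "continuous_on ({0<..} \<times> cbox (- a) a) (\<lambda>(s, y). V y * K' s y)"
        unfolding K'_def split_beta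
        by (intro continuous_intros continuous_on_compose2[OF contV[of UNIV]] continuous_on_compose2[OF continuous_flat[of UNIV]]) auto
    qed (use that in auto)
    moreover have "at s within {0<..} = at s" using that by (intro at_within_open) auto
    ultimately show ?thesis by metis
  qed
  have DE0: "integral (cbox (- a) a) (\<lambda>y. V y * K' s y) \<le> 0" if s: "0 < s" "s \<le> s1" for s
  proof -
    have tf: "test_function \<Omega> (Q s)"
      unfolding Q_def[abs_def] using s s1 by (intro test_function_flat_ball) (auto simp: subset_iff)
    have tfs: "test_function (cball x0 s) (Q s)"
      unfolding Q_def[abs_def] using s s1 by (intro test_function_flat_ball) (auto simp: subset_iff)
    note lap = laplacian_test_function[OF tfs]
    have intV: "integrable lborel (\<lambda>y. V y * laplacian (Q s) y)" 
      by (rule integrable_continuous_support[of _ "cball x0 s"]) (use lap(2) in \<open>auto intro!: continuous_intros contV lap(1)\<close>)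
    have intl: "integrable lborel (laplacian (Q s))" 
      by (rule integrable_continuous_support[of _ "cball x0 s"]) (use lap in auto)
    \<comment> \<open>Subtracting the constant v(x0) changes nothing, since the Laplacian of a test
      function has integral 0.\<close>
    have "(LINT y:\<Omega>|lebesgue. v y * laplacian (Q s) y) = (LINT y|lborel. V y * laplacian (Q s) y + v x0 * laplacian (Q s) y)"
    proof (rule set_integral_lebesgue_eq_lborel)
      show "(\<lambda>y. V y * laplacian (Q s) y + v x0 * laplacian (Q s) y) \<in> borel_measurable borel"
        by (intro borel_measurable_continuous_onI continuous_intros contV lap)
      show "v y * laplacian (Q s) y = V y * laplacian (Q s) y + v x0 * laplacian (Q s) y" for y
      proof (cases "y \<in> cball x0 s")
        case True
        then show ?thesis using s by (subst Vv) (auto simp: algebra_simps)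
      qed (simp add: lap(2))
      show "V y * laplacian (Q s) y + v x0 * laplacian (Q s) y = 0" if "y \<notin> \<Omega>" for y
        using laplacian_test_function(2)[OF tf that] by simp
    qed
    also have "\<dots> = (LINT y|lborel. V y * laplacian (Q s) y)"
      using intV intl integral_laplacian_test_function[OF tf] by simp
    also have "\<dots> = integral (cbox (- a) a) (\<lambda>y. V y * laplacian (Q s) y)"
    proof (rule integral_cbox_eq_lborel[symmetric])
      show "V y * laplacian (Q s) y = 0" if "y \<notin> cbox (- a) a" for y
      proof -
        have "y \<notin> cball x0 s1" using that ab by blast
        then show ?thesis using lap(2)[of y] s by simp
      qed
    qed (intro continuous_intros contV lap)
    finally have "integral (cbox (- a) a) (\<lambda>y. V y * laplacian (Q s) y) \<le> 0"
      using super[OF tf] by (simp add: Q_def flat_1_nonneg)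
    moreover have "integral (cbox (- a) a) (\<lambda>y. V y * K' s y) = s / s ^ CARD('n) * integral (cbox (- a) a) (\<lambda>y. V y * laplacian (Q s) y)"
      by (subst integral_mult_right[symmetric]) (use s K' in \<open>simp add: mult_ac\<close>)
    moreover have "0 \<le> s / s ^ CARD('n)" using s by simp
    ultimately show ?thesis by (metis mult_nonneg_nonpos)
  qed
  have mono: "E t \<le> E s" if "0 < s" "s \<le> t" "t \<le> s1" for s t
    by (rule DERIV_nonpos_imp_nonincreasing[OF that(2)]) (use DE DE0 that in \<open>meson le_less_trans less_le_trans order_trans\<close>)
  obtain M where M: "\<And>t. t \<in> {0..1} \<Longrightarrow> flat' t \<le> M"
    using continuous_attains_sup[of "{0..1::real}" "flat'", OF compact_Icc _ continuous_flat] by fastforce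
  \<comment> \<open>Bounds the integral of \<open>K t\<close> uniformly in \<open>t\<close>: the
    height is at most 2 M / t^N on a ball whose volume is the unit ball volume times t^N. Continuity
    of \<open>V\<close> at \<open>x0\<close> supplies the factor \<open>\<epsilon>\<close>.\<close>
  define C where "C = 2 * M * unit_ball_vol (real CARD('n))"
  have "E s \<le> \<epsilon> * C" if \<epsilon>: "0 < \<epsilon>" and s: "0 < s" "s \<le> s1" for \<epsilon> s
  proof -
    have "isCont V x0" using contV[of UNIV] by (simp add: continuous_on_eq_continuous_at)
    then obtain d where d: "0 < d" "\<And>y. dist x0 y < d \<Longrightarrow> \<bar>V y - V x0\<bar> < \<epsilon>"
      unfolding continuous_at_eps_delta using \<epsilon> by (auto simp: dist_norm norm_minus_commute)
    have Vx0: "V x0 = 0" using Vv[of x0] s1 by simp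
    define t where "t = min s (d / 2)"
    have t: "0 < t" "t \<le> s" "t < d" using d s by (auto simp: t_def min_def)
    have "V y * K t y \<le> \<epsilon> * (2 / t ^ CARD('n) * M) * indicator (cball x0 t) y" for y
    proof (cases "y \<in> cball x0 t")
      case True
      have "norm (y - x0) \<le> t" using True by (simp add: dist_norm norm_minus_commute)
      then have "(norm (y - x0))\<^sup>2 \<le> t\<^sup>2" by (intro power_mono) auto
      then have "flat' (1 - 1 / t\<^sup>2 * (norm (y - x0))\<^sup>2) \<le> M" using t by (intro M) (auto simp: divide_simps)
      then have "K t y \<le> 2 / t ^ CARD('n) * M" unfolding K_def using t by (intro mult_left_mono) auto
      moreover have "V y \<le> \<epsilon>" using d(2)[of y] True t Vx0 by auto
      moreover have "0 \<le> K t y" unfolding K_def using t by (simp add: flat'_nonneg)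
      ultimately have "V y * K t y \<le> \<epsilon> * (2 / t ^ CARD('n) * M)" using \<epsilon> by (intro mult_mono) auto
      then show ?thesis using True by simp
    next
      case False
      then show ?thesis using flat0[of t y] t by (simp add: K_def not_le)
    qed
    moreover have "integrable lborel (\<lambda>y. V y * K t y)"
    proof (rule integrable_continuous_support[of _ "cball x0 t"])
      show "V y * K t y = 0" if "y \<notin> cball x0 t" for y
        using flat0[of t y] t that by (simp add: K_def not_le)
    qed (auto intro!: continuous_intros contV cK)
    moreover have "integrable lborel (\<lambda>y. \<epsilon> * (2 / t ^ CARD('n) * M) * indicator (cball x0 t) y)"
      using emeasure_lborel_cball_finite[of x0 t] by (intro integrable_mult_right integrable_real_indicator) auto
    ultimately have "(LINT y|lborel. V y * K t y) \<le> (LINT y|lborel. \<epsilon> * (2 / t ^ CARD('n) * M) * indicator (cball x0 t) y)"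
      by (intro integral_mono) auto
    also have "\<dots> = \<epsilon> * (2 / t ^ CARD('n) * M) * measure lborel (cball x0 t)" by simp
    also have "\<dots> = \<epsilon> * C" using t content_cball[of t x0] by (simp add: C_def)
    finally show ?thesis using mono[of t s] E_eq[of t] t s by linarith
  qed
  then have E_le: "E s \<le> 0" if "0 < s" "s \<le> s1" for s
  proof -
    have "((\<lambda>\<epsilon>. \<epsilon> * C) \<longlongrightarrow> 0 * C) (at_right 0)" by (intro tendsto_intros)
    then show ?thesis
      using \<open>\<And>s \<epsilon>. \<lbrakk>0 < \<epsilon>; 0 < s; s \<le> s1\<rbrakk> \<Longrightarrow> E s \<le> \<epsilon> * C\<close> that
      by (intro tendsto_lowerbound[of "\<lambda>\<epsilon>. \<epsilon> * C" 0 "at_right 0"]) (auto intro: eventually_mono[OF eventually_at_right_less])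
  qed
  have nn: "0 \<le> V y * K s1 y" for y using V0 s1 by (simp add: K_def flat'_nonneg)
  have c: "continuous_on (cbox (- a) a) (\<lambda>y. V y * K s1 y)" by (intro continuous_intros contV cK)
  have "ball x0 s1 \<subseteq> interior (cbox (- a) a)" using ab ball_subset_cball by (intro interior_maximal) auto
  then have "box (- a) a \<noteq> {}" using s1 x by (auto simp: interior_cbox)
  moreover have "0 \<le> E s1"
    unfolding E_def by (rule integral_nonneg[OF integrable_continuous[OF c]]) (rule nn)
  then have "integral (cbox (- a) a) (\<lambda>y. V y * K s1 y) = 0"
    using E_le[of s1] s1 by (simp add: E_def)
  moreover have "x \<in> cbox (- a) a" using x ab by auto
  \<comment> \<open>A nonnegative continuous function with integral 0 vanishes; afterwards
    \<open>K s1\<close> can be cancelled, being positive inside the ball.\<close>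
  ultimately have "V x * K s1 x = 0"
    using integral_cbox_eq_0_iff[OF c] nn by blast
  moreover have "0 < K s1 x"
  proof -
    have "norm (x - x0) < s1" using x by (simp add: dist_norm norm_minus_commute)
    then have "(norm (x - x0))\<^sup>2 < s1\<^sup>2" by (intro power_strict_mono) auto
    then show ?thesis unfolding K_def using s1 by (intro mult_pos_pos flat'_pos) (auto simp: divide_simps)
  qed
  ultimately have "V x = 0" by simp
  then show ?thesis using Vv[of x] x by simp
qed

text \<open>A negative minimum is attained inside the domain, and the averaging lemma makes the
  function constant on a ball around each such point. The set of minimum points is therefore both
  compact and without extremal points, a contradiction. Disconnected domains are covered as
  well.\<close>

lemma weak_min_principle:
  fixes v :: "real^'n \<Rightarrow> real"
  assumes "open \<Omega>" "bounded \<Omega>" and cont: "continuous_on (closure \<Omega>) v"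
    and bdry: "\<And>x. x \<in> frontier \<Omega> \<Longrightarrow> 0 \<le> v x"
    and super: "\<And>\<phi>. test_function \<Omega> \<phi> \<Longrightarrow> (\<And>x. 0 \<le> \<phi> x) \<Longrightarrow> (LINT x:\<Omega>|lebesgue. v x * laplacian \<phi> x) \<le> 0"
    and x: "x \<in> closure \<Omega>"
  shows "0 \<le> v x"
proof (rule ccontr)
  assume neg: "\<not> 0 \<le> v x"
  have cpt: "compact (closure \<Omega>)" using assms(2) by simp
  obtain p where p: "p \<in> closure \<Omega>" "\<And>y. y \<in> closure \<Omega> \<Longrightarrow> v p \<le> v y"
    using continuous_attains_inf[OF cpt _ cont] x by (metis empty_iff)
  define Z where "Z = {y \<in> closure \<Omega>. v y = v p}"
  have "closed Z" unfolding Z_def by (intro continuous_closed_preimage_constant cont) simp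
  then have "compact Z" using compact_Int_closed[OF cpt, of Z] by (simp add: Z_def Int_absorb1 Collect_conj_eq)
  moreover have "p \<in> Z" using p by (simp add: Z_def)
  \<comment> \<open>an extremal minimum point cannot have a neighbourhood of minimum points\<close>
  ultimately have "\<exists>x0\<in>Z. \<forall>y\<in>Z. y \<bullet> axis undefined 1 \<le> x0 \<bullet> axis (undefined :: 'n) 1"
    by (intro continuous_attains_sup continuous_intros) auto
  \<comment> \<open>\<open>undefined\<close> stands for one fixed but arbitrary coordinate; any
    direction serves.\<close>
  then obtain x0 where x0: "x0 \<in> Z" "\<And>y. y \<in> Z \<Longrightarrow> y \<bullet> axis undefined 1 \<le> x0 \<bullet> axis (undefined :: 'n) 1"
    by blast
  have "v x0 < 0" using x0(1) p(2)[OF x] neg by (auto simp: Z_def)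
  then have "x0 \<in> \<Omega>" using bdry[of x0] x0(1) \<open>open \<Omega>\<close> by (force simp: Z_def frontier_def interior_open)
  then obtain s where s: "0 < s" "cball x0 s \<subseteq> \<Omega>" using \<open>open \<Omega>\<close> open_contains_cball by blast
  then have sc: "cball x0 s \<subseteq> closure \<Omega>" using closure_subset by blast
  define y where "y = x0 + (s / 2) *\<^sub>R axis (undefined :: 'n) 1"
  have y: "y \<in> ball x0 s" using s by (simp add: y_def dist_norm)
  have "v y = v x0"
    by (rule superharmonic_local_min_constant[OF s continuous_on_subset[OF cont sc] _ super y])
       (use x0(1) p sc in \<open>auto simp: Z_def subset_iff\<close>)
  then have "y \<in> Z" using y sc x0(1) by (auto simp: Z_def subset_iff)
  from x0(2)[OF this] show False using s by (simp add: y_def inner_add_left inner_axis_axis)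
qed


section \<open>Radial weights\<close>

text \<open>Dyadic shells replace polar coordinates: where r / 2^(j+1) \<le> |x| < r / 2^j the
  weight is at most \<open>c j\<close>, and \<open>c j\<close> times the volume of
  \<open>B j\<close> is a geometric sequence with ratio 1/2.\<close>

lemma integrable_inverse_norm_power:
  "integrable lborel (\<lambda>x::'a::euclidean_space. indicator (ball 0 r) x * (1 / norm x ^ (DIM('a) - 1)) :: real)"
proof (cases "0 < r")
  case False
  then have "ball (0::'a) r = {}" by simp
  then show ?thesis by (simp only:) simp
next
  case r: True
  let ?m = "DIM('a) - 1"
  define c where "c j = (2 ^ Suc j / r) ^ ?m" for j
  define g where "g x = indicator (ball 0 r) x * (1 / norm x ^ ?m)" for x :: 'a
  define B where "B j = ball (0 :: 'a) (r / 2 ^ j)" for j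
  have [measurable]: "B j \<in> sets borel" for j by (simp add: B_def)
  have c0: "0 \<le> c j" for j using r by (simp add: c_def)
  have pt: "\<exists>j. indicator (ball 0 r) x * (1 / norm x ^ ?m) \<le> c j * indicator (B j) x" for x :: 'a
  proof (cases "x \<noteq> 0 \<and> norm x < r")
    case True
    then have x: "0 < norm x" "norm x < r" by auto
    have "\<exists>j. r / 2 ^ Suc j \<le> norm x"
    proof -
      obtain n where "r / norm x < 2 ^ n" using real_arch_pow[of 2 "r / norm x"] by auto
      then have "r / norm x < 2 ^ Suc n" by (simp add: less_le_trans)
      then have "r / 2 ^ Suc n \<le> norm x" using x by (simp add: field_simps)
      then show ?thesis by blast
    qed
    define j where "j = (LEAST j. r / 2 ^ Suc j \<le> norm x)"
    have j: "r / 2 ^ Suc j \<le> norm x" unfolding j_def by (rule LeastI_ex) fact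
    have j': "norm x < r / 2 ^ j"
    proof (cases j)
      case (Suc i)
      then have "\<not> r / 2 ^ Suc i \<le> norm x" using not_less_Least[of i "\<lambda>j. r / 2 ^ Suc j \<le> norm x"] by (simp add: j_def)
      then show ?thesis using Suc by simp
    qed (use x in simp)
    have "1 / norm x \<le> 2 ^ Suc j / r" using j x r by (simp add: field_simps)
    then have "(1 / norm x) ^ ?m \<le> c j" unfolding c_def by (intro power_mono) auto
    then have "indicator (ball 0 r) x * (1 / norm x ^ ?m) \<le> c j * indicator (B j) x"
      using x j' by (simp add: B_def power_one_over)
    then show ?thesis by blast
  next
    case False
    \<comment> \<open>Inside the ball only x = 0 is left: the weight there is 1 / 0 = 0, or 1 =
      \<open>c 0\<close> when the exponent is 0.\<close>
    then have "indicator (ball 0 r) x * (1 / norm x ^ ?m) \<le> c 0 * indicator (B 0) x"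
      using r by (cases "?m = 0") (auto simp: B_def c_def indicator_def power_0_left)
    then show ?thesis by blast
  qed
  have "(\<integral>\<^sup>+x. ennreal (norm (g x)) \<partial>lborel)
     \<le> (\<integral>\<^sup>+x. (\<Sum>j. ennreal (c j * indicator (B j) x)) \<partial>lborel)"
  proof (rule nn_integral_mono)
    fix x :: 'a
    obtain j where "indicator (ball 0 r) x * (1 / norm x ^ ?m) \<le> c j * indicator (B j) x" using pt by blast
    then have "ennreal (norm (g x)) \<le> ennreal (c j * indicator (B j) x)"
      by (intro ennreal_leI) (simp add: g_def indicator_def)
    also have "\<dots> \<le> (\<Sum>j. ennreal (c j * indicator (B j) x))"
      using sum_le_suminf[OF summableI, of "{j}" "\<lambda>j. ennreal (c j * indicator (B j) x)"] by simp
    finally show "ennreal (norm (g x)) \<le> (\<Sum>j. ennreal (c j * indicator (B j) x))" .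
  qed
  also have "\<dots> = (\<Sum>j. (\<integral>\<^sup>+x. ennreal (c j * indicator (B j) x) \<partial>lborel))"
    by (rule nn_integral_suminf) simp
  also have "\<dots> = (\<Sum>j. ennreal (unit_ball_vol (real DIM('a)) * r * 2 ^ ?m * (1 / 2) ^ j))"
  proof (rule suminf_cong)
    fix j
    have "(\<integral>\<^sup>+x. ennreal (c j * indicator (B j) x) \<partial>lborel) = (\<integral>\<^sup>+x. ennreal (c j) * indicator (B j) x \<partial>lborel)"
      by (intro nn_integral_cong) (simp add: indicator_def)
    also have "\<dots> = ennreal (c j) * emeasure lborel (B j)" by (subst nn_integral_cmult_indicator) auto
    also have "\<dots> = ennreal (c j) * ennreal (measure lborel (B j))"
      using emeasure_lborel_ball_finite[of "0::'a" "r / 2 ^ j", folded B_def] by (subst emeasure_eq_ennreal_measure) auto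
    also have "\<dots> = ennreal (c j * (unit_ball_vol (real DIM('a)) * (r / 2 ^ j) ^ DIM('a)))"
      using c0[of j] r by (simp add: B_def content_ball ennreal_mult)
    also have "c j * (unit_ball_vol (real DIM('a)) * (r / 2 ^ j) ^ DIM('a)) = unit_ball_vol (real DIM('a)) * r * 2 ^ ?m * (1 / 2) ^ j"
    proof -
      obtain m where m: "DIM('a) = Suc m" using DIM_positive[where 'a='a] by (metis Suc_pred)
      show ?thesis using r by (simp add: c_def m power_divide power_mult_distrib field_simps)
    qed
    finally show "(\<integral>\<^sup>+x. ennreal (c j * indicator (B j) x) \<partial>lborel) = ennreal (unit_ball_vol (real DIM('a)) * r * 2 ^ ?m * (1 / 2) ^ j)" .
  qed
  also have "\<dots> < \<infinity>"
    by (subst suminf_ennreal2) (use r in \<open>auto intro!: summable_mult summable_geometric\<close>)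
  finally have "(\<integral>\<^sup>+x. ennreal (norm (g x)) \<partial>lborel) < \<infinity>" .
  moreover have "ball (0::'a) r \<in> sets borel" by simp
  then have "g \<in> borel_measurable lborel" unfolding g_def[abs_def] by measurable
  ultimately have "integrable lborel g" by (intro integrableI_bounded)
  then show ?thesis by (simp add: g_def[abs_def])
qed

text \<open>Converts a vanishing integral into equal masses of the positive and negative parts;
  finiteness is what the uniqueness of measures on half-lines asks for.\<close>

lemma nn_integral_pos_neg_eq:
  fixes h :: "'a \<Rightarrow> real"
  assumes "integrable M h" "(LINT x|M. h x) = 0"
  shows "(\<integral>\<^sup>+x. ennreal (h x) \<partial>M) = (\<integral>\<^sup>+x. ennreal (- h x) \<partial>M)" "(\<integral>\<^sup>+x. ennreal (h x) \<partial>M) < \<infinity>"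
proof -
  have fin: "(\<integral>\<^sup>+x. ennreal (h x) \<partial>M) < \<infinity>" "(\<integral>\<^sup>+x. ennreal (- h x) \<partial>M) < \<infinity>"
    using assms(1) by (auto simp: real_integrable_def less_top)
  then show "(\<integral>\<^sup>+x. ennreal (h x) \<partial>M) < \<infinity>" by simp
  have eq: "enn2real (\<integral>\<^sup>+x. ennreal (h x) \<partial>M) = enn2real (\<integral>\<^sup>+x. ennreal (- h x) \<partial>M)"
    using real_lebesgue_integral_def[OF assms(1)] assms(2) by linarith
  have "P = Q" if "enn2real P = enn2real Q" "P < \<infinity>" "Q < \<infinity>" for P Q
    using that by (metis ennreal_enn2real infinity_ennreal_def)
  from this[OF eq fin] show "(\<integral>\<^sup>+x. ennreal (h x) \<partial>M) = (\<integral>\<^sup>+x. ennreal (- h x) \<partial>M)" .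
qed

text \<open>The profile \<open>f'\<close> of a radial Lebesgue measurable function need not be Borel, so the two measures
  with densities \<open>H\<^sup>+\<close> and \<open>H\<^sup>-\<close> are pushed forward to the finest \<open>\<sigma>\<close>-algebra that makes the norm
  Lebesgue measurable. They agree there because a radial Lebesgue set differs by a null set from
  the preimage of a Borel set.\<close>

lemma integral_radial_eq_0:
  fixes H :: "'a::euclidean_space \<Rightarrow> real" and f' :: "real \<Rightarrow> real"
  assumes H: "integrable lborel H"
    and H0: "\<And>s. (LINT y|lborel. indicator {y. s < norm y} y * H y) = 0"
    and f: "(\<lambda>y::'a. f' (norm y)) \<in> borel_measurable lebesgue" "\<And>y::'a. 0 \<le> f' (norm y)"
  shows "(LINT y|lebesgue. f' (norm y) * H y) = 0"
proof -
  have Hm[measurable]: "H \<in> borel_measurable borel" using H by auto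
  have Hl[measurable]: "H \<in> borel_measurable lebesgue" using Hm by (simp add: measurable_completion)
  have int: "integrable lborel (\<lambda>y. indicator {y. s < norm y} y * H y)" for s
    using integrable_mult_indicator[OF _ H, of "{y. s < norm y}"] by simp
  \<comment> \<open>\<open>ennreal\<close> cuts off negative values, so \<open>\<sigma>\<close> = 1
    and \<open>\<sigma>\<close> = -1 select the positive and the negative part of
    \<open>H\<close>.\<close>
  define N where "N \<sigma> = distr (density lborel (\<lambda>y. ennreal (\<sigma> * H y))) borel (norm :: 'a \<Rightarrow> real)" for \<sigma> :: real
  have emN: "emeasure (N \<sigma>) A = (\<integral>\<^sup>+y. ennreal (\<sigma> * H y) * indicator A (norm y) \<partial>lborel)"
    if A[measurable]: "A \<in> sets borel" for \<sigma> A
  proof -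
    have [measurable]: "(norm :: 'a \<Rightarrow> real) -` A \<in> sets borel"
      using measurable_sets[OF _ A, of "norm :: 'a \<Rightarrow> real" borel] by simp
    show ?thesis
      unfolding N_def by (subst emeasure_distr, simp_all, subst emeasure_density) (auto intro!: nn_integral_cong simp: indicator_def)
  qed
  have emN_s: "emeasure (N \<sigma>) {s<..} = (\<integral>\<^sup>+y. ennreal (\<sigma> * (indicator {y. s < norm y} y * H y)) \<partial>lborel)" for \<sigma> s
    by (subst emN) (auto intro!: nn_integral_cong simp: indicator_def)
  note pn = nn_integral_pos_neg_eq[OF int H0]
  have N_eq: "N 1 = N (- 1)"
  proof (rule measure_eqI_lessThan)
    show "emeasure (N 1) {s<..} < \<infinity>" for s using pn(2)[of s] by (simp add: emN_s)
    show "emeasure (N 1) {s<..} = emeasure (N (- 1)) {s<..}" for s using pn(1)[of s] by (simp add: emN_s)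
  qed (simp_all add: N_def)
  define \<A> where "\<A> = {A :: real set. (norm :: 'a \<Rightarrow> real) -` A \<in> sets lebesgue}"
  have sa: "sigma_algebra UNIV \<A>"
    unfolding sigma_algebra_iff2
  proof (intro conjI ballI allI impI)
    fix A assume "A \<in> \<A>"
    then show "UNIV - A \<in> \<A>" using sets.compl_sets[of "norm -` A" lebesgue] by (simp add: \<A>_def vimage_Diff)
  next
    fix A :: "nat \<Rightarrow> real set" assume "range A \<subseteq> \<A>"
    then show "\<Union> (range A) \<in> \<A>" by (auto simp: \<A>_def vimage_Union)
  qed (auto simp: \<A>_def)
  define B where "B = sigma UNIV \<A>"
  have setsB: "sets B = \<A>" "space B = UNIV"
    unfolding B_def using sa by (simp_all add: sigma_algebra.sigma_sets_eq)
  have normB: "(norm :: 'a \<Rightarrow> real) \<in> measurable lebesgue B"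
    by (intro measurableI) (auto simp: setsB \<A>_def)
  have f'B: "f' \<in> borel_measurable B"
  proof (rule measurableI)
    fix S :: "real set" assume S: "S \<in> sets borel"
    have "(\<lambda>y::'a. f' (norm y)) -` S \<inter> space lebesgue \<in> sets lebesgue" by (rule measurable_sets[OF f(1) S])
    moreover have "(\<lambda>y::'a. f' (norm y)) -` S \<inter> space lebesgue = norm -` (f' -` S)" by auto
    ultimately show "f' -` S \<inter> space B \<in> sets B" by (simp add: setsB \<A>_def)
  qed (simp_all)
  define M where "M \<sigma> = distr (density lebesgue (\<lambda>y. ennreal (\<sigma> * H y))) B (norm :: 'a \<Rightarrow> real)" for \<sigma> :: real
  have dm: "(norm :: 'a \<Rightarrow> real) \<in> measurable (density lebesgue (\<lambda>y. ennreal (\<sigma> * H y))) B" for \<sigma>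
    using normB by simp
  have M_eq: "M 1 = M (- 1)"
  proof (rule measure_eqI)
    fix A assume "A \<in> sets (M 1)"
    then have A: "norm -` A \<in> sets (lebesgue :: 'a measure)" "A \<in> sets B" by (auto simp: M_def setsB \<A>_def)
    obtain C T where CT: "fsigma C" "T \<in> null_sets lebesgue" "C \<union> T = (norm :: 'a \<Rightarrow> real) -` A"
      using lebesgue_set_almost_fsigma[OF A(1)] by metis
    obtain K :: "nat \<Rightarrow> 'a set" where K': "range K \<subseteq> Collect compact" "C = \<Union> (range K)"
      using iffD1[OF fsigma_Union_compact CT(1)] by (elim exE conjE)
    have K: "compact (K n)" "C = (\<Union>n. K n)" for n using K' by auto
    \<comment> \<open>Images of compact sets under the norm are compact, so this union is Borel. Its
      members are norms of points of \<open>C\<close>, hence lie in \<open>A\<close>; conversely, a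
      point outside the null set \<open>T\<close> whose norm lies in \<open>A\<close> belongs to
      \<open>C\<close>.\<close>
    define A0 where "A0 = (\<Union>n. norm ` K n)"
    have [measurable]: "A0 \<in> sets borel"
      unfolding A0_def by (intro sets.countable_UN) (auto intro!: borel_compact compact_continuous_image continuous_intros K(1))
    have "AE y in lebesgue. y \<notin> T" using CT(2) by (rule AE_not_in)
    then have ae: "AE y in lebesgue. norm (y::'a) \<in> A \<longleftrightarrow> norm y \<in> A0"
    proof eventually_elim
      case (elim y)
      show ?case
      proof
        assume "norm y \<in> A"
        then have "y \<in> C" using CT(3) elim by auto
        then show "norm y \<in> A0" by (auto simp: A0_def K(2))
      next
        assume "norm y \<in> A0"
        then obtain z where "z \<in> C" "norm y = norm z" by (auto simp: A0_def K(2))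
        then show "norm y \<in> A" using CT(3) by auto
      qed
    qed
    have "emeasure (M \<sigma>) A = emeasure (N \<sigma>) A0" for \<sigma>
    proof -
      have "emeasure (M \<sigma>) A = (\<integral>\<^sup>+y. ennreal (\<sigma> * H y) * indicator (norm -` A) y \<partial>lebesgue)"
        unfolding M_def using A by (subst emeasure_distr[OF dm A(2)], subst emeasure_density) auto
      also have "\<dots> = (\<integral>\<^sup>+y. ennreal (\<sigma> * H y) * indicator A0 (norm y) \<partial>lebesgue)"
        using ae by (intro nn_integral_cong_AE) (auto simp: indicator_def)
      also have "\<dots> = emeasure (N \<sigma>) A0"
        by (subst emN) (auto simp: nn_integral_completion)
      finally show ?thesis .
    qed
    then show "emeasure (M 1) A = emeasure (M (- 1)) A" by (simp add: N_eq)
  qed (simp add: M_def)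
  have nn: "(\<integral>\<^sup>+y. ennreal (\<sigma> * (f' (norm y) * H y)) \<partial>lebesgue) = (\<integral>\<^sup>+t. ennreal (f' t) \<partial>M \<sigma>)" for \<sigma>
  proof -
    have "(\<integral>\<^sup>+t. ennreal (f' t) \<partial>M \<sigma>) = (\<integral>\<^sup>+y. ennreal (f' (norm y)) \<partial>density lebesgue (\<lambda>y::'a. ennreal (\<sigma> * H y)))"
      unfolding M_def by (rule nn_integral_distr[OF dm]) (use f'B in measurable)
    also have "\<dots> = (\<integral>\<^sup>+y. ennreal (\<sigma> * H y) * ennreal (f' (norm y)) \<partial>lebesgue)"
      by (rule nn_integral_density) (use f(1) in measurable)
    also have "\<dots> = (\<integral>\<^sup>+y. ennreal (\<sigma> * (f' (norm y) * H y)) \<partial>lebesgue)"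
    proof (rule nn_integral_cong)
      show "ennreal (\<sigma> * H y) * ennreal (f' (norm y)) = ennreal (\<sigma> * (f' (norm y) * H y))" for y
        using ennreal_mult''[OF f(2)[of y], of "\<sigma> * H y"] by (simp add: mult_ac)
    qed
    finally show ?thesis by simp
  qed
  show ?thesis
  proof (cases "integrable lebesgue (\<lambda>y. f' (norm y) * H y)")
    case True
    then show ?thesis using nn[of 1] nn[of "- 1"] M_eq by (simp add: real_lebesgue_integral_def)
  \<comment> \<open>The Bochner integral of a function that is not integrable is 0 by
    convention.\<close>
  qed (rule not_integrable_integral_eq)
qed


section \<open>The radial kernel\<close>

definition unit_sphere_area :: "nat \<Rightarrow> real" where
  "unit_sphere_area N = real N * unit_ball_vol (real N)"

text \<open>The second branch is meant for N = 3, where the usual factor N - 2 equals 1; with this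
  scaling both dimensions share the derivative -1 / (\<open>\<sigma>\<close>
  \<open>\<rho>\<close>^(N-1)).\<close>

definition radial_kernel :: "nat \<Rightarrow> real \<Rightarrow> real \<Rightarrow> real" where
  "radial_kernel N r \<rho> = (if N = 2 then ln r - ln \<rho> else 1 / \<rho> - 1 / r) / unit_sphere_area N"

lemma unit_sphere_area_pos: "0 < N \<Longrightarrow> 0 < unit_sphere_area N"
  by (simp add: unit_sphere_area_def)

lemma radial_kernel_measurable[measurable]: "radial_kernel N r \<in> borel_measurable borel"
  unfolding radial_kernel_def by measurable

lemma radial_kernel_self[simp]: "radial_kernel N r r = 0"
  by (simp add: radial_kernel_def)

lemma DERIV_radial_kernel:
  assumes "N = 2 \<or> N = 3" "0 < \<rho>"
  shows "(radial_kernel N r has_real_derivative - (1 / (unit_sphere_area N * \<rho> ^ (N - 1)))) (at \<rho>)"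
proof -
  have "0 < unit_sphere_area N" using assms by (intro unit_sphere_area_pos) auto
  from assms(1) show ?thesis
  proof
    assume N: "N = 2"
    then have "radial_kernel N r = (\<lambda>\<rho>. (ln r - ln \<rho>) / unit_sphere_area N)" by (auto simp: radial_kernel_def)
    moreover have "((\<lambda>\<rho>. (ln r - ln \<rho>) / unit_sphere_area N) has_real_derivative - (1 / (unit_sphere_area N * \<rho> ^ (N - 1)))) (at \<rho>)"
      using assms(2) \<open>0 < unit_sphere_area N\<close> N by (auto intro!: derivative_eq_intros simp: field_simps)
    ultimately show ?thesis by simp
  next
    assume N: "N = 3"
    then have "radial_kernel N r = (\<lambda>\<rho>. (1 / \<rho> - 1 / r) / unit_sphere_area N)" by (auto simp: radial_kernel_def)
    moreover have "((\<lambda>\<rho>. (1 / \<rho> - 1 / r) / unit_sphere_area N) has_real_derivative - (1 / (unit_sphere_area N * \<rho> ^ (N - 1)))) (at \<rho>)"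
      using assms(2) \<open>0 < unit_sphere_area N\<close> N by (auto intro!: derivative_eq_intros simp: field_simps power2_eq_square)
    ultimately show ?thesis by simp
  qed
qed

lemma continuous_on_radial_kernel:
  assumes "N = 2 \<or> N = 3" "A \<subseteq> {0<..}"
  shows "continuous_on A (radial_kernel N r)"
  using assms DERIV_radial_kernel[OF assms(1)]
  by (intro continuous_at_imp_continuous_on) (auto intro: DERIV_isCont)

lemma radial_kernel_antimono:
  assumes N: "N = 2 \<or> N = 3" and "0 < s" "s \<le> t"
  shows "radial_kernel N r t \<le> radial_kernel N r s"
proof (rule DERIV_nonpos_imp_nonincreasing[OF \<open>s \<le> t\<close>])
  fix x assume "s \<le> x"
  then have "0 < x" using assms by simp
  moreover have "0 < unit_sphere_area N" using N by (intro unit_sphere_area_pos) auto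
  ultimately show "\<exists>y. (radial_kernel N r has_real_derivative y) (at x) \<and> y \<le> 0"
    using DERIV_radial_kernel[OF N] by (intro exI[of _ "- (1 / (unit_sphere_area N * x ^ (N - 1)))"]) auto
qed

lemma radial_kernel_nonneg:
  assumes "N = 2 \<or> N = 3" "0 < \<rho>" "\<rho> \<le> r"
  shows "0 \<le> radial_kernel N r \<rho>"
  using radial_kernel_antimono[OF assms, of r] by simp

text \<open>The majorant is the weight of \<open>integrable_inverse_norm_power\<close>. In dimension
  2, ln z = 2 ln (sqrt z) \<le> 2 sqrt z with z = r / \<open>\<rho>\<close> gives the constant 4r;
  in dimension 3 the squared difference is at most 1 / \<open>\<rho>\<close>^2, constant 1. The sum
  4r + 1 serves both.\<close>

lemma radial_kernel_square_le:
  assumes N: "N = 2 \<or> N = 3" and "0 < \<rho>" "\<rho> \<le> r"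
  shows "(radial_kernel N r \<rho>)\<^sup>2 \<le> (4 * r + 1) / (unit_sphere_area N)\<^sup>2 * (1 / \<rho> ^ (N - 1))"
proof -
  have "(if N = 2 then ln r - ln \<rho> else 1 / \<rho> - 1 / r)\<^sup>2 \<le> (4 * r + 1) * (1 / \<rho> ^ (N - 1))"
  proof (cases "N = 2")
    case True
    let ?z = "r / \<rho>"
    have z: "1 \<le> ?z" using assms by simp
    have "ln ?z = 2 * ln (sqrt ?z)" using z by (simp add: ln_sqrt)
    also have "\<dots> \<le> 2 * sqrt ?z" using ln_le_minus_one[of "sqrt ?z"] z by (simp add: real_sqrt_gt_0_iff)
    finally have "(ln ?z)\<^sup>2 \<le> (2 * sqrt ?z)\<^sup>2" using z by (intro power_mono) auto
    also have "\<dots> = 4 * ?z" using z by (simp add: power_mult_distrib)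
    also have "\<dots> \<le> (4 * r + 1) * (1 / \<rho>)" using assms by (simp add: field_simps)
    finally show ?thesis using assms True by (simp add: ln_div)
  next
    case False
    with N have N: "N = 3" by simp
    have "(1 / \<rho> - 1 / r)\<^sup>2 \<le> (1 / \<rho>)\<^sup>2" using assms by (intro power_mono) (auto simp: field_simps)
    also have "\<dots> \<le> (4 * r + 1) * (1 / \<rho>\<^sup>2)" using assms by (simp add: power_one_over field_simps)
    finally show ?thesis using N by simp
  qed
  then show ?thesis unfolding radial_kernel_def power_divide times_divide_eq_left by (rule divide_right_mono) simp
qed

lemma radial_kernel_lipschitz:
  assumes N: "N = 2 \<or> N = 3" and "0 < t"
  shows "(1 / (unit_sphere_area N * t ^ (N - 1)))-lipschitz_on {t..} (radial_kernel N r)"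
proof (rule bounded_derivative_imp_lipschitz)
  have pos: "0 < unit_sphere_area N" using N by (intro unit_sphere_area_pos) auto
  fix x assume x: "x \<in> {t..}"
  then show "(radial_kernel N r has_derivative (*) (- (1 / (unit_sphere_area N * x ^ (N - 1))))) (at x within {t..})"
    using DERIV_radial_kernel[OF N, of x r] \<open>0 < t\<close>
    by (auto intro: has_derivative_at_withinI simp: has_field_derivative_def)
  have "1 / (unit_sphere_area N * x ^ (N - 1)) \<le> 1 / (unit_sphere_area N * t ^ (N - 1))"
    using x pos \<open>0 < t\<close> by (intro divide_left_mono mult_left_mono power_mono mult_pos_pos) auto
  moreover have "norm (- (1 / (unit_sphere_area N * x ^ (N - 1))) * h) = 1 / (unit_sphere_area N * x ^ (N - 1)) * norm h" for h
    using pos x \<open>0 < t\<close> by (simp add: abs_mult)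
  ultimately show "onorm ((*) (- (1 / (unit_sphere_area N * x ^ (N - 1))))) \<le> 1 / (unit_sphere_area N * t ^ (N - 1))"
    by (intro onorm_le) (metis mult_right_mono norm_ge_zero)
next
  show "0 \<le> 1 / (unit_sphere_area N * t ^ (N - 1))" using unit_sphere_area_pos[of N] N \<open>0 < t\<close> by auto
qed simp

section \<open>Integration by parts across a sphere\<close>

lemma norm_directional_derivative:
  fixes x :: "real^'n"
  assumes "x \<noteq> 0"
  shows "((\<lambda>\<tau>. norm (x + \<tau> *\<^sub>R axis i 1)) has_real_derivative x $ i / norm x) (at 0)"
proof -
  have 1: "((\<lambda>\<tau>. x + \<tau> *\<^sub>R axis i 1) has_derivative (\<lambda>\<tau>. \<tau> *\<^sub>R axis i 1)) (at (0::real))"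
    by (auto intro!: derivative_eq_intros)
  have 2: "(norm has_derivative (\<lambda>h. h \<bullet> sgn x)) (at (x + 0 *\<^sub>R axis i 1))"
    using GDERIV_norm[OF assms] by (simp add: gderiv_def)
  have "(\<lambda>h. (h *\<^sub>R axis i 1) \<bullet> sgn x) = (*) (x $ i / norm x)"
    by (auto simp: fun_eq_iff sgn_div_norm inner_axis' field_simps)
  then show ?thesis using has_derivative_compose[OF 1 2] by (simp add: has_field_derivative_def)
qed

lemma AE_norm_neq: "AE x in lborel. norm (x :: 'a::euclidean_space) \<noteq> t"
proof -
  have "sphere (0::'a) t \<in> null_sets lborel"
    using negligible_sphere[of "0::'a" t] by (simp add: negligible_iff_null_sets null_sets_completion_iff)
  from AE_not_in[OF this] show ?thesis by simp
qed

lemma eventually_direction: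
  fixes x e :: "'a::real_normed_vector"
  assumes "open S" "x \<in> S"
  shows "\<forall>\<^sub>F \<tau> in nhds (0::real). x + \<tau> *\<^sub>R e \<in> S"
proof -
  have "((\<lambda>\<tau>. x + \<tau> *\<^sub>R e) \<longlongrightarrow> x + 0 *\<^sub>R e) (nhds 0)" by (intro tendsto_intros filterlim_ident)
  then show ?thesis using assms by (intro topological_tendstoD) auto
qed

lemma eventually_norm_greater:
  fixes x e :: "'a::euclidean_space"
  assumes "t < norm x"
  shows "\<forall>\<^sub>F \<tau> in nhds (0::real). t < norm (x + \<tau> *\<^sub>R e)"
  using eventually_direction[of "- cball 0 t" x e] assms by (simp add: open_Compl not_le)

text \<open>Freezing the kernel inside radius \<open>t\<close> makes it Lipschitz with a kink only
  on a null set, so one integration by parts is legitimate. Its gradient is -x /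
  (\<open>\<sigma>\<close> |x|^N) outside and 0 inside, and the normalising radius \<open>r\<close>
  drops out.\<close>

lemma radial_kernel_parts:
  fixes \<phi> :: "real^'n \<Rightarrow> real"
  assumes dim: "CARD('n) = 2 \<or> CARD('n) = 3" and t: "0 < t" and \<phi>: "test_function \<Omega> \<phi>"
  shows "(LINT x|lborel. radial_kernel CARD('n) r (max t (norm x)) * laplacian \<phi> x) =
    (1 / unit_sphere_area CARD('n)) *
      (LINT x|lborel. indicator {x. t < norm x} x * ((\<Sum>i\<in>UNIV. x $ i * partial_deriv i \<phi> x) / norm x ^ CARD('n)))"
proof -
  let ?N = "CARD('n)" and ?\<sigma> = "unit_sphere_area CARD('n)"
  have \<sigma>: "0 < ?\<sigma>" by (intro unit_sphere_area_pos) simp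
  obtain m where m: "?N = Suc m" using zero_less_card_finite[where 'a='n] by (metis Suc_pred)
  define a where "a x = radial_kernel ?N r (max t (norm x))" for x :: "real^'n"
  define a' where "a' i x = indicator {x. t < norm x} x * (- (x $ i / (?\<sigma> * norm x ^ ?N)))" for i and x :: "real^'n"
  note d\<phi> = test_function_partial_deriv[OF \<phi>]
  have "1-lipschitz_on UNIV (\<lambda>x::real^'n. max t (norm x))"
  proof (rule lipschitz_onI)
    fix x y :: "real^'n"
    have "\<bar>max t (norm x) - max t (norm y)\<bar> \<le> \<bar>norm x - norm y\<bar>" by (auto simp: max_def)
    also have "\<dots> \<le> norm (x - y)" by (rule norm_triangle_ineq3)
    finally show "dist (max t (norm x)) (max t (norm y)) \<le> 1 * dist x y" by (simp add: dist_norm)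
  qed simp
  moreover have "(1 / (?\<sigma> * t ^ (?N - 1)))-lipschitz_on ((\<lambda>x::real^'n. max t (norm x)) ` UNIV) (radial_kernel ?N r)"
    by (rule lipschitz_on_subset[OF radial_kernel_lipschitz[OF dim t]]) auto
  ultimately have La: "(1 / (?\<sigma> * t ^ (?N - 1)) * 1)-lipschitz_on UNIV a"
    unfolding a_def by (rule lipschitz_on_compose2)
  have conta: "continuous_on UNIV a" using La by (rule lipschitz_on_continuous_on)
  have da: "AE x in lborel. ((\<lambda>\<tau>. a (x + \<tau> *\<^sub>R axis i 1)) has_real_derivative a' i x) (at 0)" for i
    using AE_norm_neq[of t]
  proof eventually_elim
    case (elim x)
    show ?case
    proof (cases "t < norm x")
      case True
      then have x: "x \<noteq> 0" using t by auto
      have "((\<lambda>\<tau>. radial_kernel ?N r (norm (x + \<tau> *\<^sub>R axis i 1))) has_real_derivative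
          - (1 / (?\<sigma> * norm x ^ (?N - 1))) * (x $ i / norm x)) (at 0)"
        by (rule DERIV_chain2[OF _ norm_directional_derivative[OF x]]) (use DERIV_radial_kernel[OF dim, of "norm x" r] x in simp)
      then have "((\<lambda>\<tau>. radial_kernel ?N r (norm (x + \<tau> *\<^sub>R axis i 1))) has_real_derivative a' i x) (at 0)"
        by (rule DERIV_cong) (use True x in \<open>simp add: a'_def m\<close>)
      moreover have "\<forall>\<^sub>F \<tau> in nhds 0. radial_kernel ?N r (norm (x + \<tau> *\<^sub>R axis i 1)) = a (x + \<tau> *\<^sub>R axis i 1)"
        by (rule eventually_mono[OF eventually_norm_greater[OF True, of "axis i 1"]]) (simp add: a_def max_def)
      ultimately show ?thesis by (rule DERIV_cong_ev[OF refl _ refl, THEN iffD1, rotated])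
    next
      case False
      with elim have "norm x < t" by simp
      then have "\<forall>\<^sub>F \<tau> in nhds 0. radial_kernel ?N r t = a (x + \<tau> *\<^sub>R axis i 1)"
        using eventually_direction[of "ball 0 t" x "axis i 1"]
        by (auto simp: a_def max_def elim!: eventually_mono)
      moreover have "((\<lambda>\<tau>::real. radial_kernel ?N r t) has_real_derivative a' i x) (at 0)" using False by (simp add: a'_def)
      ultimately show ?thesis by (rule DERIV_cong_ev[OF refl _ refl, THEN iffD1])
    qed
  qed
  have comp: "integrable lborel (\<lambda>x. a x * partial_deriv i (partial_deriv i \<phi>) x) \<and> integrable lborel (\<lambda>x. a' i x * partial_deriv i \<phi> x)
     \<and> (LINT x|lborel. a x * partial_deriv i (partial_deriv i \<phi>) x) = - (LINT x|lborel. a' i x * partial_deriv i \<phi> x)" for i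
  proof -
    obtain L where L: "L-lipschitz_on UNIV (partial_deriv i \<phi>)" using test_function_lipschitz[OF d\<phi>[of i]] .
    obtain K where K: "compact K" "\<And>x. x \<notin> K \<Longrightarrow> partial_deriv i \<phi> x = 0"
      using test_function_support[OF d\<phi>[of i]] by metis
    obtain \<rho> where \<rho>: "\<And>x. x \<in> K \<Longrightarrow> norm x \<le> \<rho>"
      using compact_imp_bounded[OF K(1)] by (auto simp: bounded_iff)
    have z: "partial_deriv i \<phi> x = 0" if "\<rho> < norm x" for x
      using K(2)[of x] \<rho>[of x] that by linarith
    have m1: "a' i \<in> borel_measurable borel" unfolding a'_def by measurable
    have m2: "partial_deriv i (partial_deriv i \<phi>) \<in> borel_measurable borel"
      by (intro borel_measurable_continuous_onI test_function_continuous[OF test_function_partial_deriv[OF d\<phi>]])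
    note p = integral_by_parts_lipschitz[OF La L z da _ m1 m2]
    have p1: "integrable lborel (\<lambda>x. a x * partial_deriv i (partial_deriv i \<phi>) x + a' i x * partial_deriv i \<phi> x)"
      "(LINT x|lborel. a x * partial_deriv i (partial_deriv i \<phi>) x + a' i x * partial_deriv i \<phi> x) = 0"
      by (rule p; simp add: test_function_directional[OF d\<phi>])+
    obtain K' where K': "compact K'" "\<And>x. x \<notin> K' \<Longrightarrow> partial_deriv i (partial_deriv i \<phi>) x = 0"
      using test_function_support[OF test_function_partial_deriv[OF d\<phi>[of i], of i]] by metis
    have i1: "integrable lborel (\<lambda>x. a x * partial_deriv i (partial_deriv i \<phi>) x)"
      by (rule integrable_continuous_support[OF _ K'(1)])
         (auto intro!: continuous_intros conta test_function_continuous[OF test_function_partial_deriv[OF d\<phi>]] simp: K'(2))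
    have i2: "integrable lborel (\<lambda>x. a' i x * partial_deriv i \<phi> x)"
      using Bochner_Integration.integrable_diff[OF p1(1) i1] by simp
    show ?thesis using p1(2) i1 i2 by simp
  qed
  have "(LINT x|lborel. a x * laplacian \<phi> x) = (\<Sum>i\<in>UNIV. LINT x|lborel. a x * partial_deriv i (partial_deriv i \<phi>) x)"
    unfolding laplacian_def sum_distrib_left by (rule Bochner_Integration.integral_sum) (use comp in auto)
  also have "\<dots> = (\<Sum>i\<in>UNIV. (LINT x|lborel. - (a' i x * partial_deriv i \<phi> x)))" using comp by simp
  also have "\<dots> = (LINT x|lborel. (\<Sum>i\<in>UNIV. - (a' i x * partial_deriv i \<phi> x)))"
    by (rule Bochner_Integration.integral_sum[symmetric]) (use comp in auto)
  also have "\<dots> = (LINT x|lborel. (1 / ?\<sigma>) * (indicator {x. t < norm x} x * ((\<Sum>i\<in>UNIV. x $ i * partial_deriv i \<phi> x) / norm x ^ ?N)))"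
    by (intro Bochner_Integration.integral_cong)
       (simp_all add: a'_def sum_divide_distrib sum_distrib_left indicator_def mult_ac)
  finally show ?thesis by (simp only: a_def integral_mult_right_zero)
qed

text \<open>The field x (1 - (s/|x|)^N) has divergence N, because x / |x|^N is divergence free away
  from 0, and it vanishes on |x| = s; continued by 0 it is Lipschitz and leaves no boundary term.
  The factor is the fraction of the ball of radius |x| lying beyond radius \<open>s\<close>, which
  is how it arises from Fubini below.\<close>

lemma radial_cutoff_parts:
  fixes \<phi> :: "real^'n \<Rightarrow> real"
  assumes s: "0 \<le> s" and \<phi>: "test_function \<Omega> \<phi>"
  shows "integrable lborel (\<lambda>x. (1 - (s / max s (norm x)) ^ CARD('n)) * (\<Sum>i\<in>UNIV. x $ i * partial_deriv i \<phi> x))"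
   and "(LINT x|lborel. (1 - (s / max s (norm x)) ^ CARD('n)) * (\<Sum>i\<in>UNIV. x $ i * partial_deriv i \<phi> x))
      = - real CARD('n) * (LINT x|lborel. indicator {x. s < norm x} x * \<phi> x)"
proof -
  let ?N = "CARD('n)"
  obtain m where m: "?N = Suc m" using zero_less_card_finite[where 'a='n] by (metis Suc_pred)
  define q where "q x = s / max s (norm x)" for x :: "real^'n"
  have q: "0 \<le> q x" "q x \<le> 1" for x using s by (auto simp: q_def divide_simps)
  \<comment> \<open>The factor |x|, supplied by \<open>x $ i\<close> in \<open>a\<close>,
    compensates the steepness of \<open>q\<close> for small \<open>s\<close>.\<close>
  have q_diff: "norm x * \<bar>q x - q y\<bar> \<le> norm (x - y)" for x y
  proof (cases "s = 0")
    case False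
    then have M: "0 < max s (norm x)" "0 < max s (norm y)" using s by auto
    have "q x - q y = s * (max s (norm y) - max s (norm x)) / (max s (norm x) * max s (norm y))"
      using M by (simp add: q_def divide_simps) (simp add: algebra_simps)
    then have "norm x * \<bar>q x - q y\<bar> = (norm x / max s (norm x)) * (s / max s (norm y)) * \<bar>max s (norm y) - max s (norm x)\<bar>"
      using s M by (simp add: abs_mult)
    also have "\<dots> \<le> 1 * 1 * \<bar>max s (norm y) - max s (norm x)\<bar>"
      using M s by (intro mult_mono) auto
    also have "\<dots> \<le> norm (x - y)" using norm_triangle_ineq3[of x y] by (auto simp: max_def)
    finally show ?thesis .
  qed (simp add: q_def)
  define a where "a i x = x $ i - x $ i * q x ^ ?N" for i and x :: "real^'n"
  define a' where "a' i x = indicator {x. s < norm x} x * (1 - (s / norm x) ^ ?N + real ?N * (x $ i)\<^sup>2 * s ^ ?N / norm x ^ (?N + 2))" for i and x :: "real^'n"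
  have La: "(real ?N + 2)-lipschitz_on UNIV (a i)" for i
  proof (rule lipschitz_onI)
    fix x y :: "real^'n"
    \<comment> \<open>The three terms contribute 1, N and 1 to the Lipschitz constant N + 2.\<close>
    have eq: "a i x - a i y = (x - y) $ i - (x $ i * (q x ^ ?N - q y ^ ?N) + (x - y) $ i * q y ^ ?N)"
      by (simp add: a_def algebra_simps)
    have "\<bar>x $ i\<bar> * \<bar>q x ^ ?N - q y ^ ?N\<bar> \<le> norm x * (real ?N * \<bar>q x - q y\<bar>)"
      using norm_power_diff[of "q x" "q y" ?N] q by (intro mult_mono component_le_norm_cart) auto
    also have "\<dots> \<le> real ?N * norm (x - y)" using q_diff[of x y] by (simp add: mult.left_commute)
    finally have 1: "\<bar>x $ i * (q x ^ ?N - q y ^ ?N)\<bar> \<le> real ?N * norm (x - y)" by (simp add: abs_mult)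
    have "\<bar>(x - y) $ i\<bar> * q y ^ ?N \<le> norm (x - y) * 1"
      using q[of y] by (intro mult_mono component_le_norm_cart power_le_one) auto
    then have 2: "\<bar>(x - y) $ i * q y ^ ?N\<bar> \<le> norm (x - y)" using q by (simp add: abs_mult)
    have 3: "\<bar>(x - y) $ i\<bar> \<le> norm (x - y)" by (rule component_le_norm_cart)
    show "dist (a i x) (a i y) \<le> (real ?N + 2) * dist x y"
      unfolding dist_real_def dist_norm[of x] eq distrib_right using 1 2 3 by linarith
  qed simp
  have conta: "continuous_on UNIV (a i)" for i using La by (rule lipschitz_on_continuous_on)
  have da: "AE x in lborel. ((\<lambda>\<tau>. a i (x + \<tau> *\<^sub>R axis i 1)) has_real_derivative a' i x) (at 0)" for i
    using AE_norm_neq[of s]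
  proof eventually_elim
    case (elim x)
    show ?case
    proof (cases "s < norm x")
      case True
      then have x: "x \<noteq> 0" using s by auto
      have c: "((\<lambda>\<tau>. (x + \<tau> *\<^sub>R axis i 1) $ i) has_real_derivative 1) (at 0)"
        by (auto intro!: derivative_eq_intros)
      have p: "((\<lambda>\<tau>. (s / norm (x + \<tau> *\<^sub>R axis i 1)) ^ ?N) has_real_derivative
          real ?N * (s / norm x) ^ m * (- (s * (x $ i / norm x)) / (norm x)\<^sup>2)) (at 0)"
      proof -
        have "((\<lambda>\<tau>. s / norm (x + \<tau> *\<^sub>R axis i 1)) has_real_derivative
            (0 * norm x - s * (x $ i / norm x)) / (norm x * norm x)) (at 0)"
          using DERIV_divide[OF DERIV_const norm_directional_derivative[OF x, of i]] x by simp
        from DERIV_power[OF this, of ?N] show ?thesis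
          by (rule DERIV_cong) (use x in \<open>simp add: m power2_eq_square\<close>)
      qed
      have "((\<lambda>\<tau>. (x + \<tau> *\<^sub>R axis i 1) $ i - (x + \<tau> *\<^sub>R axis i 1) $ i * (s / norm (x + \<tau> *\<^sub>R axis i 1)) ^ ?N) has_real_derivative a' i x) (at 0)"
        by (rule DERIV_cong[OF DERIV_diff[OF c DERIV_mult[OF c p]]])
           (use True x in \<open>simp add: a'_def m power_divide power2_eq_square field_simps\<close>)
      moreover have "\<forall>\<^sub>F \<tau> in nhds 0. (x + \<tau> *\<^sub>R axis i 1) $ i - (x + \<tau> *\<^sub>R axis i 1) $ i * (s / norm (x + \<tau> *\<^sub>R axis i 1)) ^ ?N = a i (x + \<tau> *\<^sub>R axis i 1)"
        by (rule eventually_mono[OF eventually_norm_greater[OF True, of "axis i 1"]]) (simp add: a_def q_def max_def)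
      ultimately show ?thesis by (rule DERIV_cong_ev[OF refl _ refl, THEN iffD1, rotated])
    next
      case False
      with elim have "norm x < s" by simp
      then have "0 < s" using norm_ge_zero[of x] by linarith
      then have "\<forall>\<^sub>F \<tau> in nhds 0. 0 = a i (x + \<tau> *\<^sub>R axis i 1)"
        using eventually_direction[of "ball 0 s" x "axis i 1"] \<open>norm x < s\<close>
        by (auto simp: a_def q_def max_def elim!: eventually_mono)
      moreover have "((\<lambda>\<tau>::real. 0) has_real_derivative a' i x) (at 0)" using False by (simp add: a'_def)
      ultimately show ?thesis by (rule DERIV_cong_ev[OF refl _ refl, THEN iffD1])
    qed
  qed
  obtain K where K: "compact K" "\<And>x. x \<notin> K \<Longrightarrow> \<phi> x = 0"
    using test_function_support[OF \<phi>] by metis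
  obtain \<rho> where \<rho>: "\<And>x. x \<in> K \<Longrightarrow> norm x \<le> \<rho>"
    using compact_imp_bounded[OF K(1)] by (auto simp: bounded_iff)
  have z: "\<phi> x = 0" if "\<rho> < norm x" for x
    using K(2)[of x] \<rho>[of x] that by linarith
  obtain L where L: "L-lipschitz_on UNIV \<phi>" using test_function_lipschitz[OF \<phi>] .
  have comp: "integrable lborel (\<lambda>x. a i x * partial_deriv i \<phi> x) \<and> integrable lborel (\<lambda>x. a' i x * \<phi> x)
     \<and> (LINT x|lborel. a i x * partial_deriv i \<phi> x) = - (LINT x|lborel. a' i x * \<phi> x)" for i
  proof -
    have m1: "a' i \<in> borel_measurable borel" unfolding a'_def by measurable
    have m2: "partial_deriv i \<phi> \<in> borel_measurable borel"
      by (intro borel_measurable_continuous_onI test_function_continuous[OF test_function_partial_deriv[OF \<phi>]])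
    note p = integral_by_parts_lipschitz[OF La L z da _ m1 m2]
    have p1: "integrable lborel (\<lambda>x. a i x * partial_deriv i \<phi> x + a' i x * \<phi> x)"
      "(LINT x|lborel. a i x * partial_deriv i \<phi> x + a' i x * \<phi> x) = 0"
      by (rule p; simp add: test_function_directional[OF \<phi>])+
    obtain K' where K': "compact K'" "\<And>x. x \<notin> K' \<Longrightarrow> partial_deriv i \<phi> x = 0"
      using test_function_support[OF test_function_partial_deriv[OF \<phi>, of i]] by metis
    have i1: "integrable lborel (\<lambda>x. a i x * partial_deriv i \<phi> x)"
      by (rule integrable_continuous_support[OF _ K'(1)])
         (auto intro!: continuous_intros conta test_function_continuous[OF test_function_partial_deriv[OF \<phi>]] simp: K'(2))
    have i2: "integrable lborel (\<lambda>x. a' i x * \<phi> x)"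
      using Bochner_Integration.integrable_diff[OF p1(1) i1] by simp
    show ?thesis using p1(2) i1 i2 by simp
  qed
  have eq: "(1 - (s / max s (norm x)) ^ ?N) * (\<Sum>i\<in>UNIV. x $ i * partial_deriv i \<phi> x) = (\<Sum>i\<in>UNIV. a i x * partial_deriv i \<phi> x)" for x
    by (simp add: a_def q_def sum_distrib_left algebra_simps)
  have eq': "(\<Sum>i\<in>UNIV. a' i x * \<phi> x) = real ?N * (indicator {x. s < norm x} x * \<phi> x)" for x
  proof (cases "s < norm x")
    case True
    then have x: "0 < norm x" using s by linarith
    have n: "(\<Sum>i\<in>UNIV. (x $ i)\<^sup>2) = (norm x)\<^sup>2"
      unfolding power2_norm_eq_inner by (simp add: inner_vec_def power2_eq_square)
    \<comment> \<open>The divergence of the cut-off field: N (1 - (s/|x|)^N) + N (s/|x|)^N.\<close>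
    have "(\<Sum>i\<in>UNIV. a' i x) = real ?N * (1 - (s / norm x) ^ ?N) + (real ?N * s ^ ?N / norm x ^ (?N + 2)) * (\<Sum>i\<in>UNIV. (x $ i)\<^sup>2)"
      using True by (simp add: a'_def sum.distrib sum_distrib_left sum_divide_distrib mult_ac)
    also have "\<dots> = real ?N" unfolding n using x by (simp add: power_divide power_add power2_eq_square field_simps)
    finally show ?thesis using True by (simp add: sum_distrib_right[symmetric])
  qed (simp add: a'_def)
  show "integrable lborel (\<lambda>x. (1 - (s / max s (norm x)) ^ ?N) * (\<Sum>i\<in>UNIV. x $ i * partial_deriv i \<phi> x))"
    unfolding eq using comp by auto
  have "(LINT x|lborel. (1 - (s / max s (norm x)) ^ ?N) * (\<Sum>i\<in>UNIV. x $ i * partial_deriv i \<phi> x)) = (\<Sum>i\<in>UNIV. LINT x|lborel. a i x * partial_deriv i \<phi> x)"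
    unfolding eq by (rule Bochner_Integration.integral_sum) (use comp in auto)
  also have "\<dots> = - (\<Sum>i\<in>UNIV. LINT x|lborel. a' i x * \<phi> x)" using comp by (simp add: sum_negf)
  also have "(\<Sum>i\<in>UNIV. LINT x|lborel. a' i x * \<phi> x) = (LINT x|lborel. (\<Sum>i\<in>UNIV. a' i x * \<phi> x))"
    by (rule Bochner_Integration.integral_sum[symmetric]) (use comp in auto)
  finally show "(LINT x|lborel. (1 - (s / max s (norm x)) ^ ?N) * (\<Sum>i\<in>UNIV. x $ i * partial_deriv i \<phi> x))
      = - real ?N * (LINT x|lborel. indicator {x. s < norm x} x * \<phi> x)"
    unfolding eq' by simp
qed

text \<open>By the divergence theorem this is minus the mean of \<open>\<phi>\<close> over the sphere of radius \<open>t\<close>; the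
  form used here needs no surface integrals.\<close>

definition radial_flux :: "(real^'n \<Rightarrow> real) \<Rightarrow> real \<Rightarrow> real" where
  "radial_flux \<phi> t = (1 / unit_sphere_area CARD('n)) *
      (LINT x|lborel. indicator {x. t < norm x} x * ((\<Sum>i\<in>UNIV. x $ i * partial_deriv i \<phi> x) / norm x ^ CARD('n)))"

lemma measure_shell:
  assumes "0 \<le> s"
  shows "measure lborel {y::'a::euclidean_space. s < norm y \<and> norm y < \<rho>} =
     (if s < \<rho> then unit_ball_vol (real DIM('a)) * (\<rho> ^ DIM('a) - s ^ DIM('a)) else 0)"
proof (cases "s < \<rho>")
  case True
  have "{y::'a. s < norm y \<and> norm y < \<rho>} = ball 0 \<rho> - cball 0 s" by auto
  moreover have "measure lborel (ball (0::'a) \<rho> - cball 0 s) = measure lborel (ball (0::'a) \<rho>) - measure lborel (cball (0::'a) s)"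
  proof (rule measure_Diff)
    show "emeasure lborel (ball (0::'a) \<rho>) \<noteq> \<infinity>" using emeasure_lborel_ball_finite[of "0::'a" \<rho>] by simp
    show "cball (0::'a) s \<subseteq> ball 0 \<rho>" using True by auto
  qed simp_all
  ultimately have "measure lborel {y::'a. s < norm y \<and> norm y < \<rho>} = measure lborel (ball (0::'a) \<rho>) - measure lborel (cball (0::'a) s)"
    by metis
  then show ?thesis using True assms by (simp add: content_ball content_cball algebra_simps)
next
  case False
  then have "{y::'a. s < norm y \<and> norm y < \<rho>} = {}" by auto
  with False show ?thesis by (simp only: measure_empty if_False)
qed

text \<open>Integrating \<open>radial_flux\<close> over |y| > s and exchanging the integrals pairs
  each x with the shell s < |y| < |x|; its volume turns the integrand into the field of
  \<open>radial_cutoff_parts\<close>, and the outcome is minus the integral of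
  \<open>\<phi>\<close>. So \<open>\<phi>\<close> and its spherical mean agree on complements of
  centred balls, which is the hypothesis of \<open>integral_radial_eq_0\<close>.\<close>

lemma radial_flux_identity:
  fixes \<phi> :: "real^'n \<Rightarrow> real"
  assumes \<phi>: "test_function (ball 0 r) \<phi>"
  defines "H \<equiv> \<lambda>y. radial_flux \<phi> (norm y) + \<phi> y"
  shows "integrable lborel H" "(LINT y|lborel. indicator {y. s < norm y} y * H y) = 0"
    and "\<exists>B. \<forall>t. \<bar>radial_flux \<phi> t\<bar> \<le> B" "radial_flux \<phi> \<in> borel_measurable borel"
proof -
  let ?N = "CARD('n)" and ?\<sigma> = "unit_sphere_area CARD('n)"
  have \<sigma>: "0 < ?\<sigma>" by (intro unit_sphere_area_pos) simp
  have N: "DIM(real^'n) = ?N" by simp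
  define P where "P x = (\<Sum>i\<in>UNIV. x $ i * partial_deriv i \<phi> x)" for x
  define q where "q x = P x / norm x ^ ?N" for x
  note d\<phi> = test_function_partial_deriv[OF \<phi>]
  have contP: "continuous_on UNIV P" unfolding P_def by (intro continuous_intros test_function_continuous[OF d\<phi>])
  then have Pm[measurable]: "P \<in> borel_measurable borel" by (rule borel_measurable_continuous_onI)
  have qm[measurable]: "q \<in> borel_measurable borel" unfolding q_def[abs_def] by measurable
  have \<phi>m[measurable]: "\<phi> \<in> borel_measurable borel" by (intro borel_measurable_continuous_onI test_function_continuous[OF \<phi>])
  have "\<exists>M. 0 \<le> M \<and> (\<forall>x. \<bar>partial_deriv i \<phi> x\<bar> \<le> M)" for i
    using test_function_bounded[OF d\<phi>[of i]] by metis
  then obtain M where M: "\<And>i. 0 \<le> M i" "\<And>i x. \<bar>partial_deriv i \<phi> x\<bar> \<le> M i" by metis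
  have Pb: "\<bar>P x\<bar> \<le> norm x * (\<Sum>i\<in>UNIV. M i)" for x
    unfolding P_def sum_distrib_left
    by (rule order_trans[OF sum_abs sum_mono]) (auto simp: abs_mult intro!: mult_mono M component_le_norm_cart)
  have P0: "P x = 0" if "x \<notin> ball 0 r" for x using test_function_zero[OF d\<phi> that] by (simp add: P_def)
  obtain m where m: "?N = Suc m" using zero_less_card_finite[where 'a='n] by (metis Suc_pred)
  \<comment> \<open>\<open>P\<close> vanishes to first order at 0, which cancels one power and
    leaves the integrable singularity |x|^(1-N).\<close>
  have qb: "\<bar>q x\<bar> \<le> (\<Sum>i\<in>UNIV. M i) * (indicator (ball 0 r) x * (1 / norm x ^ (?N - 1)))" for x
  proof (cases "x = 0 \<or> x \<notin> ball 0 r")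
    case True
    then have "q x = 0" using P0[of x] by (auto simp: q_def P_def)
    moreover have "0 \<le> (\<Sum>i\<in>UNIV. M i) * (indicator (ball 0 r) x * (1 / norm x ^ (?N - 1)))"
      by (intro mult_nonneg_nonneg sum_nonneg M) auto
    ultimately show ?thesis by (simp only: abs_zero)
  next
    case False
    then have "\<bar>q x\<bar> \<le> (norm x * (\<Sum>i\<in>UNIV. M i)) / norm x ^ ?N"
      unfolding q_def abs_divide using Pb[of x] by (simp add: divide_right_mono)
    then show ?thesis using False by (simp add: m)
  qed
  have qi: "integrable lborel q"
    by (rule Bochner_Integration.integrable_bound[OF integrable_mult_right[OF integrable_inverse_norm_power[where 'a="real^'n", of r], of "\<Sum>i\<in>UNIV. M i"]])
       (simp_all only: real_norm_def N, use qb order_trans[OF qb abs_ge_self] in \<open>auto simp del: abs_mult\<close>)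
  have J: "radial_flux \<phi> t = (1 / ?\<sigma>) * (LINT x|lborel. indicator {x. t < norm x} x * q x)" for t
    by (simp add: radial_flux_def q_def P_def)
  show Jm[measurable]: "radial_flux \<phi> \<in> borel_measurable borel"
  proof -
    have "(\<lambda>t. LINT x|lborel. (if t < norm x then 1 else 0) * q x) \<in> borel_measurable borel"
      by measurable
    then show ?thesis unfolding J[abs_def] by (simp add: indicator_def of_bool_def)
  qed
  show "\<exists>B. \<forall>t. \<bar>radial_flux \<phi> t\<bar> \<le> B"
  proof (intro exI allI)
    fix t
    have "\<bar>LINT x|lborel. indicator {x. t < norm x} x * q x\<bar> \<le> (LINT x|lborel. \<bar>q x\<bar>)"
    proof (rule order_trans[OF integral_abs_bound integral_mono])
      show "integrable lborel (\<lambda>x. \<bar>indicator {x. t < norm x} x * q x\<bar>)"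
        using integrable_mult_indicator[OF _ qi, of "{x. t < norm x}"] by (intro integrable_abs) simp
    qed (use qi in \<open>auto simp: indicator_def\<close>)
    then show "\<bar>radial_flux \<phi> t\<bar> \<le> (1 / ?\<sigma>) * (LINT x|lborel. \<bar>q x\<bar>)"
      unfolding J abs_mult using \<sigma> by (intro mult_mono) auto
  qed
  have \<phi>i: "integrable lborel (\<lambda>y. indicator {y. s < norm y} y * \<phi> y)" for s
  proof -
    obtain K where "compact K" "\<And>x. x \<notin> K \<Longrightarrow> \<phi> x = 0" using test_function_support[OF \<phi>] by metis
    then have "integrable lborel \<phi>" by (intro integrable_continuous_support[OF test_function_continuous[OF \<phi>]])
    from integrable_mult_indicator[OF _ this, of "{y. s < norm y}"] show ?thesis by simp
  qed
  define rf where "rf y = radial_flux \<phi> (norm y)" for y :: "real^'n"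
  have key: "integrable lborel (\<lambda>y. indicator {y. s < norm y} y * rf y) \<and>
     (LINT y|lborel. indicator {y. s < norm y} y * rf y) = - (LINT y|lborel. indicator {y. s < norm y} y * \<phi> y)"
    if s: "0 \<le> s" for s
  proof -
    define G where "G x y = (if s < norm y \<and> norm y < norm x then 1 else 0 :: real)" for x y :: "real^'n"
    define F where "F x y = G x y * q x" for x y :: "real^'n"
    have Fm: "case_prod F \<in> borel_measurable (lborel \<Otimes>\<^sub>M lborel)"
      unfolding F_def G_def by measurable
    have Fy: "(LINT y|lborel. c * G x y) =
        c * (unit_ball_vol ?N * norm x ^ ?N * (1 - (s / max s (norm x)) ^ ?N))" for c and x :: "real^'n"
    proof -
      have "(LINT y|lborel. c * G x y) = (LINT y|lborel. c * indicator {y::real^'n. s < norm y \<and> norm y < norm x} y)"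
        by (intro Bochner_Integration.integral_cong) (auto simp: G_def indicator_def)
      also have "\<dots> = c * measure lborel {y::real^'n. s < norm y \<and> norm y < norm x}" by simp
      also have "\<dots> = c * (unit_ball_vol ?N * norm x ^ ?N * (1 - (s / max s (norm x)) ^ ?N))"
        unfolding measure_shell[OF s] using s by (auto simp: power_divide field_simps m)
      finally show ?thesis .
    qed
    have Fy': "integrable lborel (\<lambda>y. c * G x y)" for c and x :: "real^'n"
    proof -
      have "emeasure lborel {y::real^'n. s < norm y \<and> norm y < norm x} \<le> emeasure lborel (ball (0::real^'n) (norm x))"
        by (intro emeasure_mono) auto
      then have "emeasure lborel {y::real^'n. s < norm y \<and> norm y < norm x} < \<infinity>"
        using emeasure_lborel_ball_finite[of "0::real^'n" "norm x"] by (rule le_less_trans)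
      then have "integrable lborel (\<lambda>y. c * indicator {y::real^'n. s < norm y \<and> norm y < norm x} y)"
        by (intro integrable_mult_right integrable_real_indicator) auto
      then show ?thesis by (rule Bochner_Integration.integrable_cong[THEN iffD1, rotated -1]) (auto simp: G_def indicator_def)
    qed
    note cut = radial_cutoff_parts[OF s \<phi>, folded P_def]
    have qP: "q x * (unit_ball_vol ?N * norm x ^ ?N * (1 - (s / max s (norm x)) ^ ?N)) = unit_ball_vol ?N * ((1 - (s / max s (norm x)) ^ ?N) * P x)" for x
      by (cases "x = 0") (auto simp: q_def P_def)
    have Fi: "integrable (lborel \<Otimes>\<^sub>M lborel) (case_prod F)"
    proof (rule lborel_pair.Fubini_integrable[OF Fm])
      have "norm (case_prod F (x, y)) = \<bar>q x\<bar> * G x y" for x y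
        by (simp add: F_def G_def)
      then have "(LINT y|lborel. norm (case_prod F (x, y))) = \<bar>q x * (unit_ball_vol ?N * norm x ^ ?N * (1 - (s / max s (norm x)) ^ ?N))\<bar>" for x
        using s by (simp only: Fy) (auto simp: abs_mult divide_simps max_def intro!: power_le_one)
      then show "integrable lborel (\<lambda>x. LINT y|lborel. norm (case_prod F (x, y)))"
        unfolding qP using cut(1) by (simp add: integrable_abs)
      show "AE x in lborel. integrable lborel (\<lambda>y. case_prod F (x, y))"
        using Fy'[of "q _"] by (simp add: F_def mult.commute)
    qed
    have Fx: "(LINT x|lborel. F x y) = ?\<sigma> * (indicator {y. s < norm y} y * rf y)" for y
      unfolding F_def G_def rf_def J using \<sigma> by (cases "s < norm y") (auto simp: indicator_def of_bool_def)
    have "(LINT y|lborel. ?\<sigma> * (indicator {y. s < norm y} y * rf y)) = (LINT y|lborel. (LINT x|lborel. F x y))"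
      by (simp only: Fx)
    also have "\<dots> = (LINT x|lborel. (LINT y|lborel. F x y))" by (rule lborel_pair.Fubini_integral[OF Fi])
    also have "\<dots> = (LINT x|lborel. unit_ball_vol ?N * ((1 - (s / max s (norm x)) ^ ?N) * P x))"
      using Fy[of "q _"] by (simp only: F_def mult.commute[of _ "q _"] qP)
    also have "\<dots> = - ?\<sigma> * (LINT y|lborel. indicator {y. s < norm y} y * \<phi> y)"
      using cut(2) by (simp add: unit_sphere_area_def)
    finally have "?\<sigma> * (LINT y|lborel. indicator {y. s < norm y} y * rf y) = ?\<sigma> * - (LINT y|lborel. indicator {y. s < norm y} y * \<phi> y)"
      by simp
    then have "(LINT y|lborel. indicator {y. s < norm y} y * rf y) = - (LINT y|lborel. indicator {y. s < norm y} y * \<phi> y)"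
      unfolding mult_cancel_left using \<sigma> by linarith
    moreover have "integrable lborel (\<lambda>y. ?\<sigma> * (indicator {y. s < norm y} y * rf y))"
      using lborel_pair.integrable_snd[OF Fi] by (simp only: Fx)
    ultimately show ?thesis using \<sigma> by simp
  qed
  have eq: "indicator {y. s < norm y} y * H y = indicator {y. s < norm y} y * rf y + indicator {y. s < norm y} y * \<phi> y" for s y
    by (simp add: H_def rf_def distrib_left)
  have Hm[measurable]: "H \<in> borel_measurable borel" unfolding H_def by measurable
  have pos: "integrable lborel (\<lambda>y. indicator {y. s < norm y} y * H y) \<and> (LINT y|lborel. indicator {y. s < norm y} y * H y) = 0"
    if "0 \<le> s" for s
    unfolding eq using key[OF that] \<phi>i[of s] by simp
  have ae: "AE y in lborel. indicator {y. 0 < norm y} y * H y = H y"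
    using AE_norm_neq[of 0] by eventually_elim auto
  show Hi: "integrable lborel H"
    using pos[of 0] ae by (subst integrable_cong_AE[symmetric, OF _ _ ae]) auto
  show "(LINT y|lborel. indicator {y. s < norm y} y * H y) = 0"
  proof (cases "0 \<le> s")
    case False
    \<comment> \<open>Half-lines with negative end point occur in the uniqueness of measures; for
      them the indicator is 1 everywhere, which is the case s = 0 up to the null set containing only
      the origin.\<close>
    then have "s < norm y" for y :: "real^'n" using norm_ge_zero[of y] by linarith
    then have "(LINT y|lborel. indicator {y. s < norm y} y * H y) = (LINT y|lborel. H y)" by simp
    also have "\<dots> = (LINT y|lborel. indicator {y. 0 < norm y} y * H y)"
      by (rule integral_cong_AE) (use ae in \<open>auto elim: eventually_mono\<close>)
    finally show ?thesis using pos[of 0] by simp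
  qed (use pos in blast)
qed


section \<open>The potential of a radial source\<close>

locale radial_source =
  fixes f :: "real^'n \<Rightarrow> real" and f' :: "real \<Rightarrow> real" and R :: real
  assumes dim: "CARD('n) = 2 \<or> CARD('n) = 3"
    and R: "0 < R"
    and f_measurable: "f \<in> borel_measurable lebesgue"
    and f_square: "integrable lebesgue (\<lambda>x. (f x)\<^sup>2)"
    and f_nonneg: "\<And>x. 0 \<le> f x"
    and f_radial: "\<And>x. f x = f' (norm x)"
    and f_support: "AE x in lebesgue. R < norm x \<longrightarrow> f x = 0"
begin

definition mass :: real where "mass = (LINT y|lebesgue. f y)"

text \<open>Newton's shell theorem: averaging the Green function of the ball over the sphere \<open>|y| = t\<close> leaves
  \<open>k\<^sub>r(max |x| t)\<close>.\<close>

definition potential :: "real \<Rightarrow> real^'n \<Rightarrow> real" where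
  "potential r x = (LINT y|lebesgue. f y * radial_kernel CARD('n) r (max (norm x) (norm y)))"

lemma AE_good: "AE y in lebesgue. 0 < norm (y::real^'n) \<and> (R < norm y \<longrightarrow> f y = 0)"
  using AE_completion[OF AE_norm_neq[of 0]] f_support by eventually_elim auto

lemma f_mult_measurable:
  fixes g :: "real^'n \<Rightarrow> real"
  assumes "g \<in> borel_measurable borel"
  shows "(\<lambda>y. f y * g y) \<in> borel_measurable lebesgue"
  using assms by (intro borel_measurable_times f_measurable measurable_completion) simp

text \<open>The pointwise bound |f g| \<le> f^2 + g^2 plays the role of Cauchy-Schwarz. Control of
  \<open>g\<close> is asked only for 0 < |y| \<le> R: almost everywhere beyond \<open>R\<close> the
  source vanishes, and at 0 the kernel is singular.\<close>

lemma integrable_f_mult: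
  fixes g :: "real^'n \<Rightarrow> real"
  assumes [measurable]: "g \<in> borel_measurable lebesgue" and b: "integrable lebesgue h"
    and le: "\<And>y. 0 < norm y \<Longrightarrow> norm y \<le> R \<Longrightarrow> (g y)\<^sup>2 \<le> h y"
  shows "integrable lebesgue (\<lambda>y. f y * g y)"
proof (rule Bochner_Integration.integrable_bound[OF Bochner_Integration.integrable_add[OF f_square integrable_abs[OF b]]])
  show "(\<lambda>y. f y * g y) \<in> borel_measurable lebesgue" using f_measurable by measurable
  show "AE y in lebesgue. norm (f y * g y) \<le> norm ((f y)\<^sup>2 + \<bar>h y\<bar>)"
    using AE_good
  proof eventually_elim
    case (elim y)
    show ?case
    proof (cases "R < norm y")
      case False
      have "2 * (\<bar>f y\<bar> * \<bar>g y\<bar>) \<le> \<bar>f y\<bar>\<^sup>2 + \<bar>g y\<bar>\<^sup>2"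
        using sum_squares_bound[of "\<bar>f y\<bar>" "\<bar>g y\<bar>"] by simp
      moreover have "(g y)\<^sup>2 \<le> \<bar>h y\<bar>" using le[of y] elim False by linarith
      moreover have "0 \<le> \<bar>f y\<bar> * \<bar>g y\<bar>" by simp
      ultimately have "\<bar>f y\<bar> * \<bar>g y\<bar> \<le> (f y)\<^sup>2 + \<bar>h y\<bar>" by (simp only: power2_abs)
      then show ?thesis by (simp add: abs_mult)
    qed (use elim in simp)
  qed
qed

lemma integrable_bounded_support: "integrable lebesgue (\<lambda>y. c * indicator (cball (0::real^'n) R) y :: real)"
  using emeasure_lborel_cball_finite[of "0::real^'n" R]
  by (intro integrable_mult_right integrable_real_indicator) auto

lemma integrable_f_bounded:
  assumes "g \<in> borel_measurable lebesgue" "\<And>y. \<bar>g y\<bar> \<le> B"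
  shows "integrable lebesgue (\<lambda>y. f y * g y)"
proof (rule integrable_f_mult[OF assms(1) integrable_bounded_support[of "B\<^sup>2"]])
  fix y :: "real^'n" assume "norm y \<le> R"
  then show "(g y)\<^sup>2 \<le> B\<^sup>2 * indicator (cball 0 R) y"
    using power_mono[OF assms(2)[of y], of 2] by simp
qed

lemma kernel_measurable_lebesgue: "(\<lambda>y::real^'n. radial_kernel CARD('n) r (norm y)) \<in> borel_measurable lebesgue"
  by (intro measurable_completion) measurable

lemma integrable_f_kernel:
  assumes "R \<le> r"
  shows "integrable lebesgue (\<lambda>y. f y * radial_kernel CARD('n) r (norm y))"
proof (rule integrable_f_mult[OF kernel_measurable_lebesgue])
  let ?C = "(4 * r + 1) / (unit_sphere_area CARD('n))\<^sup>2"
  \<comment> \<open>The radius R + 1 makes the open ball of the weight contain the closed ball of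
    radius \<open>R\<close>.\<close>
  let ?h = "\<lambda>y::real^'n. ?C * (indicator (ball 0 (R + 1)) y * (1 / norm y ^ (CARD('n) - 1)))"
  have "integrable lborel ?h"
    using integrable_inverse_norm_power[where 'a="real^'n", of "R + 1"] by (intro integrable_mult_right) simp
  then show "integrable lebesgue ?h" using integrable_completion[of ?h lborel] by auto
  fix y :: "real^'n" assume y: "0 < norm y" "norm y \<le> R"
  then show "(radial_kernel CARD('n) r (norm y))\<^sup>2 \<le> ?h y"
    using radial_kernel_square_le[OF dim, of "norm y" r] assms by simp
qed

text \<open>Where \<open>f\<close> is nonzero, |y| \<le> R \<le> |x| almost everywhere, so the
  maximum is |x|. Boundary values and gradients of the potential are read off from this closed
  form.\<close>

lemma potential_outside:
  assumes "R \<le> norm x"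
  shows "potential r x = mass * radial_kernel CARD('n) r (norm x)"
proof -
  have "potential r x = (LINT y|lebesgue. f y * radial_kernel CARD('n) r (norm x))"
    unfolding potential_def
  proof (rule integral_cong_AE)
    show "(\<lambda>y. f y * radial_kernel CARD('n) r (max (norm x) (norm y))) \<in> borel_measurable lebesgue"
      by (rule f_mult_measurable) measurable
    show "(\<lambda>y. f y * radial_kernel CARD('n) r (norm x)) \<in> borel_measurable lebesgue" using f_measurable by measurable
    show "AE y in lebesgue. f y * radial_kernel CARD('n) r (max (norm x) (norm y)) = f y * radial_kernel CARD('n) r (norm x)"
      using AE_good
    proof eventually_elim
      case (elim y)
      then show ?case
      proof (cases "R < norm y")
        case False
        then have "max (norm x) (norm y) = norm x" using assms by simp
        then show ?thesis by simp
      qed simp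
    qed
  qed
  then show ?thesis by (simp add: mass_def)
qed

text \<open>The upper bound is independent of x, so it serves as the dominating function both for
  continuity of the potential and for Fubini's theorem.\<close>

lemma kernel_bounds:
  assumes "0 < norm y" "norm y \<le> R" "R \<le> r" "norm x \<le> r"
  shows "0 \<le> radial_kernel CARD('n) r (max (norm x) (norm y))"
    "radial_kernel CARD('n) r (max (norm x) (norm y)) \<le> radial_kernel CARD('n) r (norm y)"
proof -
  have "0 < max (norm x) (norm y)" "max (norm x) (norm y) \<le> r" using assms by (simp_all add: less_max_iff_disj)
  then show "0 \<le> radial_kernel CARD('n) r (max (norm x) (norm y))" by (rule radial_kernel_nonneg[OF dim])
  show "radial_kernel CARD('n) r (max (norm x) (norm y)) \<le> radial_kernel CARD('n) r (norm y)"
    using assms(1) by (intro radial_kernel_antimono[OF dim]) auto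
qed

lemma potential_nonneg:
  assumes "R \<le> r" "norm x \<le> r"
  shows "0 \<le> potential r x"
  unfolding potential_def
proof (rule integral_nonneg_AE)
  show "AE y in lebesgue. 0 \<le> f y * radial_kernel CARD('n) r (max (norm x) (norm y))"
    using AE_good
  proof eventually_elim
    case (elim y)
    show ?case
    proof (cases "R < norm y")
      case False
      then show ?thesis using elim kernel_bounds(1)[of y r x] assms f_nonneg[of y] by simp
    qed (use elim in simp)
  qed
qed

lemma continuous_on_potential:
  assumes "R \<le> r"
  shows "continuous_on (cball 0 r) (potential r)"
proof (rule continuous_on_sequentiallyI)
  fix u :: "nat \<Rightarrow> real^'n" and a assume u: "\<forall>n. u n \<in> cball 0 r" "a \<in> cball 0 r" "u \<longlonglongrightarrow> a"
  have m: "(\<lambda>y. f y * radial_kernel CARD('n) r (max (norm x) (norm y))) \<in> borel_measurable lebesgue" for x :: "real^'n"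
    by (rule f_mult_measurable) measurable
  show "(\<lambda>n. potential r (u n)) \<longlonglongrightarrow> potential r a"
    unfolding potential_def
  proof (rule integral_dominated_convergence[OF m m integrable_f_kernel[OF assms]])
    show "AE y in lebesgue. (\<lambda>n. f y * radial_kernel CARD('n) r (max (norm (u n)) (norm y))) \<longlonglongrightarrow> f y * radial_kernel CARD('n) r (max (norm a) (norm y))"
      using AE_good
    proof eventually_elim
      case (elim y)
      have "isCont (radial_kernel CARD('n) r) (max (norm a) (norm y))"
        using elim by (intro DERIV_isCont[OF DERIV_radial_kernel[OF dim]]) (auto simp: less_max_iff_disj)
      moreover have "(\<lambda>n. max (norm (u n)) (norm y)) \<longlonglongrightarrow> max (norm a) (norm y)"
        by (intro tendsto_intros u)
      ultimately show ?case by (rule tendsto_mult[OF tendsto_const isCont_tendsto_compose])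
    qed
    show "AE y in lebesgue. norm (f y * radial_kernel CARD('n) r (max (norm (u n)) (norm y))) \<le> f y * radial_kernel CARD('n) r (norm y)" for n
      using AE_good
    proof eventually_elim
      case (elim y)
      show ?case
      proof (cases "R < norm y")
        case False
        moreover have "norm (u n) \<le> r" using u(1) by simp
        ultimately have k: "0 \<le> radial_kernel CARD('n) r (max (norm (u n)) (norm y))"
          "radial_kernel CARD('n) r (max (norm (u n)) (norm y)) \<le> radial_kernel CARD('n) r (norm y)"
          using kernel_bounds[of y r "u n"] elim assms by linarith+
        show ?thesis using k(1) f_nonneg[of y] mult_left_mono[OF k(2) f_nonneg[of y]] by (simp only: real_norm_def abs_of_nonneg mult_nonneg_nonneg)
      qed (use elim in simp)
    qed
  qed
qed

text \<open>Fubini and \<open>radial_kernel_parts\<close> turn the integral of the potential against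
  the Laplacian into that of \<open>f\<close> against \<open>radial_flux \<phi> (norm y)\<close>. As
  \<open>f\<close> is radial, \<open>integral_radial_eq_0\<close> lets -\<open>\<phi>\<close> take
  the place of the flux.\<close>

lemma potential_weak:
  assumes Rr: "R < r" and \<phi>: "test_function (ball 0 r) \<phi>"
  shows "- (LINT x:ball 0 r|lebesgue. potential r x * laplacian \<phi> x) = (LINT x:ball 0 r|lebesgue. f x * \<phi> x)"
proof -
  \<comment> \<open>Fubini is used over \<open>lborel\<close>, hence a Borel representative. It need
    not be radial, so the last step returns to \<open>f\<close>.\<close>
  obtain fb where fb[measurable]: "fb \<in> borel_measurable lborel" and fb_eq: "AE y in lborel. f y = fb y"
    using completion_ex_borel_measurable_real[OF f_measurable] by metis
  have fb_lint: "(LINT y|lebesgue. f y * g y) = (LINT y|lborel. fb y * g y)" 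
    "integrable lebesgue (\<lambda>y. f y * g y) \<longleftrightarrow> integrable lborel (\<lambda>y. fb y * g y)"
    if g[measurable]: "g \<in> borel_measurable borel" for g
  proof -
    have m: "(\<lambda>y. fb y * g y) \<in> borel_measurable lborel" by measurable
    have m1: "(\<lambda>y. f y * g y) \<in> borel_measurable lebesgue" using g by (rule f_mult_measurable)
    have m2: "(\<lambda>y. fb y * g y) \<in> borel_measurable lebesgue" using m by (rule measurable_completion)
    have ae: "AE y in lebesgue. f y * g y = fb y * g y"
      using AE_completion[OF fb_eq] by eventually_elim simp
    show "(LINT y|lebesgue. f y * g y) = (LINT y|lborel. fb y * g y)"
      using integral_cong_AE[OF m1 m2 ae] integral_completion[OF m] by simp
    show "integrable lebesgue (\<lambda>y. f y * g y) \<longleftrightarrow> integrable lborel (\<lambda>y. fb y * g y)"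
      using integrable_cong_AE[OF m1 m2 ae] integrable_completion[OF m] by simp
  qed
  have good: "AE y in lborel. 0 < norm y \<and> (R < norm y \<longrightarrow> fb y = 0)"
    using AE_good[unfolded AE_completion_iff] fb_eq by eventually_elim auto
  have lapc: "continuous_on UNIV (laplacian \<phi>)" by (rule laplacian_test_function[OF \<phi>])
  then have [measurable]: "laplacian \<phi> \<in> borel_measurable borel" by (rule borel_measurable_continuous_onI)
  have \<phi>m[measurable]: "\<phi> \<in> borel_measurable borel"
    by (intro borel_measurable_continuous_onI test_function_continuous[OF \<phi>])
  obtain K where K: "compact K" "K \<subseteq> ball 0 r" "\<And>x. x \<notin> K \<Longrightarrow> laplacian \<phi> x = 0"
    using laplacian_support[OF \<phi>] by metis
  have lapi: "integrable lborel (laplacian \<phi>)" by (rule integrable_continuous_support[OF lapc K(1,3)])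
  define k where "k x y = radial_kernel CARD('n) r (max (norm x) (norm y))" for x y :: "real^'n"
  have [measurable]: "k x \<in> borel_measurable borel" for x unfolding k_def[abs_def] by measurable
  have potential_eq: "potential r x = (LINT y|lborel. fb y * k x y)" for x
    unfolding potential_def k_def[symmetric] by (rule fb_lint) measurable
  have potential_meas[measurable]: "potential r \<in> borel_measurable borel"
    unfolding potential_eq[abs_def] k_def by measurable
  define F where "F y x = fb y * k x y * laplacian \<phi> x" for x y
  have Fm: "case_prod F \<in> borel_measurable (lborel \<Otimes>\<^sub>M lborel)"
    unfolding F_def k_def by measurable
  have kc: "continuous_on UNIV (\<lambda>x. k x y)" if "0 < norm y" for y
    unfolding k_def using that by (intro continuous_on_compose2[OF continuous_on_radial_kernel[OF dim order_refl]] continuous_intros) (auto simp: less_max_iff_disj)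
  have ki: "integrable lborel (\<lambda>x. k x y * laplacian \<phi> x)" if "0 < norm y" for y
    by (rule integrable_continuous_support[OF _ K(1)]) (use K(3) in \<open>auto intro!: continuous_intros kc[OF that] lapc\<close>)
  have Fi: "integrable (lborel \<Otimes>\<^sub>M lborel) (case_prod F)"
  proof (rule lborel_pair.Fubini_integrable[OF Fm])
    define B where "B = (LINT x|lborel. \<bar>laplacian \<phi> x\<bar>)"
    have "integrable lborel (\<lambda>y. fb y * radial_kernel CARD('n) r (norm y))"
      using integrable_f_kernel[of r] Rr fb_lint(2)[of "\<lambda>y. radial_kernel CARD('n) r (norm y)"] by simp
    then have i: "integrable lborel (\<lambda>y. fb y * radial_kernel CARD('n) r (norm y) * B)" by simp
    show "integrable lborel (\<lambda>y. LINT x|lborel. norm (case_prod F (y, x)))"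
    proof (rule Bochner_Integration.integrable_bound[OF i])
      show "(\<lambda>y. LINT x|lborel. norm (case_prod F (y, x))) \<in> borel_measurable lborel"
        using Fm by measurable
      show "AE y in lborel. norm (LINT x|lborel. norm (case_prod F (y, x))) \<le> norm (fb y * radial_kernel CARD('n) r (norm y) * B)"
        using good
      proof eventually_elim
        case (elim y)
        show ?case
        proof (cases "R < norm y")
          case False
          then have y: "0 < norm y" "norm y \<le> R" using elim by auto
          have le: "norm (F y x) \<le> \<bar>fb y\<bar> * radial_kernel CARD('n) r (norm y) * \<bar>laplacian \<phi> x\<bar>" for x
          proof (cases "x \<in> K")
            case True
            then have "norm x \<le> r" using K(2) by auto
            then show ?thesis using kernel_bounds[OF y, of r x] Rr
              by (auto simp: F_def k_def abs_mult intro!: mult_right_mono mult_left_mono)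
          qed (simp add: F_def K(3))
          have "(LINT x|lborel. norm (F y x)) \<le> (LINT x|lborel. \<bar>fb y\<bar> * radial_kernel CARD('n) r (norm y) * \<bar>laplacian \<phi> x\<bar>)"
            using le ki[OF y(1)] lapi by (intro integral_mono integrable_norm) (auto simp: F_def mult.assoc)
          also have "\<dots> = \<bar>fb y\<bar> * radial_kernel CARD('n) r (norm y) * B" by (simp add: B_def)
          also have "\<dots> = norm (fb y * radial_kernel CARD('n) r (norm y) * B)"
            using radial_kernel_nonneg[OF dim y(1), of r] y Rr by (simp add: B_def abs_mult)
          finally show ?thesis by simp
        qed (use elim in \<open>simp add: F_def\<close>)
      qed
    qed
    show "AE y in lborel. integrable lborel (\<lambda>x. case_prod F (y, x))"
      using good by eventually_elim (use ki in \<open>simp add: F_def mult.assoc\<close>)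
  qed
  have ball0: "x \<notin> ball 0 r \<Longrightarrow> laplacian \<phi> x = 0" for x using K by blast
  have "(LINT x:ball 0 r|lebesgue. potential r x * laplacian \<phi> x) = (LINT x|lborel. potential r x * laplacian \<phi> x)"
    by (rule set_integral_lebesgue_eq_lborel) (auto simp: ball0)
  also have "\<dots> = (LINT x|lborel. (LINT y|lborel. F y x))"
    unfolding potential_eq F_def by (intro Bochner_Integration.integral_cong refl) simp
  also have "\<dots> = (LINT y|lborel. (LINT x|lborel. F y x))"
    by (rule lborel_pair.Fubini_integral[OF Fi])
  also have "\<dots> = (LINT y|lborel. fb y * radial_flux \<phi> (norm y))"
  proof (rule integral_cong_AE)
    note rf = radial_flux_identity[OF \<phi>]
    note [measurable] = rf(4)
    show "(\<lambda>y. LINT x|lborel. F y x) \<in> borel_measurable lborel" using Fm by measurable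
    show "(\<lambda>y. fb y * radial_flux \<phi> (norm y)) \<in> borel_measurable lborel" by measurable
    show "AE y in lborel. (LINT x|lborel. F y x) = fb y * radial_flux \<phi> (norm y)"
      using good
    proof eventually_elim
      case (elim y)
      then show ?case
        using radial_kernel_parts[OF dim _ \<phi>, of "norm y" r]
        by (simp add: F_def k_def radial_flux_def mult.assoc max.commute)
    qed
  qed
  also have "\<dots> = - (LINT y|lebesgue. f y * \<phi> y)"
  proof -
    note rf = radial_flux_identity[OF \<phi>]
    note [measurable] = rf(4)
    obtain B where B: "\<And>t. \<bar>radial_flux \<phi> t\<bar> \<le> B" using rf(3) by blast
    obtain M where M: "\<And>x. \<bar>\<phi> x\<bar> \<le> M" using test_function_bounded[OF \<phi>] by metis
    have m: "(\<lambda>y. radial_flux \<phi> (norm y)) \<in> borel_measurable borel" by measurable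
    have i1: "integrable lebesgue (\<lambda>y. f y * radial_flux \<phi> (norm y))"
      by (rule integrable_f_bounded[of _ B]) (auto intro!: measurable_completion B)
    have i2: "integrable lebesgue (\<lambda>y. f y * \<phi> y)"
      by (rule integrable_f_bounded[of _ M]) (auto intro!: measurable_completion M)
    have "(LINT y|lebesgue. f' (norm y) * (radial_flux \<phi> (norm y) + \<phi> y)) = 0"
    proof (rule integral_radial_eq_0[OF rf(1,2)])
      have "(\<lambda>y. f' (norm y)) = f" by (rule ext) (rule f_radial[symmetric])
      then show "(\<lambda>y::real^'n. f' (norm y)) \<in> borel_measurable lebesgue" using f_measurable by metis
      show "0 \<le> f' (norm y)" for y :: "real^'n" using f_nonneg f_radial by metis
    qed
    then have "(LINT y|lebesgue. f y * radial_flux \<phi> (norm y)) + (LINT y|lebesgue. f y * \<phi> y) = 0"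
      using i1 i2 by (simp add: f_radial[symmetric] distrib_left)
    then show ?thesis using fb_lint(1)[OF m] by simp
  qed
  finally have 1: "- (LINT x:ball 0 r|lebesgue. potential r x * laplacian \<phi> x) = (LINT y|lebesgue. f y * \<phi> y)" by simp
  have "(\<lambda>y. indicator (ball 0 r) y *\<^sub>R (f y * \<phi> y)) = (\<lambda>y. f y * \<phi> y)"
    using test_function_zero[OF \<phi>] by (auto simp: indicator_def fun_eq_iff)
  then show ?thesis unfolding 1 by (simp only: set_lebesgue_integral_def)
qed

lemma dirichlet_solution_potential:
  assumes "R < r"
  shows "dirichlet_solution (ball 0 r) f (potential r)"
  unfolding dirichlet_solution_def
proof (intro conjI ballI allI impI)
  have r: "0 < r" "r \<noteq> 0" using assms R by auto
  then show "continuous_on (closure (ball 0 r)) (potential r)" using continuous_on_potential[of r] assms by simp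
  show "potential r x = 0" if "x \<in> frontier (ball 0 r)" for x
    using that r assms potential_outside[of x r] by simp
qed (rule potential_weak[OF assms])

end


section \<open>Comparison at contact points\<close>

lemma set_integral_superset:
  fixes h :: "'a \<Rightarrow> real"
  assumes "S \<subseteq> T" "\<And>x. x \<notin> S \<Longrightarrow> h x = 0"
  shows "(LINT x:S|M. h x) = (LINT x:T|M. h x)"
proof -
  have "(\<lambda>x. indicator S x *\<^sub>R h x) = (\<lambda>x. indicator T x *\<^sub>R h x)"
    using assms by (auto simp: indicator_def fun_eq_iff)
  then show ?thesis by (simp only: set_lebesgue_integral_def)
qed

lemma set_integrable_mult_laplacian:
  fixes u :: "real^'n \<Rightarrow> real"
  assumes \<phi>: "test_function S \<phi>" and u: "continuous_on (closure S) u"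
  shows "set_integrable lebesgue S (\<lambda>x. u x * laplacian \<phi> x)"
proof -
  obtain K where K: "compact K" "K \<subseteq> S" "\<And>x. x \<notin> K \<Longrightarrow> laplacian \<phi> x = 0"
    using laplacian_support[OF \<phi>] by metis
  have "K \<subseteq> closure S" using K(2) closure_subset by blast
  then have "continuous_on K (\<lambda>x. u x * laplacian \<phi> x)"
    by (intro continuous_intros continuous_on_subset[OF u] laplacian_test_function[OF \<phi>])
  then have i: "integrable lborel (\<lambda>x. indicator K x *\<^sub>R (u x * laplacian \<phi> x))"
    by (rule borel_integrable_compact[OF K(1)])
  then have "integrable lebesgue (\<lambda>x. indicator K x *\<^sub>R (u x * laplacian \<phi> x))"
    by (subst integrable_completion) (rule borel_measurable_integrable, auto)
  moreover have "(\<lambda>x. indicator K x *\<^sub>R (u x * laplacian \<phi> x)) = (\<lambda>x. indicator S x *\<^sub>R (u x * laplacian \<phi> x))"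
    using K(2,3) by (auto simp: indicator_def fun_eq_iff)
  ultimately show ?thesis by (simp only: set_integrable_def)
qed

lemma weak_comparison:
  fixes u v :: "real^'n \<Rightarrow> real"
  assumes "open S" "bounded S" and u: "continuous_on (closure S) u" and v: "continuous_on (closure S) v"
    and eq: "\<And>\<phi>. test_function S \<phi> \<Longrightarrow> (LINT x:S|lebesgue. u x * laplacian \<phi> x) = (LINT x:S|lebesgue. v x * laplacian \<phi> x)"
    and bd: "\<And>x. x \<in> frontier S \<Longrightarrow> u x \<le> v x"
    and x: "x \<in> closure S"
  shows "u x \<le> v x"
proof -
  have "0 \<le> v x - u x"
  proof (rule weak_min_principle[OF assms(1,2) _ _ _ x])
    show "continuous_on (closure S) (\<lambda>x. v x - u x)" by (intro continuous_intros u v)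
    show "0 \<le> v x - u x" if "x \<in> frontier S" for x using bd[OF that] by simp
    fix \<phi> :: "real^'n \<Rightarrow> real" assume \<phi>: "test_function S \<phi>"
    have "(LINT x:S|lebesgue. (v x - u x) * laplacian \<phi> x) =
        (LINT x:S|lebesgue. v x * laplacian \<phi> x) - (LINT x:S|lebesgue. u x * laplacian \<phi> x)"
      unfolding left_diff_distrib
      by (intro set_integral_diff set_integrable_mult_laplacian[OF \<phi>] u v)
    then show "(LINT x:S|lebesgue. (v x - u x) * laplacian \<phi> x) \<le> 0" using eq[OF \<phi>] by simp
  qed
  then show ?thesis by simp
qed

lemma dirichlet_solution_restrict:
  assumes "dirichlet_solution T f u" "test_function S \<phi>" "S \<subseteq> T"
  shows "(LINT x:S|lebesgue. u x * laplacian \<phi> x) = - (LINT x:S|lebesgue. f x * \<phi> x)"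
proof -
  have "(LINT x:S|lebesgue. u x * laplacian \<phi> x) = (LINT x:T|lebesgue. u x * laplacian \<phi> x)"
    by (rule set_integral_superset) (use assms laplacian_test_function(2)[OF assms(2)] in auto)
  also have "\<dots> = - (LINT x:T|lebesgue. f x * \<phi> x)"
  proof -
    have "- (LINT x:T|lebesgue. u x * laplacian \<phi> x) = (LINT x:T|lebesgue. f x * \<phi> x)"
      using assms(1) test_function_mono[OF assms(2,3)] unfolding dirichlet_solution_def by blast
    then show ?thesis by linarith
  qed
  also have "(LINT x:T|lebesgue. f x * \<phi> x) = (LINT x:S|lebesgue. f x * \<phi> x)"
    by (rule set_integral_superset[symmetric]) (use assms test_function_zero[OF assms(2)] in auto)
  finally show ?thesis .
qed

lemma gderiv_line:
  fixes u :: "'a::real_inner \<Rightarrow> real"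
  assumes "GDERIV u (a + t *\<^sub>R e) :> G"
  shows "((\<lambda>s. u (a + s *\<^sub>R e)) has_real_derivative e \<bullet> G) (at t)"
proof -
  have "((\<lambda>s. a + s *\<^sub>R e) has_derivative (\<lambda>s. s *\<^sub>R e)) (at t)"
    by (auto intro!: derivative_eq_intros)
  from has_derivative_compose[OF this assms[unfolded gderiv_def]]
  show ?thesis by (simp add: has_field_derivative_def mult.commute[of _ "e \<bullet> G"])
qed

lemma boundary_gradient_normE:
  assumes "boundary_gradient_norm \<Omega> u g"
  obtains G where "\<And>x. x \<in> frontier \<Omega> \<Longrightarrow> \<forall>\<^sub>F y in at x within \<Omega>. GDERIV u y :> G y"
    "\<And>x. x \<in> frontier \<Omega> \<Longrightarrow> ((\<lambda>y. norm (G y)) \<longlongrightarrow> g x) (at x within \<Omega>)"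
  using assms unfolding boundary_gradient_norm_def by blast

section \<open>Barriers and contact estimates\<close>

context radial_source begin

text \<open>Gauss's law: total mass divided by the area of the sphere, which for r > R is the
  gradient norm of every potential at |x| = r.\<close>

definition flux :: "real \<Rightarrow> real" where
  "flux r = mass / (unit_sphere_area CARD('n) * r ^ (CARD('n) - 1))"

lemma mass_nonneg: "0 \<le> mass"
  unfolding mass_def by (intro integral_nonneg_AE AE_I2 f_nonneg)

lemma flux_nonneg: "0 < r \<Longrightarrow> 0 \<le> flux r"
  unfolding flux_def using mass_nonneg unit_sphere_area_pos[of "CARD('n)"] by simp

lemma DERIV_mass_kernel:
  "0 < \<rho> \<Longrightarrow> ((\<lambda>\<rho>. mass * radial_kernel CARD('n) r \<rho>) has_real_derivative - flux \<rho>) (at \<rho>)"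
  by (rule DERIV_cong[OF DERIV_cmult[OF DERIV_radial_kernel[OF dim]]]) (auto simp: flux_def)

lemma solution_nonneg:
  assumes "open \<Omega>" "bounded \<Omega>" and u: "dirichlet_solution \<Omega> f u" and x: "x \<in> closure \<Omega>"
  shows "0 \<le> u x"
proof (rule weak_min_principle[OF assms(1,2) _ _ _ x])
  show "continuous_on (closure \<Omega>) u" "\<And>x. x \<in> frontier \<Omega> \<Longrightarrow> 0 \<le> u x"
    using u by (auto simp: dirichlet_solution_def)
  fix \<phi> :: "real^'n \<Rightarrow> real" assume \<phi>: "test_function \<Omega> \<phi>" "\<And>x. 0 \<le> \<phi> x"
  have "0 \<le> (LINT x:\<Omega>|lebesgue. f x * \<phi> x)"
    unfolding set_lebesgue_integral_def
    by (intro integral_nonneg_AE AE_I2) (simp add: f_nonneg \<phi>(2))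
  then show "(LINT x:\<Omega>|lebesgue. u x * laplacian \<phi> x) \<le> 0"
    using dirichlet_solution_restrict[OF u \<phi>(1)] by simp
qed

text \<open>Both functions have the same source in the ball; on its boundary the potential is 0
  while \<open>u\<close> is nonnegative.\<close>

lemma potential_le_solution:
  assumes "open \<Omega>" "bounded \<Omega>" and u: "dirichlet_solution \<Omega> f u" 
    and r: "R < r" "ball 0 r \<subseteq> \<Omega>" and x: "norm x \<le> r"
  shows "potential r x \<le> u x"
proof (rule weak_comparison[of "ball 0 r"])
  have r0: "0 < r" using r R by simp
  have sub: "closure (ball 0 r) \<subseteq> closure \<Omega>" by (rule closure_mono) fact
  show "continuous_on (closure (ball 0 r)) u"
    using u sub by (auto simp: dirichlet_solution_def intro: continuous_on_subset)
  show "continuous_on (closure (ball 0 r)) (potential r)" using dirichlet_solution_potential[OF r(1)] by (simp add: dirichlet_solution_def)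
  show "(LINT x:ball 0 r|lebesgue. potential r x * laplacian \<phi> x) = (LINT x:ball 0 r|lebesgue. u x * laplacian \<phi> x)"
    if "test_function (ball 0 r) \<phi>" for \<phi>
    using dirichlet_solution_restrict[OF u that r(2)] dirichlet_solution_restrict[OF dirichlet_solution_potential[OF r(1)] that] by simp
  show "potential r x \<le> u x" if "x \<in> frontier (ball 0 r)" for x
  proof -
    have "x \<in> closure \<Omega>" using that sub by (auto simp: frontier_def)
    then show ?thesis using solution_nonneg[OF assms(1,2) u] dirichlet_solution_potential[OF r(1)] that by (simp add: dirichlet_solution_def)
  qed
  show "x \<in> closure (ball 0 r)" using x r0 by simp
qed auto

lemma solution_le_potential:
  assumes "open \<Omega>" "bounded \<Omega>" and u: "dirichlet_solution \<Omega> f u" 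
    and r: "R < r" "\<Omega> \<subseteq> ball 0 r" and x: "x \<in> closure \<Omega>"
  shows "u x \<le> potential r x"
proof (rule weak_comparison[OF assms(1,2) _ _ _ _ x])
  have r0: "0 < r" using r R by simp
  have sub: "closure \<Omega> \<subseteq> cball 0 r" using closure_mono[OF r(2)] r0 by simp
  show "continuous_on (closure \<Omega>) u" using u by (simp add: dirichlet_solution_def)
  show "continuous_on (closure \<Omega>) (potential r)" using continuous_on_potential[of r] r sub by (auto intro: continuous_on_subset)
  show "(LINT x:\<Omega>|lebesgue. u x * laplacian \<phi> x) = (LINT x:\<Omega>|lebesgue. potential r x * laplacian \<phi> x)"
    if "test_function \<Omega> \<phi>" for \<phi>
    using dirichlet_solution_restrict[OF u that] dirichlet_solution_restrict[OF dirichlet_solution_potential[OF r(1)] that r(2)] by simp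
  show "u x \<le> potential r x" if "x \<in> frontier \<Omega>" for x
  proof -
    have "norm x \<le> r" using that sub by (auto simp: frontier_def)
    then show ?thesis using potential_nonneg[of r x] r u that by (simp add: dirichlet_solution_def)
  qed
qed

text \<open>Otherwise take g x < k < flux r and walk from x towards the origin, a path inside the
  ball. The mean value theorem keeps the growth of \<open>u\<close> at rate at most
  \<open>k\<close>, whereas \<open>u\<close> stays above the potential, which starts with slope flux
  r.\<close>

lemma flux_le_at_inner_contact:
  assumes "open \<Omega>" "bounded \<Omega>" and u: "dirichlet_solution \<Omega> f u" and bg: "boundary_gradient_norm \<Omega> u g"
    and r: "R < r" "ball 0 r \<subseteq> \<Omega>" and x: "x \<in> frontier \<Omega>" "norm x = r"
  shows "flux r \<le> g x"
proof (rule ccontr)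
  assume "\<not> flux r \<le> g x"
  then obtain k where k: "g x < k" "k < flux r" using dense[of "g x" "flux r"] by auto
  have r0: "0 < r" using r R by simp
  obtain G where G: "\<forall>\<^sub>F y in at x within \<Omega>. GDERIV u y :> G y" "((\<lambda>y. norm (G y)) \<longlongrightarrow> g x) (at x within \<Omega>)"
    using boundary_gradient_normE[OF bg] x(1) by metis
  from G(1) have "\<forall>\<^sub>F y in at x within \<Omega>. GDERIV u y :> G y \<and> norm (G y) < k"
    by (rule eventually_conj[OF _ order_tendstoD(2)[OF G(2) k(1)]])
  then obtain d where d: "0 < d" "\<And>y. y \<in> \<Omega> \<Longrightarrow> y \<noteq> x \<Longrightarrow> dist y x < d \<Longrightarrow> GDERIV u y :> G y \<and> norm (G y) < k"
    unfolding eventually_at by auto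
  \<comment> \<open>The direction -x has length \<open>r\<close>, so all rates in \<open>t\<close>
    carry a factor \<open>r\<close>.\<close>
  define p where "p t = x + t *\<^sub>R (- x)" for t
  have p: "norm (p t) = (1 - t) * r" "dist (p t) x = t * r" if "0 \<le> t" "t \<le> 1" for t
  proof -
    have "p t = (1 - t) *\<^sub>R x" by (simp add: p_def algebra_simps)
    then show "norm (p t) = (1 - t) * r" using that x(2) by simp
    show "dist (p t) x = t * r" using that x(2) by (simp add: p_def dist_norm)
  qed
  have u_le: "u (p t) \<le> t * (k * r)" if t: "0 < t" "t < 1" "t * r < d" for t
  proof -
    have in_ball: "p s \<in> ball 0 r" if "0 < s" "s \<le> t" for s
      using p(1)[of s] that t r0 by simp
    have G: "GDERIV u (p s) :> G (p s) \<and> norm (G (p s)) < k" if s: "0 < s" "s \<le> t" for s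
    proof (rule d(2))
      show "p s \<in> \<Omega>" using in_ball[OF s] r(2) by blast
      have "s * r < d" using s r0 t(3) mult_right_mono[of s t r] by linarith
      moreover have "dist (p s) x = s * r" using p(2)[of s] s t by simp
      moreover have "0 < s * r" using s r0 by simp
      ultimately show "dist (p s) x < d" "p s \<noteq> x" by auto
    qed
    have c: "continuous_on {0..t} (\<lambda>s. u (p s))"
    proof (rule continuous_on_compose2[of "cball 0 r" u])
      have "cball 0 r \<subseteq> closure \<Omega>" using closure_mono[OF r(2)] r0 by simp
      then show "continuous_on (cball 0 r) u" using u by (auto simp: dirichlet_solution_def intro: continuous_on_subset)
      show "continuous_on {0..t} p" unfolding p_def by (intro continuous_intros)
      show "p ` {0..t} \<subseteq> cball 0 r" using p(1) t r0 by (auto simp: mult_left_le_one_le)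
    qed
    have D: "((\<lambda>s. u (p s)) has_real_derivative (- x) \<bullet> G (p s)) (at s)" if "0 < s" "s \<le> t" for s
      unfolding p_def by (rule gderiv_line) (use G[OF that] in \<open>simp add: p_def\<close>)
    obtain l z where z: "0 < z" "z < t" "((\<lambda>s. u (p s)) has_real_derivative l) (at z)" "u (p t) - u (p 0) = (t - 0) * l"
      using MVT[OF t(1) c] D real_differentiable_def by (metis less_imp_le)
    have "l = (- x) \<bullet> G (p z)" using DERIV_unique[OF z(3) D] z by simp
    also have "\<dots> \<le> norm (- x) * norm (G (p z))" by (rule norm_cauchy_schwarz)
    also have "\<dots> \<le> k * r" using G[of z] z x(2) r0 by (simp add: mult.commute mult_right_mono)
    finally have "t * l \<le> t * (k * r)" using t by simp
    moreover have "u (p 0) = 0" using u x(1) by (simp add: dirichlet_solution_def p_def)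
    ultimately show ?thesis using z(4) by simp
  qed
  \<comment> \<open>Barrier minus the upper bound for \<open>u\<close>: it vanishes at 0 and has
    slope r (flux r - k) > 0 there.\<close>
  define h where "h t = mass * radial_kernel CARD('n) r ((1 - t) * r) - t * (k * r)" for t
  have "(h has_real_derivative (- flux r) * (- r) - k * r) (at 0)"
  proof -
    have "((\<lambda>t. (1 - t) * r) has_real_derivative - r) (at 0)" by (auto intro!: derivative_eq_intros)
    moreover have "((\<lambda>\<rho>. mass * radial_kernel CARD('n) r \<rho>) has_real_derivative - flux r) (at ((1 - 0) * r))"
      using DERIV_mass_kernel[OF r0] by simp
    ultimately have "((\<lambda>t. mass * radial_kernel CARD('n) r ((1 - t) * r)) has_real_derivative (- flux r) * (- r)) (at 0)"
      using DERIV_chain2 by fast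
    then show ?thesis unfolding h_def by (rule DERIV_diff) (auto intro!: derivative_eq_intros)
  qed
  moreover have "0 < (- flux r) * (- r) - k * r" using k r0 by (simp add: mult_strict_right_mono)
  ultimately obtain d' where d': "0 < d'" "\<And>t. 0 < t \<Longrightarrow> t < d' \<Longrightarrow> h 0 < h (0 + t)"
    using DERIV_pos_inc_right[of h _ 0] by blast
  \<comment> \<open>1/2 keeps \<open>t\<close> below 1, \<open>d'\<close> makes \<open>h\<close>
    positive, d / (2r) keeps the point where the gradient bound holds, and 1 - R / r keeps it at
    distance at least \<open>R\<close> from 0, where the closed form of the potential is
    valid.\<close>
  define t where "t = min (min (1/2) (d' / 2)) (min (d / (2 * r)) (1 - R / r))"
  have "R / r < 1" using r R by simp
  have t: "0 < t" "t < 1" "t < d'" "t \<le> d / (2 * r)" "t \<le> 1 - R / r"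
  proof -
    have le: "t \<le> 1/2" "t \<le> d' / 2" "t \<le> d / (2 * r)" "t \<le> 1 - R / r"
      unfolding t_def by linarith+
    show "0 < t" using d(1) d'(1) r0 \<open>R / r < 1\<close> by (simp add: t_def)
    show "t < 1" "t < d'" using le(1,2) d'(1) by linarith+
    show "t \<le> d / (2 * r)" "t \<le> 1 - R / r" by (fact le)+
  qed
  have "t * r < d" using t(4) d r0 by (simp add: field_simps)
  have "R \<le> (1 - t) * r" using t(5) r0 by (simp add: field_simps)
  then have "potential r (p t) = mass * radial_kernel CARD('n) r ((1 - t) * r)"
    using potential_outside[of "p t" r] p(1)[of t] t by simp
  moreover have "norm (p t) \<le> r" using p(1)[of t] t r0 by (simp add: mult_left_le_one_le)
  then have "potential r (p t) \<le> u (p t)" by (rule potential_le_solution[OF assms(1,2) u r])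
  moreover have "0 < h t" using d'(2)[of t] t by (simp add: h_def)
  ultimately show False using u_le[OF t(1,2) \<open>t * r < d\<close>] by (simp add: h_def)
qed

text \<open>The boundary may be irregular at \<open>x\<close>. If \<open>|\<nabla>u| > k\<close> near \<open>x\<close>, a maximum point of
  \<open>u - k |\<cdot> - y|\<close> near \<open>x\<close> must lie on the sphere of radius \<open>s\<close> about \<open>x\<close> (this replaces the
  gradient flow from \<open>y\<close>), so \<open>u\<close> reaches there at least about \<open>k s\<close>, too much for the barrier
  \<open>potential\<^sub>r\<close>.\<close>

lemma flux_ge_at_outer_contact:
  assumes "open \<Omega>" "bounded \<Omega>" and u: "dirichlet_solution \<Omega> f u" and bg: "boundary_gradient_norm \<Omega> u g"
    and r: "R < r" "\<Omega> \<subseteq> ball 0 r" and x: "x \<in> frontier \<Omega>" "norm x = r"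
  shows "g x \<le> flux r"
proof (rule ccontr)
  assume "\<not> g x \<le> flux r"
  then obtain k where k: "flux r < k" "k < g x" using dense[of "flux r" "g x"] by auto
  \<comment> \<open>Two levels: \<open>k'\<close> limits the barrier from above, \<open>k\<close>
    the gradient from below. The gap pays for the base point \<open>y\<close> being only near
    x.\<close>
  then obtain k' where k': "flux r < k'" "k' < k" using dense[of "flux r" k] by auto
  have r0: "0 < r" using r R by simp
  have k'0: "0 < k'" "0 < k" using flux_nonneg[OF r0] k' by auto
  obtain G where G: "\<forall>\<^sub>F y in at x within \<Omega>. GDERIV u y :> G y" "((\<lambda>y. norm (G y)) \<longlongrightarrow> g x) (at x within \<Omega>)"
    using boundary_gradient_normE[OF bg] x(1) by metis
  from G(1) have "\<forall>\<^sub>F y in at x within \<Omega>. GDERIV u y :> G y \<and> k < norm (G y)"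
    by (rule eventually_conj[OF _ order_tendstoD(1)[OF G(2) k(2)]])
  then obtain d where d: "0 < d" "\<And>y. y \<in> \<Omega> \<Longrightarrow> y \<noteq> x \<Longrightarrow> dist y x < d \<Longrightarrow> GDERIV u y :> G y \<and> k < norm (G y)"
    unfolding eventually_at by auto
  define h where "h \<rho> = mass * radial_kernel CARD('n) r \<rho> + k' * \<rho>" for \<rho>
  have "(h has_real_derivative - flux r + k') (at r)"
    unfolding h_def by (rule DERIV_add[OF DERIV_mass_kernel[OF r0]]) (auto intro!: derivative_eq_intros)
  moreover have "0 < - flux r + k'" using k' by simp
  ultimately obtain d' where d': "0 < d'" "\<And>t. 0 < t \<Longrightarrow> t < d' \<Longrightarrow> h (r - t) < h r"
    using DERIV_pos_inc_left[of h _ r] by blast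
  \<comment> \<open>Small enough for the gradient bound (\<open>d\<close>), the barrier estimate
    (\<open>d'\<close>) and the closed form of the potential (r - R).\<close>
  define s where "s = min (d / 2) (min (d' / 2) (r - R))"
  have s: "0 < s" "s < d" "s < d'" "s \<le> r - R" using d d' r by (auto simp: s_def min_def)
  have x\<Omega>: "x \<notin> \<Omega>" "x \<in> closure \<Omega>" using x(1) \<open>open \<Omega>\<close> by (auto simp: frontier_def interior_open)
  have u_le: "u z \<le> k' * s" if z: "z \<in> closure \<Omega>" "dist z x \<le> s" for z
  proof -
    have zr: "norm z \<le> r" using z(1) closure_mono[OF r(2)] r0 by auto
    have nz: "r - s \<le> norm z" using z(2) x(2) norm_triangle_ineq2[of x z] by (simp add: dist_norm norm_minus_commute)
    have "u z \<le> potential r z" by (rule solution_le_potential[OF assms(1,2) u r z(1)])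
    also have "potential r z = mass * radial_kernel CARD('n) r (norm z)" using nz s by (intro potential_outside) simp
    also have "\<dots> \<le> k' * (r - norm z)"
    proof (cases "norm z = r")
      case False
      then show ?thesis using d'(2)[of "r - norm z"] zr nz s by (simp add: h_def algebra_simps)
    qed simp
    also have "\<dots> \<le> k' * s" using nz k'0 by simp
    finally show ?thesis .
  qed
  \<comment> \<open>With this choice k (s - \<open>\<eta>\<close>) = s (k + k') / 2, halfway between
    k' s and k s.\<close>
  define \<eta> where "\<eta> = s * (k - k') / (2 * k)"
  have \<eta>: "0 < \<eta>" "k' * s < k * (s - \<eta>)" using s k' k'0 by (auto simp: \<eta>_def field_simps)
  have "\<eta> < s" using \<eta> k'0 s by (smt (verit) mult_nonneg_nonneg mult_pos_pos mult_nonneg_nonpos)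
  obtain y where y: "y \<in> \<Omega>" "dist y x < \<eta>" using x\<Omega>(2) \<eta>(1) closure_approachable by blast
  define F where "F z = u z - k * dist z y" for z
  define K where "K = closure \<Omega> \<inter> cball x s"
  have "compact K" unfolding K_def using \<open>bounded \<Omega>\<close> by (intro compact_Int) auto
  moreover have yK: "y \<in> K" using y \<open>\<eta> < s\<close> closure_subset by (auto simp: K_def dist_commute)
  moreover have "continuous_on K F"
    unfolding F_def using u by (auto simp: dirichlet_solution_def K_def intro!: continuous_intros intro: continuous_on_subset)
  ultimately obtain z where z: "z \<in> K" "\<And>y. y \<in> K \<Longrightarrow> F y \<le> F z"
    using continuous_attains_sup[of K F] by blast
  have "0 \<le> u y" using y closure_subset by (intro solution_nonneg[OF assms(1,2) u]) auto
  then have Fz: "0 \<le> F z" using z(2)[OF yK] by (simp add: F_def)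
  \<comment> \<open>On the boundary \<open>u\<close> is 0, so \<open>F\<close> is negative there,
    while F z \<ge> F y = u y \<ge> 0.\<close>
  have z\<Omega>: "z \<in> \<Omega>"
  proof (rule ccontr)
    assume "z \<notin> \<Omega>"
    then have "z \<in> frontier \<Omega>" "z \<noteq> y" using z(1) y \<open>open \<Omega>\<close> by (auto simp: K_def frontier_def interior_open)
    then have "u z = 0" "0 < k * dist z y" using u k'0 by (auto simp: dirichlet_solution_def)
    then show False using Fz by (simp add: F_def)
  qed
  show False
  proof (cases "dist z x < s")
    case True
    have zx: "z \<noteq> x" using z\<Omega> x\<Omega> by blast
    then have G: "GDERIV u z :> G z" "k < norm (G z)" using d(2)[OF z\<Omega> zx] True s by auto
    then have Gn: "G z \<noteq> 0" using k'0 by auto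
    \<comment> \<open>Along the gradient \<open>u\<close> grows faster than rate \<open>k\<close>,
      the penalty by the triangle inequality at rate at most \<open>k\<close>; hence no maximum
      inside the ball about x.\<close>
    define e where "e = G z /\<^sub>R norm (G z)"
    have e: "norm e = 1" "e \<bullet> G z = norm (G z)"
      using Gn by (auto simp: e_def power2_norm_eq_inner[symmetric] power2_eq_square)
    have "((\<lambda>t. u (z + t *\<^sub>R e) - k * t) has_real_derivative norm (G z) - k) (at 0)"
      using gderiv_line[of u z 0 e "G z"] G e by (auto intro!: derivative_eq_intros)
    moreover have "0 < norm (G z) - k" using G by simp
    ultimately obtain c where c: "0 < c" "\<And>t. 0 < t \<Longrightarrow> t < c \<Longrightarrow> u (z + 0 *\<^sub>R e) - k * 0 < u (z + (0 + t) *\<^sub>R e) - k * (0 + t)"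
      using DERIV_pos_inc_right[of "\<lambda>t. u (z + t *\<^sub>R e) - k * t" _ 0] by blast
    have "open (\<Omega> \<inter> ball x s)" "z \<in> \<Omega> \<inter> ball x s" using \<open>open \<Omega>\<close> z\<Omega> True by (auto simp: dist_commute)
    then obtain b where b: "0 < b" "ball z b \<subseteq> \<Omega> \<inter> ball x s" using open_contains_ball by blast
    define t where "t = min c b / 2"
    have t: "0 < t" "t < c" "t < b" using b c by (auto simp: t_def)
    have "z + t *\<^sub>R e \<in> ball z b" using t e by (simp add: dist_norm)
    then have "z + t *\<^sub>R e \<in> K" using b closure_subset by (fastforce simp: K_def)
    then have "F (z + t *\<^sub>R e) \<le> F z" by (rule z(2))
    moreover have "dist (z + t *\<^sub>R e) y \<le> dist z y + t"
      using dist_triangle[of "z + t *\<^sub>R e" y z] t e by (simp add: dist_norm)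
    then have "k * dist (z + t *\<^sub>R e) y \<le> k * dist z y + k * t" using k'0 by (simp add: distrib_left[symmetric])
    ultimately show False using c(2)[of t] t by (simp add: F_def)
  next
    case False
    then have "s - \<eta> \<le> dist z y" using y dist_triangle[of z x y] by (simp add: dist_commute)
    then have "k * (s - \<eta>) \<le> k * dist z y" using k'0 by simp
    then have "k * (s - \<eta>) \<le> u z" using Fz by (simp add: F_def)
    moreover have "u z \<le> k' * s" using z(1) by (intro u_le) (auto simp: K_def dist_commute)
    ultimately show False using \<eta> by simp
  qed
qed

end


section \<open>Shape of the domain\<close>

text \<open>The union defining the support may be uncountable; Lindelof's theorem extracts a
  countable subfamily with the same union, and countably many null sets form a null set.\<close>

lemma AE_not_in_ess_support: "AE x in lebesgue. x \<notin> ess_support f \<longrightarrow> f x = 0"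
proof -
  let ?\<U> = "{U. open U \<and> (AE x in lebesgue. x \<in> U \<longrightarrow> f x = 0)}"
  obtain \<U>' where \<U>': "\<U>' \<subseteq> ?\<U>" "countable \<U>'" "\<Union>\<U>' = \<Union>?\<U>"
    using Lindelof[of ?\<U>] by auto
  have "AE x in lebesgue. \<forall>U\<in>\<U>'. x \<in> U \<longrightarrow> f x = 0"
    using \<U>'(1,2) by (subst AE_ball_countable) auto
  then show ?thesis
  proof eventually_elim
    case (elim x)
    show ?case
    proof
      assume "x \<notin> ess_support f"
      then have "x \<in> \<Union>\<U>'" unfolding \<U>'(3) ess_support_def by blast
      then show "f x = 0" using elim by blast
    qed
  qed
qed

text \<open>Radial projection carries the punctured ball onto the sphere, so the sphere has measure
  N / r times the volume of the ball.\<close>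

lemma sphere_integral_radial:
  fixes g :: "real^'n \<Rightarrow> real"
  assumes r: "0 < r" and g: "\<And>x. norm x = r \<Longrightarrow> g x = c"
  shows "sphere_integral r g = unit_sphere_area CARD('n) * (r ^ (CARD('n) - 1) * c)"
proof -
  let ?M = "sphere_measure r :: (real^'n) measure"
  let ?S = "sphere 0 r :: (real^'n) set"
  obtain m where m: "CARD('n) = Suc m" using zero_less_card_finite[where 'a='n] by (metis Suc_pred)
  have [measurable]: "(\<lambda>x::real^'n. (r / norm x) *\<^sub>R x) \<in> borel_measurable borel" by measurable
  have "ball (0::real^'n) r \<in> sets borel" by simp
  then have [measurable]: "(\<lambda>x::real^'n. ennreal (real CARD('n) / r) * indicator (ball 0 r) x) \<in> borel_measurable borel"
    by measurable
  have "emeasure ?M ?S = emeasure (density lborel (\<lambda>x. ennreal (real CARD('n) / r) * indicator (ball 0 r) x)) ((\<lambda>x. (r / norm x) *\<^sub>R x) -` ?S \<inter> UNIV)"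
    unfolding sphere_measure_def by (subst emeasure_distr) auto
  \<comment> \<open>The origin drops out because r / 0 = 0 maps it to 0.\<close>
  also have "(\<lambda>x::real^'n. (r / norm x) *\<^sub>R x) -` ?S \<inter> UNIV = - {0}"
    using r by auto
  also have "emeasure (density lborel (\<lambda>x::real^'n. ennreal (real CARD('n) / r) * indicator (ball 0 r) x)) (- {0})
      = (\<integral>\<^sup>+x. ennreal (real CARD('n) / r) * indicator (ball 0 r) x * indicator (- {0}) (x :: real^'n) \<partial>lborel)"
    by (subst emeasure_density) auto
  also have "\<dots> = (\<integral>\<^sup>+x. ennreal (real CARD('n) / r) * indicator (ball 0 r) (x :: real^'n) \<partial>lborel)"
    by (rule nn_integral_cong_AE) (use AE_norm_neq[of 0] in \<open>eventually_elim, auto simp: indicator_def\<close>)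
  also have "\<dots> = ennreal (real CARD('n) / r) * emeasure lborel (ball (0::real^'n) r)"
    by (subst nn_integral_cmult_indicator) auto
  also have "emeasure lborel (ball (0::real^'n) r) = ennreal (unit_ball_vol CARD('n) * r ^ CARD('n))"
    using emeasure_lborel_ball_finite[of "0::real^'n" r] r by (subst emeasure_eq_ennreal_measure) (auto simp: content_ball)
  also have "ennreal (real CARD('n) / r) * \<dots> = ennreal (unit_sphere_area CARD('n) * r ^ (CARD('n) - 1))"
  proof -
    have "real CARD('n) / r * (unit_ball_vol CARD('n) * r ^ CARD('n)) = unit_sphere_area CARD('n) * r ^ (CARD('n) - 1)"
      using r by (simp add: unit_sphere_area_def m)
    then show ?thesis using r by (subst ennreal_mult[symmetric]) simp_all
  qed
  finally have em: "emeasure ?M ?S = ennreal (unit_sphere_area CARD('n) * r ^ (CARD('n) - 1))" .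
  have "sphere_integral r g = (LINT x|?M. indicator ?S x * c)"
    unfolding sphere_integral_def set_lebesgue_integral_def
    by (rule Bochner_Integration.integral_cong[OF refl]) (auto simp: indicator_def g)
  also have "\<dots> = measure ?M ?S * c"
    by (simp add: sphere_measure_def)
  also have "measure ?M ?S = unit_sphere_area CARD('n) * r ^ (CARD('n) - 1)"
    unfolding measure_def em using r unit_sphere_area_pos[of "CARD('n)"] by simp
  finally show ?thesis by simp
qed

section \<open>Rigidity of solutions and explicit solutions on balls\<close>

context radial_source begin

lemma mass_eq: "(LINT x:cball 0 R|lebesgue. f x) = mass"
  unfolding mass_def set_lebesgue_integral_def
proof (rule integral_cong_AE)
  show "(\<lambda>x. indicator (cball 0 R) x *\<^sub>R f x) \<in> borel_measurable lebesgue"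
    using f_measurable by (intro borel_measurable_scaleR borel_measurable_indicator) auto
  show "AE x in lebesgue. indicator (cball 0 R) x *\<^sub>R f x = f x"
    using f_support by eventually_elim (auto simp: indicator_def not_le)
qed (rule f_measurable)

lemma flux_le_iff:
  assumes "0 < r"
  shows "flux r \<le> c \<longleftrightarrow> mass \<le> unit_sphere_area CARD('n) * (r ^ (CARD('n) - 1) * c)"
    "c \<le> flux r \<longleftrightarrow> unit_sphere_area CARD('n) * (r ^ (CARD('n) - 1) * c) \<le> mass"
  using assms unit_sphere_area_pos[of "CARD('n)"] by (simp_all add: flux_def field_simps)

text \<open>The two radii are the least and the greatest norm on the boundary; compactness provides
  points realising them, where the contact estimates apply. The value of the mass is recorded
  because it gives the necessary condition.\<close>

lemma solution_is_ball:
  fixes g' :: "real \<Rightarrow> real"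
  assumes "open \<Omega>" "bounded \<Omega>" "cball 0 R \<subset> \<Omega>" and u: "dirichlet_solution \<Omega> f u" and bg: "boundary_gradient_norm \<Omega> u g"
    and g: "\<And>x. g x = g' (norm x)"
    and incr: "strict_mono_on {R..} (\<lambda>\<rho>. \<rho> ^ (CARD('n) - 1) * g' \<rho>)"
  shows "\<exists>r>R. \<Omega> = ball 0 r \<and> mass = unit_sphere_area CARD('n) * (r ^ (CARD('n) - 1) * g' r)"
proof -
  have "0 \<in> cball 0 R" using R by simp
  with assms(3) have 0: "0 \<in> \<Omega>" by blast
  have cf: "compact (frontier \<Omega>)" using \<open>bounded \<Omega>\<close> by (rule compact_frontier_bounded)
  have "\<Omega> \<noteq> UNIV" using \<open>bounded \<Omega>\<close> not_bounded_UNIV by blast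
  then have nf: "frontier \<Omega> \<noteq> {}" using frontier_eq_empty[of \<Omega>] 0 by blast
  have cn: "continuous_on A (norm :: real^'n \<Rightarrow> real)" for A by (intro continuous_intros)
  obtain x1 where x1: "x1 \<in> frontier \<Omega>" "\<And>y. y \<in> frontier \<Omega> \<Longrightarrow> norm x1 \<le> norm y"
    using continuous_attains_inf[OF cf nf cn] by blast
  obtain x2 where x2: "x2 \<in> frontier \<Omega>" "\<And>y. y \<in> frontier \<Omega> \<Longrightarrow> norm y \<le> norm x2"
    using continuous_attains_sup[OF cf nf cn] by blast
  have out: "R < norm x" if "x \<in> frontier \<Omega>" for x
  proof -
    have "x \<notin> \<Omega>" using that \<open>open \<Omega>\<close> by (simp add: frontier_def interior_open)
    then show ?thesis using assms(3) by (auto simp: not_le[symmetric])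
  qed
  \<comment> \<open>This ball is connected, contains 0 and misses the boundary, so it cannot leave
    \<open>\<Omega>\<close>.\<close>
  have inner: "ball 0 (norm x1) \<subseteq> \<Omega>"
  proof (rule ccontr)
    assume "\<not> ball 0 (norm x1) \<subseteq> \<Omega>"
    then have out': "ball 0 (norm x1) - \<Omega> \<noteq> {}" by blast
    have "0 < norm x1" using out[OF x1(1)] R by linarith
    then have "ball 0 (norm x1) \<inter> \<Omega> \<noteq> {}" using 0 by (intro ex_in_conv[THEN iffD1] exI[of _ 0]) simp
    then have "ball 0 (norm x1) \<inter> frontier \<Omega> \<noteq> {}"
      using out' by (intro connected_Int_frontier connected_ball)
    then show False using x1(2) by force
  qed
  have outer: "\<Omega> \<subseteq> ball 0 (norm x2)"
  proof -
    have "compact (closure \<Omega>)" "closure \<Omega> \<noteq> {}" using \<open>bounded \<Omega>\<close> 0 closure_subset by auto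
    then obtain p where p: "p \<in> closure \<Omega>" "\<And>y. y \<in> closure \<Omega> \<Longrightarrow> norm y \<le> norm p"
      using continuous_attains_sup[OF _ _ cn] by metis
    \<comment> \<open>Openness allows a push outwards along the ray, in any direction if the point
      is 0. So a farthest point of the closure lies on the boundary, and the enclosing ball can be
      taken open.\<close>
    have far: "\<exists>y\<in>\<Omega>. norm x < norm y" if x: "x \<in> \<Omega>" for x
    proof -
      obtain e where e: "0 < e" "cball x e \<subseteq> \<Omega>" using \<open>open \<Omega>\<close> x open_contains_cball by blast
      show ?thesis
      proof (cases "x = 0")
        case True
        then have "(e *\<^sub>R axis undefined 1 :: real^'n) \<in> \<Omega>" using e by (auto simp: subset_iff norm_axis_1)
        then show ?thesis using True e by (intro bexI[of _ "e *\<^sub>R axis undefined 1"]) (auto simp: norm_axis_1)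
      next
        case False
        let ?y = "(1 + e / norm x) *\<^sub>R x"
        have "?y - x = (e / norm x) *\<^sub>R x" by (simp add: algebra_simps)
        then have "norm (?y - x) = \<bar>e / norm x\<bar> * norm x" by (simp only: norm_scaleR)
        also have "\<dots> = e" using False e by simp
        finally have "dist x ?y = e" by (simp only: dist_norm norm_minus_commute)
        moreover have "norm ?y = norm x + e" using False e by (simp add: distrib_right)
        ultimately show ?thesis using e by (intro bexI[of _ ?y]) (auto simp: subset_iff)
      qed
    qed
    have "p \<notin> \<Omega>" using far[of p] p(2) closure_subset by force
    then have "p \<in> frontier \<Omega>" using p \<open>open \<Omega>\<close> by (simp add: frontier_def interior_open)
    then have "norm p \<le> norm x2" by (rule x2(2))
    show ?thesis
    proof
      fix x assume "x \<in> \<Omega>"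
      then obtain y where "y \<in> \<Omega>" "norm x < norm y" using far by blast
      then show "x \<in> ball 0 (norm x2)" using p(2)[of y] closure_subset \<open>norm p \<le> norm x2\<close> by (force simp: subset_iff)
    qed
  qed
  note pos = out[OF x1(1)] out[OF x2(1)] R
  have n: "0 < norm x1" "0 < norm x2" using pos by linarith+
  let ?\<sigma> = "unit_sphere_area CARD('n)" and ?h = "\<lambda>\<rho>. \<rho> ^ (CARD('n) - 1) * g' \<rho>"
  have \<sigma>: "0 < ?\<sigma>" by (intro unit_sphere_area_pos) simp
  have "flux (norm x1) \<le> g x1"
    by (rule flux_le_at_inner_contact[OF assms(1,2) u bg pos(1) inner x1(1) refl])
  then have i: "mass \<le> ?\<sigma> * ?h (norm x1)" unfolding g flux_le_iff(1)[OF n(1)] .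
  have "g x2 \<le> flux (norm x2)"
    by (rule flux_ge_at_outer_contact[OF assms(1,2) u bg pos(2) outer x2(1) refl])
  then have o: "?\<sigma> * ?h (norm x2) \<le> mass" unfolding g flux_le_iff(2)[OF n(2)] .
  have "?\<sigma> * ?h (norm x2) \<le> ?\<sigma> * ?h (norm x1)" using i o by linarith
  then have "?h (norm x2) \<le> ?h (norm x1)" using \<sigma> by (rule mult_left_le_imp_le)
  then have "\<not> norm x1 < norm x2" using strict_mono_onD[OF incr, of "norm x1" "norm x2"] pos by auto
  then have eq: "norm x1 = norm x2" using x1(2)[OF x2(1)] by simp
  then have "\<Omega> = ball 0 (norm x1)" using inner outer by auto
  moreover have "mass = ?\<sigma> * ?h (norm x1)" using i o eq by simp
  ultimately show ?thesis using pos by blast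
qed

lemma boundary_gradient_norm_potential:
  assumes r: "R < r" and g: "\<And>x. norm x = r \<Longrightarrow> g x = flux r"
  shows "boundary_gradient_norm (ball 0 r) (potential r) g"
  unfolding boundary_gradient_norm_def
proof (intro exI ballI conjI)
  define G where "G y = (- flux (norm y)) *\<^sub>R sgn y" for y :: "real^'n"
  have r0: "0 < r" using r R by simp
  have GD: "GDERIV (potential r) y :> G y" if y: "R < norm y" for y
  proof -
    have y0: "y \<noteq> 0" "0 < norm y" using y R by auto
    have "GDERIV (\<lambda>x. mass * radial_kernel CARD('n) r (norm x)) y :> G y"
      unfolding G_def by (rule GDERIV_DERIV_compose[OF GDERIV_norm[OF y0(1)] DERIV_mass_kernel[OF y0(2)]])
    then show ?thesis
      unfolding gderiv_def
    proof (rule has_derivative_transform_within_open)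
      show "open (- cball (0::real^'n) R)" by (rule open_Compl) simp
      show "y \<in> - cball 0 R" using y by simp
      show "mass * radial_kernel CARD('n) r (norm x) = potential r x" if "x \<in> - cball 0 R" for x
        using potential_outside[of x r] that by simp
    qed
  qed
  fix x :: "real^'n" assume "x \<in> frontier (ball 0 r)"
  then have x: "norm x = r" "x \<noteq> 0" using r0 by auto
  have "\<forall>\<^sub>F y in at x within ball 0 r. y \<in> - cball 0 R"
    by (rule topological_tendstoD[OF tendsto_ident_at]) (use x r in \<open>auto intro: open_Compl\<close>)
  then have ev: "\<forall>\<^sub>F y in at x within ball 0 r. R < norm y" by (simp add: not_le)
  then show "\<forall>\<^sub>F y in at x within ball 0 r. GDERIV (potential r) y :> G y" by eventually_elim (rule GD)
  have "((\<lambda>y. flux (norm y)) \<longlongrightarrow> flux (norm x)) (at x within ball 0 r)"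
    unfolding flux_def using x r0 unit_sphere_area_pos[of "CARD('n)"] by (intro tendsto_intros) auto
  moreover have "\<forall>\<^sub>F y in at x within ball 0 r. flux (norm y) = norm (G y)"
    using ev
  proof eventually_elim
    case (elim y)
    then have "0 < norm y" using R by linarith
    then show ?case using flux_nonneg[of "norm y"] by (simp add: G_def norm_sgn)
  qed
  ultimately show "((\<lambda>y. norm (G y)) \<longlongrightarrow> g x) (at x within ball 0 r)"
    using g[OF x(1)] x(1) by (simp add: Lim_transform_eventually)
qed

end

text \<open>The last conjunct carries what the intermediate value theorem needs: a strictly
  increasing function might jump over the value of the mass, and the radius where it is attained has
  to fit into \<open>D\<close>.\<close>

theorem theorem9p1:
  fixes D :: "(real^'n) set"
    and f g :: "real^'n \<Rightarrow> real"
    and f' g' :: "real \<Rightarrow> real"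
    and R :: real
  assumes dim: "CARD('n) = 2 \<or> CARD('n) = 3"
    and D: "open D" "connected D" "bounded D"
    and f_L2: "L2_on UNIV f"
    and g_L2: "L2_on D g"
    and f_nonneg: "\<forall>x. 0 \<le> f x"
    and g_pos: "\<forall>x. 0 < g x"
    and f_supp: "compact (ess_support f)" "interior (ess_support f) \<noteq> {}"
    and R: "0 < R"
    and C: "convex hull (ess_support f) = cball 0 R"
    and f_radial: "\<forall>x. f x = f' (norm x)"
    and g_radial: "\<forall>x. g x = g' (norm x)"
    and g_incr: "strict_mono_on {R..} (\<lambda>\<rho>. \<rho> ^ (CARD('n) - 1) * g' \<rho>)"
  shows "(\<forall>\<Omega>. solves_QS D f g \<Omega> \<longrightarrow> (\<exists>r>R. \<Omega> = ball 0 r))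
    \<and> ((\<exists>r. solves_QS D f g (ball 0 r)) \<longrightarrow>
         (LINT x:cball 0 R|lebesgue. f x) > sphere_integral R g)
    \<and> (continuous_on {R..} g' \<and>
       (\<exists>\<rho>>R. ball 0 \<rho> \<subseteq> D \<and> (LINT x:cball 0 R|lebesgue. f x) \<le> sphere_integral \<rho> g) \<longrightarrow>
         ((\<exists>r. solves_QS D f g (ball 0 r)) \<longleftrightarrow>
          (LINT x:cball 0 R|lebesgue. f x) > sphere_integral R g))"
proof -
  have supp: "AE x in lebesgue. R < norm x \<longrightarrow> f x = 0"
    using AE_not_in_ess_support[of f]
  proof eventually_elim
    case (elim x)
    have "ess_support f \<subseteq> cball 0 R" using hull_subset[of "ess_support f" convex] C by simp
    with elim show ?case by auto
  qed
  interpret radial_source f f' R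
  proof
    show "f \<in> borel_measurable lebesgue" "integrable lebesgue (\<lambda>x. (f x)\<^sup>2)"
      using f_L2 by (simp_all add: L2_on_def set_borel_measurable_def set_integrable_def)
    show "0 \<le> f x" "f x = f' (norm x)" for x using f_nonneg f_radial by blast+
  qed (fact dim R supp)+
  let ?\<sigma> = "unit_sphere_area CARD('n)" and ?h = "\<lambda>\<rho>. \<rho> ^ (CARD('n) - 1) * g' \<rho>"
  have \<sigma>: "0 < ?\<sigma>" by (intro unit_sphere_area_pos) simp
  have sph: "sphere_integral \<rho> g = ?\<sigma> * ?h \<rho>" if "0 < \<rho>" for \<rho>
    by (rule sphere_integral_radial[OF that]) (simp add: g_radial)
  have ball: "\<exists>r>R. \<Omega> = ball 0 r \<and> mass = ?\<sigma> * ?h r" if sol: "solves_QS D f g \<Omega>" for \<Omega>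
  proof -
    obtain u where u: "dirichlet_solution \<Omega> f u" "boundary_gradient_norm \<Omega> u g"
      and \<Omega>: "open \<Omega>" "\<Omega> \<subseteq> D" "cball 0 R \<subset> \<Omega>"
      using sol C by (auto simp: solves_QS_def)
    show ?thesis
      by (rule solution_is_ball[OF \<Omega>(1) bounded_subset[OF D(3) \<Omega>(2)] \<Omega>(3) u _ g_incr]) (use g_radial in blast)
  qed
  have necessary: "sphere_integral R g < mass" if sol: "solves_QS D f g (ball 0 r)" for r
  proof -
    \<comment> \<open>At the radius of a solution the boundary integral equals the mass, and it is
      strictly larger there than at \<open>R\<close>.\<close>
    obtain r' where r': "R < r'" "mass = ?\<sigma> * ?h r'" using ball[OF sol] by blast
    then have "?h R < ?h r'" using strict_mono_onD[OF g_incr, of R r'] by simp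
    then have "?\<sigma> * ?h R < ?\<sigma> * ?h r'" using \<sigma> by (rule mult_strict_left_mono)
    then show ?thesis using r'(2) sph[OF R] by simp
  qed
  have sufficient: "\<exists>r. solves_QS D f g (ball 0 r)"
    if cont: "continuous_on {R..} g'" and \<rho>: "R < \<rho>" "ball 0 \<rho> \<subseteq> D" "mass \<le> sphere_integral \<rho> g"
      and lt: "sphere_integral R g < mass" for \<rho>
  proof -
    have "continuous_on {R..\<rho>} (\<lambda>\<rho>. ?\<sigma> * ?h \<rho>)"
      by (intro continuous_intros continuous_on_subset[OF cont]) auto
    \<comment> \<open>The intermediate value theorem may return the end point \<open>R\<close>; the
      strict inequality rules it out next.\<close>
    then obtain r where r: "R \<le> r" "r \<le> \<rho>" "?\<sigma> * ?h r = mass"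
      using IVT'[of "\<lambda>\<rho>. ?\<sigma> * ?h \<rho>" R mass \<rho>] \<rho> lt sph R by auto
    have "r \<noteq> R" using r(3) lt sph[OF R] by auto
    with r have Rr: "R < r" by simp
    then have r0: "0 < r" using R by simp
    have fl: "g' r = flux r" using flux_le_iff[OF r0, of "g' r"] r(3) by linarith
    have "cball 0 R \<subset> (ball 0 r :: (real^'n) set)"
    proof
      show "cball 0 R \<subseteq> (ball 0 r :: (real^'n) set)" using Rr by auto
      have "((R + r) / 2) *\<^sub>R axis undefined 1 \<in> (ball 0 r :: (real^'n) set)" "((R + r) / 2) *\<^sub>R axis undefined 1 \<notin> (cball 0 R :: (real^'n) set)"
        using Rr R by (simp_all add: norm_axis_1)
      then show "cball 0 R \<noteq> (ball 0 r :: (real^'n) set)" by blast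
    qed
    moreover have "ball 0 r \<subseteq> D" using \<rho>(2) r(2) by (meson order_trans subset_ball)
    ultimately have "solves_QS D f g (ball 0 r)"
      unfolding solves_QS_def C
      using dirichlet_solution_potential[OF Rr] boundary_gradient_norm_potential[OF Rr, of g] fl g_radial by auto
    then show ?thesis by blast
  qed
  show ?thesis
    unfolding mass_eq using ball necessary sufficient by blast
qed

end
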